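(* Let $\mathcal A$ be a $C^*$-algebroid with unit. The following are equivalent: (1) for every $s,t\in S_{\mathcal A}$ and every $x\in\mathcal A_s^t$ there exists $a\in\mathcal A_s^s$ with $x^*x=a^*a$; (2) there exist a family of Hilbert spaces $\{\mathcal H_s\}_{s\in S_{\mathcal A}}$ and an injective $*$-representation $\Phi$ of $\mathcal A$ with identity aggregation map, i.e. an injective map $\Phi$ with $\Phi(a)\in\mathcal B(\mathcal H_s,\mathcal H_t)$ for $a\in\mathcal A_s^t$, linear on each fibre, $\Phi(ab)=\Phi(a)\Phi(b)$ whenever $d(a)=c(b)$, and $\Phi(a^* )=\Phi(a)^*$; (3) for each $n\in\mathbb N$ there exists a system of norms on the amplification ${}^n\mathcal A$ extending the norms of $\mathcal A$ (with respect to the canonical embeddings of the fibres $\mathcal A_{s_j}^{t_i}$ as matrix entries) with respect to which ${}^n\mathcal A$ is a $C^*$-algebroid; (3') there exists such a system of norms on ${}^2\mathcal A$ making it a $C^*$-algebroid.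
   Context: An algebroid $\mathcal A$ consists of nonempty sets $\mathcal A$, $S_{\mathcal A}$, maps $d,c\colon\mathcal A\to S_{\mathcal A}$, and an associative partial product $ab$ defined when $d(a)=c(b)$ with $d(ab)=d(b)$, $c(ab)=c(a)$; each fibre $\mathcal A_s^t=\{a:d(a)=s,c(a)=t\}$ is a complex vector space and the product is bilinear. A unit is a family $\epsilon_s\in\mathcal A_s^s$ with $\epsilon_s a=a$ if $c(a)=s$ and $a\epsilon_s=a$ if $d(a)=s$. A $*$-algebroid has an involution $a\mapsto a^*$ with $d(a^* )=c(a)$, $c(a^* )=d(a)$, $(ab)^*=b^*a^*$, $a^{**}=a$, conjugate-linear on fibres. A $C^*$-algebroid is a $*$-algebroid with complete norms $\|\cdot\|_{s,t}$ on each $\mathcal A_s^t$ such that $\|ab\|_{s,t}\le\|a\|_{u,t}\|b\|_{s,u}$ ($a\in\mathcal A_u^t$, $b\in\mathcal A_s^u$), $\|a^*\|_{t,s}=\|a\|_{s,t}$, and $\|a^*a\|_{s,s}=\|a\|_{s,t}^2$ for $a\in\mathcal A_s^t$. The $n$-fold amplification ${}^n\mathcal A$ has object set $S_{\mathcal A}^n$ and, for $\mathbf s=(s_1,\dots,s_n)$, $\mathbf t=(t_1,\dots,t_n)$, fibre ${}^n\mathcal A_{\mathbf s}^{\mathbf t}$ consisting of $n\times n$ matrices $[a_{ij}]$ with $a_{ij}\in\mathcal A_{s_j}^{t_i}$, with matrix multiplication and involution $[a_{ij}]^*=[a_{ji}^*]$; a system of norms on ${}^n\mathcal A$ extends the norms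 of $\mathcal A$ if the norm of a matrix in ${}^n\mathcal A_{\mathbf s}^{\mathbf t}$ whose only nonzero entry is $a\in\mathcal A_{s_j}^{t_i}$ at position $(i,j)$ equals $\|a\|_{s_j,t_i}$. *)

theory Defs
  imports Complex_Main
begin

text \<open>An algebroid with (partial) structure.  Elements of all fibres live in one carrier
  set; the fibre of an element a is determined by (dm a, cd a).  The fibrewise vector space
  operations, the involution and the norms are given as total functions that are only
  constrained on the relevant fibres.  Since every element lies in exactly one fibre, the
  family of norms is represented by a single function nrm.\<close>

record ('a, 's) alg =
  Carr :: "'a set"
  Obj  :: "'s set"
  dm   :: "'a \<Rightarrow> 's"
  cd   :: "'a \<Rightarrow> 's"
  mul  :: "'a \<Rightarrow> 'a \<Rightarrow> 'a"
  add  :: "'a \<Rightarrow> 'a \<Rightarrow> 'a"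
  sml  :: "complex \<Rightarrow> 'a \<Rightarrow> 'a"
  zer  :: "'s \<Rightarrow> 's \<Rightarrow> 'a"
  inv  :: "'a \<Rightarrow> 'a"
  nrm  :: "'a \<Rightarrow> real"

definition fibre :: "('a, 's, 'z) alg_scheme \<Rightarrow> 's \<Rightarrow> 's \<Rightarrow> 'a set" where
  "fibre A s t = {a \<in> Carr A. dm A a = s \<and> cd A a = t}"

definition asub :: "('a, 's, 'z) alg_scheme \<Rightarrow> 'a \<Rightarrow> 'a \<Rightarrow> 'a" where
  "asub A a b = add A a (sml A (-1) b)"

definition algebroid :: "('a, 's, 'z) alg_scheme \<Rightarrow> bool" where
  "algebroid A \<longleftrightarrow>
     Carr A \<noteq> {} \<and> Obj A \<noteq> {} \<and>
     (\<forall>a\<in>Carr A. dm A a \<in> Obj A \<and> cd A a \<in> Obj A) \<and>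
     (\<forall>a\<in>Carr A. \<forall>b\<in>Carr A. dm A a = cd A b \<longrightarrow>
        mul A a b \<in> Carr A \<and> dm A (mul A a b) = dm A b \<and> cd A (mul A a b) = cd A a) \<and>
     (\<forall>a\<in>Carr A. \<forall>b\<in>Carr A. \<forall>c\<in>Carr A. dm A a = cd A b \<longrightarrow> dm A b = cd A c \<longrightarrow>
        mul A (mul A a b) c = mul A a (mul A b c)) \<and>
     \<comment> \<open>each fibre is a complex vector space\<close>
     (\<forall>s\<in>Obj A. \<forall>t\<in>Obj A.
        zer A s t \<in> fibre A s t \<and>
        (\<forall>a\<in>fibre A s t. \<forall>b\<in>fibre A s t. add A a b \<in> fibre A s t) \<and>
        (\<forall>c. \<forall>a\<in>fibre A s t. sml A c a \<in> fibre A s t) \<and>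
        (\<forall>a\<in>fibre A s t. \<forall>b\<in>fibre A s t. \<forall>c\<in>fibre A s t.
            add A (add A a b) c = add A a (add A b c)) \<and>
        (\<forall>a\<in>fibre A s t. \<forall>b\<in>fibre A s t. add A a b = add A b a) \<and>
        (\<forall>a\<in>fibre A s t. add A (zer A s t) a = a) \<and>
        (\<forall>a\<in>fibre A s t. \<exists>b\<in>fibre A s t. add A a b = zer A s t) \<and>
        (\<forall>c. \<forall>a\<in>fibre A s t. \<forall>b\<in>fibre A s t.
            sml A c (add A a b) = add A (sml A c a) (sml A c b)) \<and>
        (\<forall>c d. \<forall>a\<in>fibre A s t. sml A (c + d) a = add A (sml A c a) (sml A d a)) \<and>
        (\<forall>c d. \<forall>a\<in>fibre A s t. sml A (c * d) a = sml A c (sml A d a)) \<and>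
        (\<forall>a\<in>fibre A s t. sml A 1 a = a)) \<and>
     \<comment> \<open>the product is bilinear\<close>
     (\<forall>s\<in>Obj A. \<forall>u\<in>Obj A. \<forall>t\<in>Obj A.
        \<forall>a\<in>fibre A u t. \<forall>a'\<in>fibre A u t. \<forall>b\<in>fibre A s u. \<forall>b'\<in>fibre A s u. \<forall>c.
          mul A (add A a a') b = add A (mul A a b) (mul A a' b) \<and>
          mul A a (add A b b') = add A (mul A a b) (mul A a b') \<and>
          mul A (sml A c a) b = sml A c (mul A a b) \<and>
          mul A a (sml A c b) = sml A c (mul A a b))"

definition unital :: "('a, 's, 'z) alg_scheme \<Rightarrow> bool" where
  "unital A \<longleftrightarrow> (\<exists>\<epsilon>. \<forall>s\<in>Obj A. \<epsilon> s \<in> fibre A s s \<and>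
      (\<forall>a\<in>Carr A. (cd A a = s \<longrightarrow> mul A (\<epsilon> s) a = a) \<and> (dm A a = s \<longrightarrow> mul A a (\<epsilon> s) = a)))"

definition star_algebroid :: "('a, 's, 'z) alg_scheme \<Rightarrow> bool" where
  "star_algebroid A \<longleftrightarrow> algebroid A \<and>
     (\<forall>a\<in>Carr A. inv A a \<in> Carr A \<and> dm A (inv A a) = cd A a \<and> cd A (inv A a) = dm A a \<and>
        inv A (inv A a) = a) \<and>
     (\<forall>a\<in>Carr A. \<forall>b\<in>Carr A. dm A a = cd A b \<longrightarrow> inv A (mul A a b) = mul A (inv A b) (inv A a)) \<and>
     (\<forall>s\<in>Obj A. \<forall>t\<in>Obj A. \<forall>a\<in>fibre A s t. \<forall>b\<in>fibre A s t. \<forall>c.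
        inv A (add A a b) = add A (inv A a) (inv A b) \<and>
        inv A (sml A c a) = sml A (cnj c) (inv A a))"

definition cstar_algebroid :: "('a, 's, 'z) alg_scheme \<Rightarrow> bool" where
  "cstar_algebroid A \<longleftrightarrow> star_algebroid A \<and>
     \<comment> \<open>nrm restricted to each fibre is a norm\<close>
     (\<forall>s\<in>Obj A. \<forall>t\<in>Obj A.
        (\<forall>a\<in>fibre A s t. nrm A a \<ge> 0 \<and> (nrm A a = 0 \<longleftrightarrow> a = zer A s t)) \<and>
        (\<forall>a\<in>fibre A s t. \<forall>b\<in>fibre A s t. nrm A (add A a b) \<le> nrm A a + nrm A b) \<and>
        (\<forall>c. \<forall>a\<in>fibre A s t. nrm A (sml A c a) = cmod c * nrm A a) \<and>
        \<comment> \<open>completeness\<close>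
        (\<forall>X. (\<forall>n. X n \<in> fibre A s t) \<longrightarrow>
             (\<forall>e>0. \<exists>N. \<forall>m\<ge>N. \<forall>n\<ge>N. nrm A (asub A (X m) (X n)) < e) \<longrightarrow>
             (\<exists>L\<in>fibre A s t. (\<lambda>n. nrm A (asub A (X n) L)) \<longlonglongrightarrow> 0))) \<and>
     (\<forall>a\<in>Carr A. \<forall>b\<in>Carr A. dm A a = cd A b \<longrightarrow> nrm A (mul A a b) \<le> nrm A a * nrm A b) \<and>
     (\<forall>a\<in>Carr A. nrm A (inv A a) = nrm A a) \<and>
     (\<forall>a\<in>Carr A. nrm A (mul A (inv A a) a) = (nrm A a)\<^sup>2)"

text \<open>Matrices are functions nat => nat => 'a with entries outside the index range
  set to undefined; objects of the n-fold amplification are n-tuples, i.e. functions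
  nat => 's that are undefined outside the index range.\<close>

primrec fsum :: "('a, 's, 'z) alg_scheme \<Rightarrow> 's \<Rightarrow> 's \<Rightarrow> (nat \<Rightarrow> 'a) \<Rightarrow> nat \<Rightarrow> 'a" where
  "fsum A s t f 0 = zer A s t"
| "fsum A s t f (Suc k) = add A (fsum A s t f k) (f k)"

definition amp :: "nat \<Rightarrow> ('a, 's, 'z) alg_scheme \<Rightarrow> ((nat \<Rightarrow> nat \<Rightarrow> 'a) \<Rightarrow> real)
      \<Rightarrow> (nat \<Rightarrow> nat \<Rightarrow> 'a, nat \<Rightarrow> 's) alg" where
  "amp n A N = \<lparr>
     Carr = {M. \<exists>s t. (\<forall>i<n. s i \<in> Obj A \<and> t i \<in> Obj A) \<and>
                      (\<forall>i<n. \<forall>j<n. M i j \<in> fibre A (s j) (t i)) \<and>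
                      (\<forall>i j. \<not> (i < n \<and> j < n) \<longrightarrow> M i j = undefined)},
     Obj = {s. (\<forall>i<n. s i \<in> Obj A) \<and> (\<forall>i\<ge>n. s i = undefined)},
     dm = (\<lambda>M j. if j < n then dm A (M 0 j) else undefined),
     cd = (\<lambda>M i. if i < n then cd A (M i 0) else undefined),
     mul = (\<lambda>M M' i j. if i < n \<and> j < n
                then fsum A (dm A (M' 0 j)) (cd A (M i 0)) (\<lambda>k. mul A (M i k) (M' k j)) n
                else undefined),
     add = (\<lambda>M M' i j. if i < n \<and> j < n then add A (M i j) (M' i j) else undefined),
     sml = (\<lambda>c M i j. if i < n \<and> j < n then sml A c (M i j) else undefined),
     zer = (\<lambda>s t i j. if i < n \<and> j < n then zer A (s j) (t i) else undefined),
     inv = (\<lambda>M i j. if i < n \<and> j < n then inv A (M j i) else undefined),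
     nrm = N \<rparr>"

definition single_entry :: "nat \<Rightarrow> ('a, 's, 'z) alg_scheme \<Rightarrow> (nat \<Rightarrow> 's) \<Rightarrow> (nat \<Rightarrow> 's)
      \<Rightarrow> nat \<Rightarrow> nat \<Rightarrow> 'a \<Rightarrow> nat \<Rightarrow> nat \<Rightarrow> 'a" where
  "single_entry n A s t i j a = (\<lambda>k l. if k < n \<and> l < n
       then (if k = i \<and> l = j then a else zer A (s l) (t k)) else undefined)"

definition extends_norms :: "nat \<Rightarrow> ('a, 's, 'z) alg_scheme \<Rightarrow> ((nat \<Rightarrow> nat \<Rightarrow> 'a) \<Rightarrow> real) \<Rightarrow> bool" where
  "extends_norms n A N \<longleftrightarrow>
     (\<forall>s\<in>Obj (amp n A N). \<forall>t\<in>Obj (amp n A N). \<forall>i<n. \<forall>j<n. \<forall>a\<in>fibre A (s j) (t i).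
        N (single_entry n A s t i j a) = nrm A a)"

record 'h hspace =
  hcarr  :: "'h set"
  hadd   :: "'h \<Rightarrow> 'h \<Rightarrow> 'h"
  hsml   :: "complex \<Rightarrow> 'h \<Rightarrow> 'h"
  hzero  :: "'h"
  hinner :: "'h \<Rightarrow> 'h \<Rightarrow> complex"

definition hnorm :: "'h hspace \<Rightarrow> 'h \<Rightarrow> real" where
  "hnorm H x = sqrt (Re (hinner H x x))"

definition hsub :: "'h hspace \<Rightarrow> 'h \<Rightarrow> 'h \<Rightarrow> 'h" where
  "hsub H x y = hadd H x (hsml H (-1) y)"

definition hilbert_space :: "'h hspace \<Rightarrow> bool" where
  "hilbert_space H \<longleftrightarrow>
     hzero H \<in> hcarr H \<and>
     (\<forall>x\<in>hcarr H. \<forall>y\<in>hcarr H. hadd H x y \<in> hcarr H) \<and>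
     (\<forall>c. \<forall>x\<in>hcarr H. hsml H c x \<in> hcarr H) \<and>
     (\<forall>x\<in>hcarr H. \<forall>y\<in>hcarr H. \<forall>z\<in>hcarr H. hadd H (hadd H x y) z = hadd H x (hadd H y z)) \<and>
     (\<forall>x\<in>hcarr H. \<forall>y\<in>hcarr H. hadd H x y = hadd H y x) \<and>
     (\<forall>x\<in>hcarr H. hadd H (hzero H) x = x) \<and>
     (\<forall>x\<in>hcarr H. \<exists>y\<in>hcarr H. hadd H x y = hzero H) \<and>
     (\<forall>c. \<forall>x\<in>hcarr H. \<forall>y\<in>hcarr H. hsml H c (hadd H x y) = hadd H (hsml H c x) (hsml H c y)) \<and>
     (\<forall>c d. \<forall>x\<in>hcarr H. hsml H (c + d) x = hadd H (hsml H c x) (hsml H d x)) \<and>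
     (\<forall>c d. \<forall>x\<in>hcarr H. hsml H (c * d) x = hsml H c (hsml H d x)) \<and>
     (\<forall>x\<in>hcarr H. hsml H 1 x = x) \<and>
     \<comment> \<open>inner product (linear in the first argument)\<close>
     (\<forall>x\<in>hcarr H. \<forall>y\<in>hcarr H. hinner H x y = cnj (hinner H y x)) \<and>
     (\<forall>x\<in>hcarr H. \<forall>y\<in>hcarr H. \<forall>z\<in>hcarr H.
        hinner H (hadd H x y) z = hinner H x z + hinner H y z) \<and>
     (\<forall>c. \<forall>x\<in>hcarr H. \<forall>y\<in>hcarr H. hinner H (hsml H c x) y = c * hinner H x y) \<and>
     (\<forall>x\<in>hcarr H. 0 \<le> Re (hinner H x x)) \<and>
     (\<forall>x\<in>hcarr H. hinner H x x = 0 \<longrightarrow> x = hzero H) \<and>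
     \<comment> \<open>completeness\<close>
     (\<forall>X. (\<forall>n. X n \<in> hcarr H) \<longrightarrow>
          (\<forall>e>0. \<exists>N. \<forall>m\<ge>N. \<forall>n\<ge>N. hnorm H (hsub H (X m) (X n)) < e) \<longrightarrow>
          (\<exists>L\<in>hcarr H. (\<lambda>n. hnorm H (hsub H (X n) L)) \<longlonglongrightarrow> 0))"

definition bounded_op :: "'h hspace \<Rightarrow> 'h hspace \<Rightarrow> ('h \<Rightarrow> 'h) \<Rightarrow> bool" where
  "bounded_op H K T \<longleftrightarrow>
     (\<forall>x\<in>hcarr H. T x \<in> hcarr K) \<and>
     (\<forall>x\<in>hcarr H. \<forall>y\<in>hcarr H. T (hadd H x y) = hadd K (T x) (T y)) \<and>
     (\<forall>c. \<forall>x\<in>hcarr H. T (hsml H c x) = hsml K c (T x)) \<and>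
     (\<exists>C. \<forall>x\<in>hcarr H. hnorm K (T x) \<le> C * hnorm H x)"

text \<open>An injective *-representation of A with identity aggregation map on the family
  of Hilbert spaces H (indexed by the objects).  Operators are compared by their action
  on the relevant Hilbert space.\<close>
definition inj_star_rep :: "('a, 's, 'z) alg_scheme \<Rightarrow> ('s \<Rightarrow> 'h hspace) \<Rightarrow> ('a \<Rightarrow> 'h \<Rightarrow> 'h) \<Rightarrow> bool" where
  "inj_star_rep A H \<Phi> \<longleftrightarrow>
     (\<forall>s\<in>Obj A. hilbert_space (H s)) \<and>
     (\<forall>a\<in>Carr A. bounded_op (H (dm A a)) (H (cd A a)) (\<Phi> a)) \<and>
     (\<forall>s\<in>Obj A. \<forall>t\<in>Obj A. \<forall>a\<in>fibre A s t. \<forall>b\<in>fibre A s t. \<forall>c. \<forall>x\<in>hcarr (H s).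
        \<Phi> (add A a b) x = hadd (H t) (\<Phi> a x) (\<Phi> b x) \<and>
        \<Phi> (sml A c a) x = hsml (H t) c (\<Phi> a x)) \<and>
     (\<forall>a\<in>Carr A. \<forall>b\<in>Carr A. dm A a = cd A b \<longrightarrow>
        (\<forall>x\<in>hcarr (H (dm A b)). \<Phi> (mul A a b) x = \<Phi> a (\<Phi> b x))) \<and>
     (\<forall>a\<in>Carr A. \<forall>x\<in>hcarr (H (cd A a)). \<forall>y\<in>hcarr (H (dm A a)).
        hinner (H (dm A a)) (\<Phi> (inv A a) x) y = hinner (H (cd A a)) x (\<Phi> a y)) \<and>
     (\<forall>a\<in>Carr A. \<forall>b\<in>Carr A. dm A a = dm A b \<longrightarrow> cd A a = cd A b \<longrightarrow>
        (\<forall>x\<in>hcarr (H (dm A a)). \<Phi> a x = \<Phi> b x) \<longrightarrow> a = b)"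

end

theory Submission
  imports Defs
begin

text \<open>All four conditions are equivalent to positivity of \<open>x* x\<close> in the fibre C*-algebra \<open>A s s\<close> for every
  \<open>x\<close> from \<open>s\<close> to \<open>t\<close>. Here positive means being the square of a self-adjoint element, equivalently
  \<open>\<parallel>t - y\<parallel> \<le> t\<close> for some (every) \<open>t \<ge> \<parallel>y\<parallel>\<close>, \<open>t > 0\<close>; the latter form survives compression by a corner
  projection, so positivity of \<open>X* X\<close> in the 2-fold amplification, where \<open>X\<close> has the single entry \<open>x\<close>,
  descends to \<open>x* x\<close>.

  A self-adjoint \<open>y\<close> has elements \<open>m, n\<close> with \<open>m y m = -n\<^sup>2\<close> such that \<open>n = 0\<close> forces \<open>y\<close> to be positive. For
  \<open>y = x* x\<close> and \<open>v = x m\<close> this gives \<open>v* v = -n\<^sup>2\<close>, which is impossible for \<open>n \<noteq> 0\<close> in a Hilbert space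
  representation, and also inside a single C*-algebra (so there \<open>x* x\<close> is always positive).

  Conversely, if all \<open>x* x\<close> are positive, the GNS construction applies to every state of every fibre
  \<open>A u u\<close> and represents the whole algebroid on pre-Hilbert spaces with underlying spaces \<open>A u s\<close>. The
  direct sum over enough states is isometric; completing it gives the representation, and the operator
  norms of matrices on it give the norms on the amplifications.\<close>


section \<open>Complex vector spaces on a carrier set\<close>

text \<open>When \<open>s\<close> and \<open>t\<close> differ, \<open>x* x\<close> and
  \<open>x x*\<close> lie in different fibre algebras and \<open>x + x*\<close> is undefined, so the
  classical proof that \<open>x* x\<close> is positive does not carry over from one C*-algebra to an
  algebroid. It does work in each \<open>A s s\<close>, which is how \<open>x* x = a* a\<close>
  becomes positivity, and the 2-fold amplification restores a single algebra containing
  \<open>x\<close>.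

  No spectrum is used. Positivity rests on one square root of \<open>1 - z\<close> for self-adjoint
  \<open>z\<close> in the closed unit ball, which commutes with everything that commutes with
  \<open>z\<close>; unitaries \<open>b + i c\<close> with \<open>b^2 + c^2 = 1\<close> turn
  statements about squares back into norm bounds.

  Null vectors are never divided out before the completion. The laws of a representation are
  equations between semi-inner products, and the completion records a vector by its pairings with
  test vectors. Since the tests are coded in \<open>'a => complex\<close>, all Hilbert spaces get
  the one type that the theorem names.\<close>

locale cvs =
  fixes B :: "'a set"
    and ad :: "'a \<Rightarrow> 'a \<Rightarrow> 'a" (infixl "\<oplus>" 65)
    and sm :: "complex \<Rightarrow> 'a \<Rightarrow> 'a" (infixr "\<cdot>" 75)
    and z0 :: 'a ("\<zero>")
  assumes zero_closed [simp, intro]: "\<zero> \<in> B"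
    and ad_closed [simp, intro]: "\<And>x y. x \<in> B \<Longrightarrow> y \<in> B \<Longrightarrow> x \<oplus> y \<in> B"
    and sm_closed [simp, intro]: "\<And>c x. x \<in> B \<Longrightarrow> c \<cdot> x \<in> B"
    and ad_assoc: "\<And>x y z. x \<in> B \<Longrightarrow> y \<in> B \<Longrightarrow> z \<in> B \<Longrightarrow> (x \<oplus> y) \<oplus> z = x \<oplus> (y \<oplus> z)"
    and ad_comm: "\<And>x y. x \<in> B \<Longrightarrow> y \<in> B \<Longrightarrow> x \<oplus> y = y \<oplus> x"
    and zero_ad [simp]: "\<And>x. x \<in> B \<Longrightarrow> \<zero> \<oplus> x = x"
    and neg_ex: "\<And>x. x \<in> B \<Longrightarrow> \<exists>y\<in>B. x \<oplus> y = \<zero>"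
    and sm_ad: "\<And>c x y. x \<in> B \<Longrightarrow> y \<in> B \<Longrightarrow> c \<cdot> (x \<oplus> y) = c \<cdot> x \<oplus> c \<cdot> y"
    and add_sm: "\<And>c d x. x \<in> B \<Longrightarrow> (c + d) \<cdot> x = c \<cdot> x \<oplus> d \<cdot> x"
    and mult_sm: "\<And>c d x. x \<in> B \<Longrightarrow> (c * d) \<cdot> x = c \<cdot> (d \<cdot> x)"
    and one_sm [simp]: "\<And>x. x \<in> B \<Longrightarrow> 1 \<cdot> x = x"
begin

lemma ad_left_comm: "x \<in> B \<Longrightarrow> y \<in> B \<Longrightarrow> z \<in> B \<Longrightarrow> x \<oplus> (y \<oplus> z) = y \<oplus> (x \<oplus> z)"
  by (metis ad_assoc ad_comm)

lemmas ad_ac = ad_assoc ad_comm ad_left_comm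

lemma ad_zero [simp]: "x \<in> B \<Longrightarrow> x \<oplus> \<zero> = x"
  using ad_comm zero_ad zero_closed by metis

lemma ad_cancel: assumes "x \<in> B" "y \<in> B" "z \<in> B" "x \<oplus> y = x \<oplus> z" shows "y = z"
proof -
  obtain w where w: "w \<in> B" "x \<oplus> w = \<zero>" using neg_ex assms by blast
  have "w \<oplus> (x \<oplus> y) = w \<oplus> (x \<oplus> z)" using assms by simp
  then have "(x \<oplus> w) \<oplus> y = (x \<oplus> w) \<oplus> z" using assms w by (metis ad_assoc ad_comm)
  then show ?thesis using w assms by simp
qed

lemma zero_sm [simp]: assumes "x \<in> B" shows "0 \<cdot> x = \<zero>"
proof (rule ad_cancel[of "0 \<cdot> x"])
  show "0 \<cdot> x \<oplus> 0 \<cdot> x = 0 \<cdot> x \<oplus> \<zero>" using add_sm[of x 0 0] assms by simp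
qed (use assms in auto)

lemma sm_zero [simp]: "c \<cdot> \<zero> = \<zero>"
  using mult_sm[of \<zero> c 0] zero_sm[of \<zero>] by simp

lemma ad_neg [simp]: "x \<in> B \<Longrightarrow> x \<oplus> (-1) \<cdot> x = \<zero>"
  using add_sm[of x 1 "-1"] by simp

lemma neg_ad [simp]: "x \<in> B \<Longrightarrow> (-1) \<cdot> x \<oplus> x = \<zero>"
  using ad_comm[of x "(-1) \<cdot> x"] by simp

definition lf :: "('a \<Rightarrow> complex) set" where
  "lf = {\<phi>. (\<forall>x\<in>B. \<forall>y\<in>B. \<phi> (x \<oplus> y) = \<phi> x + \<phi> y) \<and> (\<forall>c. \<forall>x\<in>B. \<phi> (c \<cdot> x) = c * \<phi> x)}"

text \<open>The constant \<open>ap\<close> makes the linearity rules usable as rewrite rules: a bare variable as head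
  symbol would not be a higher-order pattern.\<close>
definition ap :: "('a \<Rightarrow> complex) \<Rightarrow> 'a \<Rightarrow> complex" where "ap \<phi> x = \<phi> x"

lemma ap_simps:
  "\<phi> \<in> lf \<Longrightarrow> x \<in> B \<Longrightarrow> y \<in> B \<Longrightarrow> ap \<phi> (x \<oplus> y) = ap \<phi> x + ap \<phi> y"
  "\<phi> \<in> lf \<Longrightarrow> x \<in> B \<Longrightarrow> ap \<phi> (c \<cdot> x) = c * ap \<phi> x"
  "\<phi> \<in> lf \<Longrightarrow> ap \<phi> \<zero> = 0"
proof -
  show "\<phi> \<in> lf \<Longrightarrow> x \<in> B \<Longrightarrow> y \<in> B \<Longrightarrow> ap \<phi> (x \<oplus> y) = ap \<phi> x + ap \<phi> y"
    "\<And>c x. \<phi> \<in> lf \<Longrightarrow> x \<in> B \<Longrightarrow> ap \<phi> (c \<cdot> x) = c * ap \<phi> x" by (auto simp: lf_def ap_def)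
  from this(2)[of \<zero> 0] show "\<phi> \<in> lf \<Longrightarrow> ap \<phi> \<zero> = 0" by simp
qed

section \<open>Sublinear functionals and the Hahn-Banach theorem\<close>

definition sublin :: "('a \<Rightarrow> real) \<Rightarrow> bool" where
  "sublin q \<longleftrightarrow> (\<forall>x\<in>B. \<forall>y\<in>B. q (x \<oplus> y) \<le> q x + q y) \<and>
     (\<forall>c\<ge>0. \<forall>x\<in>B. q (complex_of_real c \<cdot> x) = c * q x)"

lemma sublin_ad: "sublin q \<Longrightarrow> x \<in> B \<Longrightarrow> y \<in> B \<Longrightarrow> q (x \<oplus> y) \<le> q x + q y"
  and sublin_sm: "sublin q \<Longrightarrow> c \<ge> 0 \<Longrightarrow> x \<in> B \<Longrightarrow> q (complex_of_real c \<cdot> x) = c * q x"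
  by (auto simp: sublin_def)

lemma sublin_zero: "sublin q \<Longrightarrow> q \<zero> = 0"
  using sublin_sm[of q 0 \<zero>] by simp

lemma sublin_neg: "sublin q \<Longrightarrow> x \<in> B \<Longrightarrow> - q ((-1) \<cdot> x) \<le> q x"
  using sublin_ad[of q x "(-1) \<cdot> x"] sublin_zero[of q] by simp

text \<open>A sublinear functional below \<open>q\<close> which at \<open>(-1) \<cdot> y\<close> drops to \<open>- q y\<close>; minimal sublinear functionals
  are therefore additive.\<close>
definition shift :: "('a \<Rightarrow> real) \<Rightarrow> 'a \<Rightarrow> 'a \<Rightarrow> real" where
  "shift q y x = (if x \<in> B then (INF t\<in>{0..}. q (x \<oplus> complex_of_real t \<cdot> y) - t * q y) else 0)"

context
  fixes q y assumes q: "sublin q" and y: "y \<in> B"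
begin

text \<open>Subadditivity applied to \<open>t y = (x + t y) + (-x)\<close>. The bound does not
  involve \<open>t\<close>, so the infimum in \<open>shift\<close> is finite.\<close>

lemma shift_lower: assumes "x \<in> B" "t \<ge> 0"
  shows "- q ((-1) \<cdot> x) \<le> q (x \<oplus> complex_of_real t \<cdot> y) - t * q y"
proof -
  have "(x \<oplus> complex_of_real t \<cdot> y) \<oplus> (-1) \<cdot> x = (x \<oplus> (-1) \<cdot> x) \<oplus> complex_of_real t \<cdot> y"
    using assms y by (simp add: ad_ac del: ad_neg)
  then have "(x \<oplus> complex_of_real t \<cdot> y) \<oplus> (-1) \<cdot> x = complex_of_real t \<cdot> y"
    using assms y by simp
  moreover have "q ((x \<oplus> complex_of_real t \<cdot> y) \<oplus> (-1) \<cdot> x) \<le> q (x \<oplus> complex_of_real t \<cdot> y) + q ((-1) \<cdot> x)"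
    using sublin_ad[OF q] assms y by simp
  ultimately show ?thesis using sublin_sm[OF q assms(2) y] by simp
qed

lemma shift_le: assumes "x \<in> B" "t \<ge> 0"
  shows "shift q y x \<le> q (x \<oplus> complex_of_real t \<cdot> y) - t * q y"
  unfolding shift_def using assms shift_lower[OF assms(1)]
  by (auto intro!: cINF_lower bdd_belowI2[where m="- q ((-1) \<cdot> x)"])

lemma shift_greatest:
  assumes "x \<in> B" "\<And>t. t \<ge> 0 \<Longrightarrow> b \<le> q (x \<oplus> complex_of_real t \<cdot> y) - t * q y"
  shows "b \<le> shift q y x"
  unfolding shift_def using assms by (auto intro!: cINF_greatest)

lemma shift_ad: assumes x: "x \<in> B" "x' \<in> B"
  shows "shift q y (x \<oplus> x') \<le> shift q y x + shift q y x'"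
proof -
  have *: "shift q y (x \<oplus> x') \<le> (q (x \<oplus> complex_of_real t \<cdot> y) - t * q y)
      + (q (x' \<oplus> complex_of_real t' \<cdot> y) - t' * q y)" if t: "t \<ge> 0" "t' \<ge> 0" for t t'
  proof -
    have "(x \<oplus> x') \<oplus> complex_of_real (t + t') \<cdot> y
        = (x \<oplus> complex_of_real t \<cdot> y) \<oplus> (x' \<oplus> complex_of_real t' \<cdot> y)"
      using x y by (simp add: add_sm ad_ac)
    then show ?thesis
      using shift_le[of "x \<oplus> x'" "t + t'"] t x y
        sublin_ad[OF q, of "x \<oplus> complex_of_real t \<cdot> y" "x' \<oplus> complex_of_real t' \<cdot> y"]
      by (simp add: algebra_simps)
  qed
  have "shift q y (x \<oplus> x') - (q (x' \<oplus> complex_of_real t' \<cdot> y) - t' * q y) \<le> shift q y x"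
    if "t' \<ge> 0" for t'
    by (rule shift_greatest[OF x(1)]) (use *[OF _ that] in \<open>simp add: algebra_simps\<close>)
  then have "shift q y (x \<oplus> x') - shift q y x \<le> shift q y x'"
    by (intro shift_greatest[OF x(2)]) (simp add: algebra_simps)
  then show ?thesis by simp
qed

text \<open>The substitution of \<open>c t\<close> for \<open>t\<close> in the infimum. The reverse
  inequality is the same statement for \<open>1/c\<close>.\<close>

lemma shift_sm_le: assumes x: "x \<in> B" and c: "c > 0"
  shows "shift q y (complex_of_real c \<cdot> x) \<le> c * shift q y x"
proof -
  have "shift q y (complex_of_real c \<cdot> x) / c \<le> shift q y x"
  proof (rule shift_greatest[OF x])
    fix t :: real assume t: "t \<ge> 0"
    have "complex_of_real c \<cdot> x \<oplus> complex_of_real (c * t) \<cdot> y = complex_of_real c \<cdot> (x \<oplus> complex_of_real t \<cdot> y)"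
      using x y by (simp add: sm_ad mult_sm)
    then have "shift q y (complex_of_real c \<cdot> x) \<le> c * q (x \<oplus> complex_of_real t \<cdot> y) - c * t * q y"
      using shift_le[of "complex_of_real c \<cdot> x" "c * t"] x y c t
        sublin_sm[OF q, of c "x \<oplus> complex_of_real t \<cdot> y"] by simp
    then show "shift q y (complex_of_real c \<cdot> x) / c \<le> q (x \<oplus> complex_of_real t \<cdot> y) - t * q y"
      using c by (simp add: field_simps)
  qed
  then show ?thesis using c by (simp add: field_simps)
qed

lemma shift_sublin: "sublin (shift q y)"
  unfolding sublin_def
proof (intro conjI ballI allI impI)
  fix x x' assume "x \<in> B" "x' \<in> B"
  then show "shift q y (x \<oplus> x') \<le> shift q y x + shift q y x'" by (rule shift_ad)
next
  fix c :: real and x assume c: "0 \<le> c" and x: "x \<in> B"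
  show "shift q y (complex_of_real c \<cdot> x) = c * shift q y x"
  proof (cases "c = 0")
    case True
    have "shift q y \<zero> \<le> 0" using shift_le[of \<zero> 0] y by (simp add: sublin_zero[OF q])
    moreover have "0 \<le> shift q y \<zero>" using shift_greatest[of \<zero> 0] y by (simp add: sublin_sm[OF q])
    ultimately show ?thesis using True x by simp
  next
    case False
    with c have c: "c > 0" by simp
    have "complex_of_real (1/c) \<cdot> complex_of_real c \<cdot> x = x"
      using x c by (simp flip: mult_sm)
    then have "shift q y x \<le> (1/c) * shift q y (complex_of_real c \<cdot> x)"
      using shift_sm_le[of "complex_of_real c \<cdot> x" "1/c"] x c by simp
    then show ?thesis using shift_sm_le[OF x c] c by (simp add: field_simps)
  qed
qed

lemma shift_le_self: "x \<in> B \<Longrightarrow> shift q y x \<le> q x"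
  using shift_le[of x 0] y by simp

lemma shift_le_diff: "x \<in> B \<Longrightarrow> shift q y x \<le> q (x \<oplus> y) - q y"
  using shift_le[of x 1] y by simp

end

text \<open>Zorn's lemma among the sublinear functionals below \<open>p\<close>. If \<open>m\<close>
  is minimal, then \<open>shift m y\<close>, being sublinear and below \<open>m\<close>, equals
  \<open>m\<close>, and its bound at \<open>t = 1\<close> reads
  \<open>m x + m y <= m (x + y)\<close>.\<close>

lemma minimal_sublin:
  assumes p: "sublin p"
  obtains m where "sublin m" "\<And>x. x \<in> B \<Longrightarrow> m x \<le> p x"
    "\<And>x y. x \<in> B \<Longrightarrow> y \<in> B \<Longrightarrow> m (x \<oplus> y) = m x + m y"
proof -
  \<comment> \<open>Members vanish outside \<open>B\<close>, so the pointwise order of total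
    functions compares them on \<open>B\<close> only, and minimality yields equality of functions.
    The relation \<open>?r\<close> is reversed because Zorn's lemma produces maximal
    elements.\<close>
  define Q where "Q = {q. sublin q \<and> (\<forall>x\<in>B. q x \<le> p x) \<and> (\<forall>x. x \<notin> B \<longrightarrow> q x = 0)}"
  let ?r = "relation_of (\<lambda>q q'. q' \<le> q) Q"
  define p' where "p' x = (if x \<in> B then p x else 0)" for x
  have p': "p' \<in> Q" using p by (auto simp: Q_def p'_def sublin_def)
  have po: "partial_order_on Q ?r"
    by (auto simp: partial_order_on_def preorder_on_def refl_on_def trans_on_def antisym_on_def relation_of_def)
  have "\<exists>m\<in>Q. \<forall>q\<in>Q. q \<le> m \<longrightarrow> q = m"
  proof (rule predicate_Zorn[OF po])
    fix C assume C: "C \<in> Chains ?r"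
    then have CQ: "C \<subseteq> Q" and tot: "\<And>q q'. q \<in> C \<Longrightarrow> q' \<in> C \<Longrightarrow> q \<le> q' \<or> q' \<le> q"
      by (auto simp: Chains_def relation_of_def)
    show "\<exists>u\<in>Q. \<forall>a\<in>C. u \<le> a"
    proof (cases "C = {}")
      case True then show ?thesis using p' by auto
    next
      case False
      define u where "u x = (if x \<in> B then (INF q\<in>C. q x) else 0)" for x
      have low: "- p ((-1) \<cdot> x) \<le> q x" if "q \<in> C" "x \<in> B" for q x
      proof -
        have "sublin q" "q ((-1) \<cdot> x) \<le> p ((-1) \<cdot> x)" using CQ that by (auto simp: Q_def)
        then show ?thesis using sublin_neg[of q x] that by simp
      qed
      have ule: "u x \<le> q x" if "q \<in> C" "x \<in> B" for q x
        unfolding u_def using that low[OF _ that(2)]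
        by (auto intro!: cINF_lower bdd_belowI2[where m="- p ((-1) \<cdot> x)"])
      have ugr: "b \<le> u x" if "x \<in> B" "\<And>q. q \<in> C \<Longrightarrow> b \<le> q x" for b x
        unfolding u_def using that False by (auto intro!: cINF_greatest)
      have sl: "sublin q" if "q \<in> C" for q using CQ that by (auto simp: Q_def)
      have "sublin u"
        unfolding sublin_def
      proof (intro conjI ballI allI impI)
        fix x y assume xy: "x \<in> B" "y \<in> B"
        have *: "u (x \<oplus> y) \<le> q x + q' y" if qq: "q \<in> C" "q' \<in> C" for q q'
        proof -
          \<comment> \<open>In a chain the smaller of \<open>q\<close> and \<open>q'\<close> serves
            for both arguments; this makes the infimum subadditive.\<close>
          obtain q0 where q0: "q0 \<in> C" "q0 \<le> q" "q0 \<le> q'" using tot[OF qq] qq by blast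
          have "u (x \<oplus> y) \<le> q0 (x \<oplus> y)" using ule q0 xy by simp
          also have "\<dots> \<le> q0 x + q0 y" using sublin_ad[OF sl] q0 xy by simp
          also have "\<dots> \<le> q x + q' y" using q0 by (simp add: le_fun_def add_mono)
          finally show ?thesis .
        qed
        have "u (x \<oplus> y) - q' y \<le> u x" if "q' \<in> C" for q'
          by (rule ugr[OF xy(1)]) (use *[OF _ that] in \<open>simp add: algebra_simps\<close>)
        then have "u (x \<oplus> y) - u x \<le> u y"
          by (intro ugr[OF xy(2)]) (simp add: algebra_simps)
        then show "u (x \<oplus> y) \<le> u x + u y" by simp
      next
        fix c :: real and x assume c: "0 \<le> c" and x: "x \<in> B"
        have 1: "u (complex_of_real c \<cdot> x) \<le> c * u x" if c: "c > 0" and x: "x \<in> B" for c x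
        proof -
          have "u (complex_of_real c \<cdot> x) / c \<le> u x"
          proof (rule ugr[OF x])
            fix q assume "q \<in> C"
            then show "u (complex_of_real c \<cdot> x) / c \<le> q x"
              using ule[of q "complex_of_real c \<cdot> x"] sublin_sm[OF sl, of q c x] c x
              by (simp add: field_simps)
          qed
          then show ?thesis using c by (simp add: field_simps)
        qed
        show "u (complex_of_real c \<cdot> x) = c * u x"
        proof (cases "c = 0")
          case True
          have "(INF q\<in>C. q \<zero>) = (INF q\<in>C. (0::real))"
            by (rule INF_cong) (auto simp: sublin_zero sl)
          then have "u \<zero> = 0" using False by (simp add: u_def)
          then show ?thesis using True x by simp
        next
          case F: False
          with c have c: "c > 0" by simp
          have "complex_of_real (1/c) \<cdot> complex_of_real c \<cdot> x = x"
            using x c by (simp flip: mult_sm)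
          then have "u x \<le> (1/c) * u (complex_of_real c \<cdot> x)"
            using 1[of "1/c" "complex_of_real c \<cdot> x"] x c by simp
          then show ?thesis using 1[OF c x] c by (simp add: field_simps)
        qed
      qed
      moreover obtain q where "q \<in> C" using False by blast
      then have "u x \<le> p x" if "x \<in> B" for x
        using ule[of q x] CQ that by (force simp: Q_def)
      ultimately have "u \<in> Q" by (auto simp: Q_def u_def)
      moreover have "u \<le> q" if "q \<in> C" for q
        using ule[OF that] CQ that by (auto simp: le_fun_def Q_def u_def)
      ultimately show ?thesis by blast
    qed
  qed
  then obtain m where m: "m \<in> Q" and mm: "\<And>q. q \<in> Q \<Longrightarrow> q \<le> m \<Longrightarrow> q = m" by blast
  have sm: "sublin m" using m by (simp add: Q_def)
  have "m (x \<oplus> y) = m x + m y" if xy: "x \<in> B" "y \<in> B" for x y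
  proof -
    have le: "shift m y \<le> m"
      using shift_le_self[OF sm xy(2)] m by (auto simp: le_fun_def shift_def Q_def)
    moreover have "shift m y \<in> Q"
    proof -
      have "shift m y x \<le> p x" if "x \<in> B" for x
        using shift_le_self[OF sm xy(2) that] m that by (force simp: Q_def)
      then show ?thesis using shift_sublin[OF sm xy(2)] by (auto simp: Q_def shift_def)
    qed
    ultimately have "shift m y = m" by (intro mm)
    then have "m x \<le> m (x \<oplus> y) - m y" using shift_le_diff[OF sm xy(2) xy(1)] by simp
    then show ?thesis using sublin_ad[OF sm xy] by simp
  qed
  then show thesis using that[of m] sm m by (auto simp: Q_def)
qed

text \<open>Instead of extending a functional from the line through \<open>h\<close>, take a minimal
  one below \<open>shift p h\<close>: then \<open>m (-h) <= shift p h (-h) <= - p h\<close>, which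
  forces \<open>m h = p h\<close>. The complex functional is \<open>m x - i m (i x)\<close>.\<close>

lemma hahn_banach:
  assumes p: "sublin p" and h: "h \<in> B"
  obtains \<phi> where "\<phi> \<in> lf" "\<And>x. x \<in> B \<Longrightarrow> Re (ap \<phi> x) \<le> p x" "Re (ap \<phi> h) = p h"
proof -
  obtain m where m: "sublin m" and mle: "\<And>x. x \<in> B \<Longrightarrow> m x \<le> shift p h x"
    and mad: "\<And>x y. x \<in> B \<Longrightarrow> y \<in> B \<Longrightarrow> m (x \<oplus> y) = m x + m y"
    using minimal_sublin[OF shift_sublin[OF p h]] by blast
  have mp: "m x \<le> p x" if "x \<in> B" for x
    using mle[OF that] shift_le_self[OF p h that] by simp
  have neg: "m ((-1) \<cdot> x) = - m x" if "x \<in> B" for x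
    using mad[of x "(-1) \<cdot> x"] that sublin_zero[OF m] by simp
  have "m ((-1) \<cdot> h) \<le> - p h"
    using mle[of "(-1) \<cdot> h"] shift_le_diff[OF p h, of "(-1) \<cdot> h"] h sublin_zero[OF p] by simp
  then have mh: "m h = p h" using neg[OF h] mp[OF h] by simp
  have real: "m (complex_of_real c \<cdot> x) = c * m x" if "x \<in> B" for c x
  proof (cases "c \<ge> 0")
    case True then show ?thesis using sublin_sm[OF m True that] by simp
  next
    case False
    have "(-1) \<cdot> complex_of_real (- c) \<cdot> x = complex_of_real c \<cdot> x"
      using that by (simp flip: mult_sm)
    then show ?thesis using sublin_sm[OF m, of "- c" x] False that neg[of "complex_of_real (- c) \<cdot> x"]
      by simp
  qed
  have comp: "m (c \<cdot> x) = Re c * m x + Im c * m (\<i> \<cdot> x)" if "x \<in> B" for c x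
  proof -
    have "c \<cdot> x = (complex_of_real (Re c) + complex_of_real (Im c) * \<i>) \<cdot> x"
      by (rule arg_cong[of _ _ "\<lambda>c. c \<cdot> x"]) (simp add: complex_eq_iff)
    also have "\<dots> = complex_of_real (Re c) \<cdot> x \<oplus> complex_of_real (Im c) \<cdot> \<i> \<cdot> x"
      by (simp only: add_sm[OF that] mult_sm[OF that])
    finally have "c \<cdot> x = complex_of_real (Re c) \<cdot> x \<oplus> complex_of_real (Im c) \<cdot> \<i> \<cdot> x" .
    then show ?thesis using that by (simp add: mad real)
  qed
  define \<phi> where "\<phi> x = Complex (m x) (- m (\<i> \<cdot> x))" for x
  have "\<phi> \<in> lf"
    unfolding lf_def
  proof (intro CollectI conjI ballI allI)
    fix x y assume "x \<in> B" "y \<in> B"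
    then show "\<phi> (x \<oplus> y) = \<phi> x + \<phi> y" by (simp add: \<phi>_def mad sm_ad complex_eq_iff)
  next
    fix c x assume x: "x \<in> B"
    have "\<i> \<cdot> c \<cdot> x = (\<i> * c) \<cdot> x" using x by (simp add: mult_sm)
    then show "\<phi> (c \<cdot> x) = c * \<phi> x" using x
      by (simp add: \<phi>_def comp[OF x, of c] comp[OF x, of "\<i> * c"] complex_eq_iff algebra_simps)
  qed
  then show thesis using that[of \<phi>] mp mh by (simp add: ap_def \<phi>_def)
qed

end


section \<open>Unital C*-algebras on a carrier set\<close>

text \<open>The majorant for the algebra-valued iteration \<open>sqit\<close> below: its recursion
  on real numbers with \<open>z = 1\<close>. It increases from 0 and never exceeds 1, hence is
  Cauchy.\<close>

primrec sqit_bound :: "nat \<Rightarrow> real" where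
  "sqit_bound 0 = 0"
| "sqit_bound (Suc k) = (1 + (sqit_bound k)\<^sup>2) / 2"

lemma sqit_bound_range: "0 \<le> sqit_bound k \<and> sqit_bound k \<le> 1"
proof (induction k)
  case (Suc k)
  then have "(sqit_bound k)\<^sup>2 \<le> 1" by (simp add: power_le_one)
  then show ?case by simp
qed simp

lemma sqit_bound_mono: "incseq sqit_bound"
proof (rule incseq_SucI)
  fix k
  have "0 \<le> (1 - sqit_bound k)\<^sup>2" by simp
  then show "sqit_bound k \<le> sqit_bound (Suc k)" by (simp add: power2_eq_square algebra_simps)
qed

lemma sqit_bound_Cauchy: "Cauchy sqit_bound"
proof -
  have "Bseq sqit_bound"
    by (rule BseqI'[where K=1]) (metis abs_of_nonneg real_norm_def sqit_bound_range)
  then show ?thesis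
    using Bseq_mono_convergent sqit_bound_mono convergent_Cauchy by (metis incseq_def)
qed

locale ucalg = cvs +
  fixes mu :: "'a \<Rightarrow> 'a \<Rightarrow> 'a" (infixl "\<odot>" 70)
    and st :: "'a \<Rightarrow> 'a" and nm :: "'a \<Rightarrow> real" and e :: 'a
  assumes mu_closed [simp, intro]: "\<And>x y. x \<in> B \<Longrightarrow> y \<in> B \<Longrightarrow> x \<odot> y \<in> B"
    and mu_assoc: "\<And>x y z. x \<in> B \<Longrightarrow> y \<in> B \<Longrightarrow> z \<in> B \<Longrightarrow> (x \<odot> y) \<odot> z = x \<odot> (y \<odot> z)"
    and ad_mu: "\<And>x y z. x \<in> B \<Longrightarrow> y \<in> B \<Longrightarrow> z \<in> B \<Longrightarrow> (x \<oplus> y) \<odot> z = x \<odot> z \<oplus> y \<odot> z"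
    and mu_ad: "\<And>x y z. x \<in> B \<Longrightarrow> y \<in> B \<Longrightarrow> z \<in> B \<Longrightarrow> x \<odot> (y \<oplus> z) = x \<odot> y \<oplus> x \<odot> z"
    and sm_mu: "\<And>c x y. x \<in> B \<Longrightarrow> y \<in> B \<Longrightarrow> (c \<cdot> x) \<odot> y = c \<cdot> (x \<odot> y)"
    and mu_sm: "\<And>c x y. x \<in> B \<Longrightarrow> y \<in> B \<Longrightarrow> x \<odot> (c \<cdot> y) = c \<cdot> (x \<odot> y)"
    and e_closed [simp, intro]: "e \<in> B"
    and e_mu [simp]: "\<And>x. x \<in> B \<Longrightarrow> e \<odot> x = x"
    and mu_e [simp]: "\<And>x. x \<in> B \<Longrightarrow> x \<odot> e = x"
    and st_closed [simp, intro]: "\<And>x. x \<in> B \<Longrightarrow> st x \<in> B"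
    and st_st [simp]: "\<And>x. x \<in> B \<Longrightarrow> st (st x) = x"
    and st_mu: "\<And>x y. x \<in> B \<Longrightarrow> y \<in> B \<Longrightarrow> st (x \<odot> y) = st y \<odot> st x"
    and st_ad: "\<And>x y. x \<in> B \<Longrightarrow> y \<in> B \<Longrightarrow> st (x \<oplus> y) = st x \<oplus> st y"
    and st_sm: "\<And>c x. x \<in> B \<Longrightarrow> st (c \<cdot> x) = cnj c \<cdot> st x"
    and nm_nonneg [simp]: "\<And>x. x \<in> B \<Longrightarrow> 0 \<le> nm x"
    and nm_eq_0: "\<And>x. x \<in> B \<Longrightarrow> nm x = 0 \<longleftrightarrow> x = \<zero>"
    and nm_ad: "\<And>x y. x \<in> B \<Longrightarrow> y \<in> B \<Longrightarrow> nm (x \<oplus> y) \<le> nm x + nm y"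
    and nm_sm: "\<And>c x. x \<in> B \<Longrightarrow> nm (c \<cdot> x) = cmod c * nm x"
    and nm_mu: "\<And>x y. x \<in> B \<Longrightarrow> y \<in> B \<Longrightarrow> nm (x \<odot> y) \<le> nm x * nm y"
    and nm_st: "\<And>x. x \<in> B \<Longrightarrow> nm (st x) = nm x"
    and nm_cstar: "\<And>x. x \<in> B \<Longrightarrow> nm (st x \<odot> x) = (nm x)\<^sup>2"
    and nm_complete: "\<And>X. (\<And>n. X n \<in> B) \<Longrightarrow>
      (\<And>\<epsilon>. \<epsilon> > 0 \<Longrightarrow> \<exists>N. \<forall>m\<ge>N. \<forall>n\<ge>N. nm (X m \<oplus> (-1) \<cdot> X n) < \<epsilon>) \<Longrightarrow>
      \<exists>L\<in>B. (\<lambda>n. nm (X n \<oplus> (-1) \<cdot> L)) \<longlonglongrightarrow> 0"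
begin

abbreviation mi (infixl "\<ominus>" 65) where "x \<ominus> y \<equiv> x \<oplus> (-1) \<cdot> y"
abbreviation sc :: "real \<Rightarrow> 'a" where "sc t \<equiv> complex_of_real t \<cdot> e"

text \<open>Functionals separate points, by Hahn-Banach for the norm. This is the working method for
  identities in the algebra: after \<open>ap_simps\<close> both sides are complex combinations of
  values at monomials, which arithmetic can compare.\<close>

lemma eqI:
  assumes "x \<in> B" "y \<in> B" "\<And>\<phi>. \<phi> \<in> lf \<Longrightarrow> ap \<phi> x = ap \<phi> y"
  shows "x = y"
proof -
  have "sublin nm" by (auto simp: sublin_def nm_ad nm_sm)
  moreover have h: "x \<ominus> y \<in> B" using assms by simp
  ultimately obtain \<phi> where \<phi>: "\<phi> \<in> lf" "Re (ap \<phi> (x \<ominus> y)) = nm (x \<ominus> y)"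
    using hahn_banach by metis
  have "ap \<phi> (x \<ominus> y) = 0" using \<phi> assms by (simp add: ap_simps)
  then have "nm (x \<ominus> y) = 0" using \<phi>(2) by simp
  then have "x \<ominus> y = \<zero>" using h nm_eq_0 by simp
  then have "x \<ominus> y \<oplus> y = y" using assms by simp
  then show ?thesis using assms by (simp add: ad_assoc)
qed

lemma zero_mu [simp]: "x \<in> B \<Longrightarrow> \<zero> \<odot> x = \<zero>"
  using sm_mu[of \<zero> x 0] by simp

lemma mu_zero [simp]: "x \<in> B \<Longrightarrow> x \<odot> \<zero> = \<zero>"
  using mu_sm[of x \<zero> 0] by simp

lemma st_e [simp]: "st e = e"
  using st_mu[of e "st e"] by simp

lemma st_zero [simp]: "st \<zero> = \<zero>"
  using st_sm[of \<zero> 0] by simp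

lemma nm_zero [simp]: "nm \<zero> = 0"
  using nm_eq_0 by simp

text \<open>The C*-identity gives \<open>nm e ^ 2 = nm e\<close>. The value 0 occurs in the zero
  algebra, which is not excluded, so only the inequality is available.\<close>

lemma nm_e: "nm e \<le> 1"
proof -
  have "nm e * nm e = nm e" using nm_cstar[of e] by (simp add: power2_eq_square)
  then have "nm e = 0 \<or> nm e = 1" by (metis mult_cancel_right1)
  then show ?thesis by auto
qed

lemma nm_sc: "t \<ge> 0 \<Longrightarrow> nm (sc t) \<le> t"
  using mult_left_mono[OF nm_e] by (simp add: nm_sm)

lemmas dist_simps = ad_mu mu_ad sm_mu mu_sm mu_assoc st_mu st_ad st_sm

lemma lcomm: "x \<in> B \<Longrightarrow> y \<in> B \<Longrightarrow> z \<in> B \<Longrightarrow> x \<odot> y = y \<odot> x \<Longrightarrow> x \<odot> (y \<odot> z) = y \<odot> (x \<odot> z)"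
  by (metis mu_assoc)

lemma nm_sa: "x \<in> B \<Longrightarrow> st x = x \<Longrightarrow> nm (x \<odot> x) = (nm x)\<^sup>2"
  using nm_cstar[of x] by simp

lemma nm_mi_comm: "x \<in> B \<Longrightarrow> y \<in> B \<Longrightarrow> nm (x \<ominus> y) = nm (y \<ominus> x)"
proof -
  assume xy: "x \<in> B" "y \<in> B"
  have "x \<ominus> y = (-1) \<cdot> (y \<ominus> x)"
    by (rule eqI) (use xy in \<open>simp_all add: ap_simps\<close>)
  then show ?thesis using xy by (simp add: nm_sm)
qed

lemma nm_mi_triangle: "x \<in> B \<Longrightarrow> y \<in> B \<Longrightarrow> z \<in> B \<Longrightarrow> nm (x \<ominus> z) \<le> nm (x \<ominus> y) + nm (y \<ominus> z)"
proof -
  assume xy: "x \<in> B" "y \<in> B" "z \<in> B"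
  have "x \<ominus> z = (x \<ominus> y) \<oplus> (y \<ominus> z)"
    by (rule eqI) (use xy in \<open>simp_all add: ap_simps\<close>)
  then show ?thesis using xy by (simp add: nm_ad)
qed

section \<open>Limits of sequences in the algebra\<close>

definition conv :: "(nat \<Rightarrow> 'a) \<Rightarrow> 'a \<Rightarrow> bool" where
  "conv X L \<longleftrightarrow> (\<lambda>n. nm (X n \<ominus> L)) \<longlonglongrightarrow> 0"

lemma convI: "(\<And>n. X n \<in> B) \<Longrightarrow> L \<in> B \<Longrightarrow> (\<And>n. nm (X n \<ominus> L) \<le> b n) \<Longrightarrow> b \<longlonglongrightarrow> 0 \<Longrightarrow> conv X L"
  unfolding conv_def by (rule tendsto_sandwich[of "\<lambda>_. 0" _ _ b]) auto

lemma conv_unique: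
  assumes "\<And>n. X n \<in> B" "L \<in> B" "M \<in> B" "conv X L" "conv X M"
  shows "L = M"
proof -
  have "(\<lambda>n. nm (X n \<ominus> L) + nm (X n \<ominus> M)) \<longlonglongrightarrow> 0 + 0"
    using assms(4,5) unfolding conv_def by (rule tendsto_add)
  moreover have "nm (L \<ominus> M) \<le> nm (X n \<ominus> L) + nm (X n \<ominus> M)" for n
    using nm_mi_triangle[of L "X n" M] nm_mi_comm[of L "X n"] assms by simp
  ultimately have "nm (L \<ominus> M) \<le> 0"
    by (metis (no_types, lifting) Lim_bounded2 add_0)
  then have "L \<ominus> M = \<zero>"
    using assms nm_eq_0[of "L \<ominus> M"] nm_nonneg[of "L \<ominus> M"] by (metis ad_closed antisym sm_closed)
  then have "L \<ominus> M \<oplus> M = M" using assms by simp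
  then show ?thesis using assms by (simp add: ad_assoc)
qed

lemma conv_mu:
  assumes "\<And>n. X n \<in> B" "\<And>n. Y n \<in> B" "L \<in> B" "M \<in> B" "conv X L" "conv Y M"
  shows "conv (\<lambda>n. X n \<odot> Y n) (L \<odot> M)"
proof (rule convI)
  let ?b = "\<lambda>n. nm (X n \<ominus> L) * (nm (Y n \<ominus> M) + nm M) + nm L * nm (Y n \<ominus> M)"
  have "?b \<longlonglongrightarrow> 0 * (0 + nm M) + nm L * 0"
    using assms(5,6) unfolding conv_def by (intro tendsto_intros)
  then show "?b \<longlonglongrightarrow> 0" by simp
  fix n
  have "X n \<odot> Y n \<ominus> L \<odot> M = (X n \<ominus> L) \<odot> ((Y n \<ominus> M) \<oplus> M) \<oplus> L \<odot> (Y n \<ominus> M)"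
    by (rule eqI) (use assms in \<open>simp_all add: ap_simps dist_simps\<close>)
  also have "nm \<dots> \<le> nm ((X n \<ominus> L) \<odot> ((Y n \<ominus> M) \<oplus> M)) + nm (L \<odot> (Y n \<ominus> M))"
    using assms by (intro nm_ad) auto
  also have "\<dots> \<le> nm (X n \<ominus> L) * nm ((Y n \<ominus> M) \<oplus> M) + nm L * nm (Y n \<ominus> M)"
    using assms by (intro add_mono nm_mu) auto
  also have "\<dots> \<le> ?b n"
    using assms by (intro add_mono mult_left_mono nm_ad) auto
  finally show "nm (X n \<odot> Y n \<ominus> L \<odot> M) \<le> ?b n" .
qed (use assms in auto)

lemma conv_ad:
  assumes "\<And>n. X n \<in> B" "\<And>n. Y n \<in> B" "L \<in> B" "M \<in> B" "conv X L" "conv Y M"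
  shows "conv (\<lambda>n. X n \<oplus> Y n) (L \<oplus> M)"
proof (rule convI)
  let ?b = "\<lambda>n. nm (X n \<ominus> L) + nm (Y n \<ominus> M)"
  have "?b \<longlonglongrightarrow> 0 + 0" using assms(5,6) unfolding conv_def by (intro tendsto_intros)
  then show "?b \<longlonglongrightarrow> 0" by simp
  fix n
  have "X n \<oplus> Y n \<ominus> (L \<oplus> M) = (X n \<ominus> L) \<oplus> (Y n \<ominus> M)"
    by (rule eqI) (use assms in \<open>simp_all add: ap_simps dist_simps\<close>)
  then show "nm (X n \<oplus> Y n \<ominus> (L \<oplus> M)) \<le> ?b n" using assms by (simp add: nm_ad)
qed (use assms in auto)

lemma conv_const: "L \<in> B \<Longrightarrow> conv (\<lambda>_. L) L"
  by (simp add: conv_def)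

lemma conv_st:
  assumes "\<And>n. X n \<in> B" "L \<in> B" "conv X L" shows "conv (\<lambda>n. st (X n)) (st L)"
proof (rule convI)
  show "(\<lambda>n. nm (X n \<ominus> L)) \<longlonglongrightarrow> 0" using assms(3) by (simp add: conv_def)
  fix n
  have "st (X n) \<ominus> st L = st (X n \<ominus> L)" using assms by (simp add: st_ad st_sm)
  then show "nm (st (X n) \<ominus> st L) \<le> nm (X n \<ominus> L)" using assms by (simp add: nm_st)
qed (use assms in auto)

lemma conv_Suc: "conv X L \<Longrightarrow> conv (\<lambda>n. X (Suc n)) L"
  unfolding conv_def by (rule LIMSEQ_Suc)

lemma conv_bound:
  assumes "\<And>n. X n \<in> B" "L \<in> B" "conv X L" "\<And>n. nm (X n) \<le> b" shows "nm L \<le> b"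
proof -
  have "(\<lambda>n. b + nm (X n \<ominus> L)) \<longlonglongrightarrow> b + 0"
    using assms(3) unfolding conv_def by (intro tendsto_intros)
  moreover have "nm L \<le> b + nm (X n \<ominus> L)" for n
  proof -
    have "L = X n \<oplus> (L \<ominus> X n)"
      by (rule eqI) (use assms in \<open>simp_all add: ap_simps\<close>)
    then have "nm L \<le> nm (X n) + nm (L \<ominus> X n)"
      using nm_ad[of "X n" "L \<ominus> X n"] assms by simp
    then show ?thesis using nm_mi_comm[of L "X n"] assms(1,2) assms(4)[of n] by simp
  qed
  ultimately show ?thesis
    by (metis (no_types, lifting) Lim_bounded2 add_0_right)
qed

text \<open>Fixed-point iteration for \<open>w = (z + w\<^sup>2) / 2\<close>, the equation satisfied by \<open>w = 1 - \<surd>(1 - z)\<close>. Its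
  increments are dominated by those of the scalar iteration for \<open>z = 1\<close>, so it converges even on
  the boundary of the unit ball.\<close>
primrec sqit :: "'a \<Rightarrow> nat \<Rightarrow> 'a" where
  "sqit z 0 = \<zero>"
| "sqit z (Suc k) = (1/2) \<cdot> (z \<oplus> sqit z k \<odot> sqit z k)"

context
  fixes z assumes z: "z \<in> B" "st z = z" "nm z \<le> 1"
begin

lemma sqit_closed [simp]: "sqit z k \<in> B"
  by (induction k) (use z in auto)

lemma sqit_sa: "st (sqit z k) = sqit z k"
  by (induction k) (use z in \<open>simp_all add: st_ad st_sm st_mu\<close>)

lemma sqit_commute: assumes "y \<in> B" "y \<odot> z = z \<odot> y" shows "y \<odot> sqit z k = sqit z k \<odot> y"
proof (induction k)
  case (Suc k)
  have "y \<odot> (sqit z k \<odot> sqit z k) = sqit z k \<odot> sqit z k \<odot> y"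
    using Suc assms by (metis mu_assoc sqit_closed)
  then show ?case using assms z by (simp add: dist_simps)
qed (use assms in simp)

lemma sqit_commute_self: "sqit z j \<odot> sqit z k = sqit z k \<odot> sqit z j"
  using sqit_commute[of "sqit z j" k] sqit_commute[of z j] z by simp

lemma sqit_norm: "nm (sqit z k) \<le> sqit_bound k"
proof (induction k)
  case (Suc k)
  have "nm (sqit z (Suc k)) \<le> (nm z + nm (sqit z k \<odot> sqit z k)) / 2"
    using nm_ad[of z "sqit z k \<odot> sqit z k"] z by (simp add: nm_sm)
  moreover have "nm (sqit z k \<odot> sqit z k) \<le> (sqit_bound k)\<^sup>2"
    using nm_mu[of "sqit z k" "sqit z k"] power_mono[OF Suc, of 2] by (simp add: power2_eq_square)
  ultimately show ?case using z(3) unfolding sqit_bound.simps by simp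
qed simp

text \<open>The iterates commute, so the difference of successive squares factors as
  \<open>(a - b) (a + b)\<close>. The majorant satisfies the same recursion for its increments with
  equality.\<close>

lemma sqit_step: "nm (sqit z (Suc k) \<ominus> sqit z k) \<le> sqit_bound (Suc k) - sqit_bound k"
proof (induction k)
  case 0
  then show ?case using z by (simp add: nm_sm)
next
  case (Suc k)
  let ?a = "sqit z (Suc k)" and ?b = "sqit z k"
  have "sqit z (Suc (Suc k)) \<ominus> ?a = (1/2) \<cdot> ((?a \<ominus> ?b) \<odot> (?a \<oplus> ?b))"
  proof (rule eqI)
    fix \<phi> assume "\<phi> \<in> lf"
    moreover have "sqit z (Suc (Suc k)) \<ominus> ?a = (1/2) \<cdot> (z \<oplus> ?a \<odot> ?a) \<ominus> (1/2) \<cdot> (z \<oplus> ?b \<odot> ?b)" by simp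
    ultimately show "ap \<phi> (sqit z (Suc (Suc k)) \<ominus> ?a) = ap \<phi> ((1/2) \<cdot> ((?a \<ominus> ?b) \<odot> (?a \<oplus> ?b)))"
      using z sqit_commute_self[of "Suc k" k]
      by (simp add: ap_simps dist_simps algebra_simps del: sqit.simps)
  qed (use z in simp_all)
  then have 1: "nm (sqit z (Suc (Suc k)) \<ominus> ?a) \<le> (nm (?a \<ominus> ?b) * nm (?a \<oplus> ?b)) / 2"
    using nm_mu[of "?a \<ominus> ?b" "?a \<oplus> ?b"] by (simp add: nm_sm del: sqit.simps)
  have 2: "nm (?a \<ominus> ?b) * nm (?a \<oplus> ?b)
      \<le> (sqit_bound (Suc k) - sqit_bound k) * (sqit_bound (Suc k) + sqit_bound k)"
  proof (rule mult_mono)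
    have "nm (?a \<oplus> ?b) \<le> nm ?a + nm ?b" by (rule nm_ad) (simp_all del: sqit.simps)
    also have "\<dots> \<le> sqit_bound (Suc k) + sqit_bound k" using sqit_norm by (intro add_mono)
    finally show "nm (?a \<oplus> ?b) \<le> sqit_bound (Suc k) + sqit_bound k" .
    show "0 \<le> nm (?a \<oplus> ?b)" by (rule nm_nonneg) (simp del: sqit.simps)
    show "0 \<le> sqit_bound (Suc k) - sqit_bound k"
      using incseq_SucD[OF sqit_bound_mono, of k] by simp
  qed (fact Suc)
  have 3: "(sqit_bound (Suc k) - sqit_bound k) * (sqit_bound (Suc k) + sqit_bound k) / 2
      = sqit_bound (Suc (Suc k)) - sqit_bound (Suc k)"
    by (simp add: power2_eq_square field_simps)
  show ?case using 1 2 3 by linarith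
qed

lemma sqit_diff: "n \<le> m \<Longrightarrow> nm (sqit z m \<ominus> sqit z n) \<le> sqit_bound m - sqit_bound n"
proof (induction m rule: dec_induct)
  case base then show ?case by simp
next
  case (step m)
  have "nm (sqit z (Suc m) \<ominus> sqit z n) \<le> nm (sqit z (Suc m) \<ominus> sqit z m) + nm (sqit z m \<ominus> sqit z n)"
    by (rule nm_mi_triangle) (simp_all del: sqit.simps)
  then show ?case using step sqit_step[of m] by linarith
qed

text \<open>The root is \<open>c = e - w\<close> for the limit \<open>w\<close>: the equation
  \<open>2 w = z + w^2\<close> rearranges to \<open>(e - w)^2 = e - z\<close>. The commutation
  clause stands in for functional calculus, and \<open>nm (e - c) <= 1\<close> records that
  \<open>c\<close> is a positive root.\<close>

lemma sqrt_one_minus: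
  obtains c where "c \<in> B" "st c = c" "nm (e \<ominus> c) \<le> 1" "c \<odot> c = e \<ominus> z"
    "\<And>y. y \<in> B \<Longrightarrow> y \<odot> z = z \<odot> y \<Longrightarrow> y \<odot> c = c \<odot> y"
proof -
  have "\<exists>L\<in>B. (\<lambda>n. nm (sqit z n \<ominus> L)) \<longlonglongrightarrow> 0"
  proof (rule nm_complete)
    fix \<epsilon> :: real assume "\<epsilon> > 0"
    then obtain N where N: "\<And>m n. m \<ge> N \<Longrightarrow> n \<ge> N \<Longrightarrow> \<bar>sqit_bound m - sqit_bound n\<bar> < \<epsilon>"
      using sqit_bound_Cauchy unfolding Cauchy_def dist_real_def by blast
    have "nm (sqit z m \<ominus> sqit z n) < \<epsilon>" if "m \<ge> N" "n \<ge> N" for m n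
    proof (cases "n \<le> m")
      case True then show ?thesis using sqit_diff[OF True] N[OF that] by simp
    next
      case False then show ?thesis
        using sqit_diff[of m n] N[OF that] nm_mi_comm[of "sqit z m" "sqit z n"] by simp
    qed
    then show "\<exists>N. \<forall>m\<ge>N. \<forall>n\<ge>N. nm (sqit z m \<ominus> sqit z n) < \<epsilon>" by blast
  qed simp
  then obtain w where w: "w \<in> B" and cw: "conv (sqit z) w" unfolding conv_def by blast
  \<comment> \<open>Scaling by 1/2 is written as multiplication by the constant
    \<open>(1/2) e\<close>, so that \<open>conv_mu\<close> covers it.\<close>
  have "conv (\<lambda>k. sqit z (Suc k)) ((1/2) \<cdot> e \<odot> (z \<oplus> w \<odot> w))"
  proof -
    have "conv (\<lambda>k. (1/2) \<cdot> e \<odot> (z \<oplus> sqit z k \<odot> sqit z k)) ((1/2) \<cdot> e \<odot> (z \<oplus> w \<odot> w))"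
      using w z cw by (intro conv_mu conv_ad conv_const) auto
    then show ?thesis using z by (simp add: sm_mu)
  qed
  then have weq: "w = (1/2) \<cdot> e \<odot> (z \<oplus> w \<odot> w)"
    using conv_unique[of "\<lambda>k. sqit z (Suc k)" w "(1/2) \<cdot> e \<odot> (z \<oplus> w \<odot> w)"] conv_Suc[OF cw] w z
      sqit_closed[of "Suc _"] by blast
  have stw: "st w = w"
    using conv_unique[of "sqit z" "st w" w] conv_st[OF _ w cw] w cw by (simp add: sqit_sa)
  have "nm w \<le> 1"
    using conv_bound[OF _ w cw, of 1] sqit_norm sqit_bound_range by (meson order_trans sqit_closed)
  moreover have com: "y \<odot> w = w \<odot> y" if y: "y \<in> B" "y \<odot> z = z \<odot> y" for y
  proof (rule conv_unique[of "\<lambda>k. y \<odot> sqit z k"])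
    show "conv (\<lambda>k. y \<odot> sqit z k) (y \<odot> w)" using y w cw by (intro conv_mu conv_const) auto
    have "conv (\<lambda>k. sqit z k \<odot> y) (w \<odot> y)" using y w cw by (intro conv_mu conv_const) auto
    then show "conv (\<lambda>k. y \<odot> sqit z k) (w \<odot> y)" by (simp add: sqit_commute[OF y])
  qed (use y w in auto)
  moreover have "(e \<ominus> w) \<odot> (e \<ominus> w) = e \<ominus> z"
  proof (rule eqI)
    fix \<phi> assume \<phi>: "\<phi> \<in> lf"
    have "ap \<phi> w = (ap \<phi> z + ap \<phi> (w \<odot> w)) / 2"
      using arg_cong[OF weq, of "ap \<phi>"] w z \<phi> by (simp add: ap_simps sm_mu)
    then show "ap \<phi> ((e \<ominus> w) \<odot> (e \<ominus> w)) = ap \<phi> (e \<ominus> z)"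
      using \<phi> w z by (simp add: ap_simps dist_simps field_simps)
  qed (use w z in auto)
  moreover have "e \<ominus> (e \<ominus> w) = w"
    by (rule eqI) (use w in \<open>simp_all add: ap_simps\<close>)
  moreover have "y \<odot> (e \<ominus> w) = (e \<ominus> w) \<odot> y" if "y \<in> B" "y \<odot> z = z \<odot> y" for y
    using com[OF that] that w by (simp add: dist_simps)
  ultimately show thesis using w stw by (intro that[of "e \<ominus> w"]) (simp_all add: st_ad st_sm)
qed

end

text \<open>Rescaled \<open>sqrt_one_minus\<close>: \<open>y = t (e - z)\<close> with
  \<open>nm z <= 1\<close>. The norm bound on \<open>r\<close> has the shape of the hypothesis with
  \<open>sqrt t\<close> in place of \<open>t\<close>, so a root can be extracted from
  \<open>r\<close> again.\<close>

lemma sqrt_near_scalar: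
  assumes t: "t > 0" and y: "y \<in> B" "st y = y" "nm (sc t \<ominus> y) \<le> t"
  obtains r where "r \<in> B" "st r = r" "r \<odot> r = y" "nm (sc (sqrt t) \<ominus> r) \<le> sqrt t"
    "\<And>x. x \<in> B \<Longrightarrow> x \<odot> y = y \<odot> x \<Longrightarrow> x \<odot> r = r \<odot> x"
proof -
  let ?z = "complex_of_real (1/t) \<cdot> (sc t \<ominus> y)"
  have z: "?z \<in> B" "st ?z = ?z" "nm ?z \<le> 1"
    using y t by (simp_all add: st_ad st_sm nm_sm norm_divide)
  obtain c where c: "c \<in> B" "st c = c" "nm (e \<ominus> c) \<le> 1" "c \<odot> c = e \<ominus> ?z"
    and com: "\<And>x. x \<in> B \<Longrightarrow> x \<odot> ?z = ?z \<odot> x \<Longrightarrow> x \<odot> c = c \<odot> x"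
    using sqrt_one_minus[OF z] by blast
  have t2: "complex_of_real (sqrt t) * (complex_of_real (sqrt t) * a) = complex_of_real t * a" for a
    using t by (simp flip: of_real_mult mult.assoc)
  let ?r = "complex_of_real (sqrt t) \<cdot> c"
  have "?r \<odot> ?r = y"
  proof (rule eqI)
    fix \<phi> assume \<phi>: "\<phi> \<in> lf"
    have "ap \<phi> (?r \<odot> ?r) = t * ap \<phi> (c \<odot> c)"
      using \<phi> c(1) t2 by (simp add: ap_simps sm_mu mu_sm)
    also have "\<dots> = ap \<phi> y" unfolding c(4) using \<phi> y t by (simp add: ap_simps field_simps)
    finally show "ap \<phi> (?r \<odot> ?r) = ap \<phi> y" .
  qed (use c y in auto)
  moreover have "sc (sqrt t) \<ominus> ?r = complex_of_real (sqrt t) \<cdot> (e \<ominus> c)"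
    by (rule eqI) (use c in \<open>simp_all add: ap_simps algebra_simps\<close>)
  then have "nm (sc (sqrt t) \<ominus> ?r) \<le> sqrt t"
    using c t mult_left_mono[of "nm (e \<ominus> c)" 1 "sqrt t"] by (simp add: nm_sm)
  moreover have "x \<odot> ?r = ?r \<odot> x" if x: "x \<in> B" "x \<odot> y = y \<odot> x" for x
  proof -
    have "x \<odot> ?z = ?z \<odot> x" using x y by (simp add: dist_simps)
    then show ?thesis using com[OF x(1)] x c by (simp add: dist_simps)
  qed
  ultimately show thesis using c by (intro that[of ?r]) (simp_all add: st_sm)
qed

text \<open>\<open>u = b + i c\<close> satisfies \<open>u* u = t\<close>, and \<open>b\<close> is its real part.\<close>
lemma nm_real_part_unitary:
  assumes b: "b \<in> B" "st b = b" and c: "c \<in> B" "st c = c" and bc: "b \<odot> c = c \<odot> b"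
    and t: "t \<ge> 0" "b \<odot> b \<oplus> c \<odot> c = sc t"
  shows "(nm b)\<^sup>2 \<le> t"
proof -
  let ?u = "b \<oplus> \<i> \<cdot> c"
  have "st ?u \<odot> ?u = b \<odot> b \<oplus> c \<odot> c"
    by (rule eqI) (use b c bc in \<open>simp_all add: ap_simps dist_simps algebra_simps\<close>)
  then have "(nm ?u)\<^sup>2 \<le> t"
    using nm_cstar[of ?u] b c t nm_sc[OF t(1)] by simp
  moreover have "b = (1/2) \<cdot> (?u \<oplus> st ?u)"
    by (rule eqI) (use b c in \<open>simp_all add: ap_simps dist_simps field_simps\<close>)
  then have "nm b \<le> (nm ?u + nm (st ?u)) / 2"
    using nm_ad[of ?u "st ?u"] nm_sm[of "?u \<oplus> st ?u" "1/2"] b c by simp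
  then have "nm b \<le> nm ?u" using nm_st[of ?u] b c by simp
  then have "(nm b)\<^sup>2 \<le> (nm ?u)\<^sup>2" using b by (intro power_mono) auto
  ultimately show ?thesis by simp
qed

text \<open>Scale to \<open>b = r / sqrt t\<close> and let \<open>c\<close> be a root of
  \<open>e - b^2\<close> commuting with \<open>b\<close>. Then \<open>c + i b\<close> is unitary, so
  its real part has \<open>nm c <= 1\<close>, and the element in question is
  \<open>t c^2\<close>.\<close>

lemma nm_scalar_minus_square:
  assumes r: "r \<in> B" "st r = r" and t: "t > 0" "(nm r)\<^sup>2 \<le> t"
  shows "nm (sc t \<ominus> r \<odot> r) \<le> t"
proof -
  let ?z = "complex_of_real (1/t) \<cdot> (r \<odot> r)"
  let ?b = "complex_of_real (1/sqrt t) \<cdot> r"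
  have z: "?z \<in> B" "st ?z = ?z" "nm ?z \<le> 1"
    using r t by (simp_all add: st_mu st_sm nm_sm nm_sa norm_divide)
  obtain c where c: "c \<in> B" "st c = c" "c \<odot> c = e \<ominus> ?z"
    and com: "\<And>x. x \<in> B \<Longrightarrow> x \<odot> ?z = ?z \<odot> x \<Longrightarrow> x \<odot> c = c \<odot> x"
    using sqrt_one_minus[OF z] by blast
  have "r \<odot> c = c \<odot> r" using r by (intro com) (simp_all add: dist_simps)
  then have bc: "c \<odot> ?b = ?b \<odot> c" using r c by (simp add: dist_simps)
  have "complex_of_real (1/sqrt t) * complex_of_real (1/sqrt t) = complex_of_real (1/t)"
    using t by (simp flip: of_real_mult)
  then have "?b \<odot> ?b = ?z" using r by (simp add: dist_simps flip: mult_sm)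
  then have "c \<odot> c \<oplus> ?b \<odot> ?b = sc 1" using c(3) r by (simp add: ad_assoc)
  then have "(nm c)\<^sup>2 \<le> 1"
    using nm_real_part_unitary[OF c(1,2) _ _ bc, of 1] r by (simp add: st_sm)
  moreover have "sc t \<ominus> r \<odot> r = complex_of_real t \<cdot> (c \<odot> c)"
    unfolding c(3) by (rule eqI) (use r t in \<open>simp_all add: ap_simps field_simps\<close>)
  ultimately show ?thesis using c(1,2) t by (simp add: nm_sm nm_sa)
qed

section \<open>Positive elements of a C*-algebra\<close>

definition pos :: "'a \<Rightarrow> bool" where
  "pos y \<longleftrightarrow> (\<exists>r\<in>B. st r = r \<and> y = r \<odot> r)"

lemma pos_closed: "pos y \<Longrightarrow> y \<in> B" and pos_sa: "pos y \<Longrightarrow> st y = y"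
  and pos_square: "r \<in> B \<Longrightarrow> st r = r \<Longrightarrow> pos (r \<odot> r)"
  by (auto simp: pos_def st_mu)

lemma pos_nm: "pos y \<Longrightarrow> t > 0 \<Longrightarrow> nm y \<le> t \<Longrightarrow> nm (sc t \<ominus> y) \<le> t"
  using nm_scalar_minus_square by (auto simp: pos_def nm_sa)

lemma nm_pos: "t > 0 \<Longrightarrow> y \<in> B \<Longrightarrow> st y = y \<Longrightarrow> nm (sc t \<ominus> y) \<le> t \<Longrightarrow> pos y"
  using sqrt_near_scalar[of t y] by (metis pos_def)

lemma pos_zero [simp]: "pos \<zero>"
  using pos_square[of \<zero>] by simp

text \<open>A sum of two squares is not visibly a square, but the norm criterion is additive: radii
  add, and so do the deviations from them. The summand 1 keeps the radii strictly positive.\<close>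

lemma pos_ad: assumes "pos x" "pos y" shows "pos (x \<oplus> y)"
proof -
  let ?s = "nm x + 1" and ?t = "nm y + 1"
  have xy: "x \<in> B" "y \<in> B" "st x = x" "st y = y" using assms by (simp_all add: pos_closed pos_sa)
  have st: "?s > 0" "?t > 0" using xy by (simp_all add: add_nonneg_pos)
  have "sc (?s + ?t) \<ominus> (x \<oplus> y) = (sc ?s \<ominus> x) \<oplus> (sc ?t \<ominus> y)"
    by (rule eqI) (use xy in \<open>simp_all add: ap_simps algebra_simps\<close>)
  also have "nm \<dots> \<le> nm (sc ?s \<ominus> x) + nm (sc ?t \<ominus> y)" using xy by (intro nm_ad) auto
  also have "\<dots> \<le> ?s + ?t" using assms st by (intro add_mono pos_nm) auto
  finally show ?thesis using xy st by (intro nm_pos[of "?s + ?t"]) (auto simp: st_ad)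
qed

lemma pos_sm: assumes "pos x" "t \<ge> 0" shows "pos (complex_of_real t \<cdot> x)"
proof -
  obtain r where r: "r \<in> B" "st r = r" "x = r \<odot> r" using assms by (auto simp: pos_def)
  have "complex_of_real (sqrt t) * complex_of_real (sqrt t) = complex_of_real t"
    using assms by (simp flip: of_real_mult)
  then have "complex_of_real t \<cdot> x = (complex_of_real (sqrt t) \<cdot> r) \<odot> (complex_of_real (sqrt t) \<cdot> r)"
    using r by (simp add: dist_simps flip: mult_sm)
  then show ?thesis using r by (simp add: pos_square st_sm)
qed

lemma pos_scalar_minus: assumes "y \<in> B" "st y = y" "nm y \<le> t" shows "pos (sc t \<ominus> y)"
proof (cases "t > 0")
  case True
  have "sc t \<ominus> (sc t \<ominus> y) = y" by (rule eqI) (use assms in \<open>simp_all add: ap_simps\<close>)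
  then show ?thesis using assms True by (intro nm_pos[of t]) (simp_all add: st_ad st_sm)
next
  case False
  with assms have "nm y = 0" "t = 0" using nm_nonneg[of y] by linarith+
  then show ?thesis using assms nm_eq_0 by simp
qed

text \<open>Let \<open>c\<close> be a root of \<open>t - r^2\<close> commuting with
  \<open>r\<close>; then \<open>u = r + i c\<close> satisfies \<open>u* u = t\<close>, and
  \<open>r\<close> is its real part. Together with \<open>pos_scalar_minus\<close> this expresses
  the norm of a square by the order alone.\<close>

lemma nm_le_if_pos:
  assumes r: "r \<in> B" "st r = r" and t: "t \<ge> 0" and p: "pos (sc t \<ominus> r \<odot> r)"
  shows "(nm r)\<^sup>2 \<le> t"
proof -
  let ?y = "sc t \<ominus> r \<odot> r"
  have y: "?y \<in> B" "st ?y = ?y" using p pos_closed pos_sa by auto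
  have s: "nm ?y + 1 > 0" using y by (simp add: add_nonneg_pos)
  have yb: "nm (sc (nm ?y + 1) \<ominus> ?y) \<le> nm ?y + 1" using pos_nm[OF p s] by simp
  obtain c where c: "c \<in> B" "st c = c" "c \<odot> c = ?y"
    and com: "\<And>x. x \<in> B \<Longrightarrow> x \<odot> ?y = ?y \<odot> x \<Longrightarrow> x \<odot> c = c \<odot> x"
    by (rule sqrt_near_scalar[OF s y yb]) (rule that; assumption)
  have "r \<odot> c = c \<odot> r" using r by (intro com) (simp_all add: dist_simps)
  moreover have "r \<odot> r \<oplus> c \<odot> c = sc t"
    unfolding c(3) by (rule eqI) (use r in \<open>simp_all add: ap_simps\<close>)
  ultimately show ?thesis using nm_real_part_unitary r c t by blast
qed

text \<open>\<open>k\<close> is a fourth root of \<open>y^2\<close>, that is, a square root of the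
  absolute value \<open>d\<close>. The second extraction is possible because
  \<open>sqrt_near_scalar\<close> supplies a norm bound for \<open>d\<close>; and \<open>y\<close>
  commutes with \<open>y^2\<close>, hence with \<open>d\<close>, hence with
  \<open>k\<close>.\<close>

lemma abs_exists:
  assumes y: "y \<in> B" "st y = y"
  obtains k where "k \<in> B" "st k = k" "k \<odot> k \<odot> (k \<odot> k) = y \<odot> y" "y \<odot> k = k \<odot> y"
proof -
  let ?t = "(nm y)\<^sup>2 + 1"
  have t: "?t > 0" by (simp add: add_nonneg_pos)
  have yy: "y \<odot> y \<in> B" "st (y \<odot> y) = y \<odot> y" using y by (simp_all add: st_mu)
  have yb: "nm (sc ?t \<ominus> y \<odot> y) \<le> ?t" using nm_scalar_minus_square[OF y t] by simp
  obtain d where d: "d \<in> B" "st d = d" "d \<odot> d = y \<odot> y" "nm (sc (sqrt ?t) \<ominus> d) \<le> sqrt ?t"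
    and com: "\<And>x. x \<in> B \<Longrightarrow> x \<odot> (y \<odot> y) = (y \<odot> y) \<odot> x \<Longrightarrow> x \<odot> d = d \<odot> x"
    by (rule sqrt_near_scalar[OF t yy yb]) (rule that; assumption)
  have "sqrt ?t > 0" using t by simp
  then obtain k where k: "k \<in> B" "st k = k" "k \<odot> k = d"
    and com': "\<And>x. x \<in> B \<Longrightarrow> x \<odot> d = d \<odot> x \<Longrightarrow> x \<odot> k = k \<odot> x"
    by (rule sqrt_near_scalar[OF _ d(1,2,4)]) (assumption | rule that; assumption)+
  have "y \<odot> k = k \<odot> y" using y by (intro com' com) (simp_all add: mu_assoc)
  then show thesis using that k d by simp
qed

text \<open>With \<open>\<bar>y\<bar> = k\<^sup>2\<close>, take \<open>m = \<bar>y\<bar> - y\<close> (twice the negative part of \<open>y\<close>) and \<open>n = k m\<close>.\<close>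
lemma negative_part:
  assumes y: "y \<in> B" "st y = y"
  obtains m n where "m \<in> B" "st m = m" "n \<in> B" "st n = n" "m \<odot> (y \<odot> m) = (-1) \<cdot> (n \<odot> n)"
    "n = \<zero> \<Longrightarrow> pos y"
proof -
  obtain k where k: "k \<in> B" "st k = k" and k4: "k \<odot> k \<odot> (k \<odot> k) = y \<odot> y" and yk: "y \<odot> k = k \<odot> y"
    using abs_exists[OF y] by blast
  have yk': "y \<odot> (k \<odot> x) = k \<odot> (y \<odot> x)" if "x \<in> B" for x using lcomm[OF y(1) k(1) that yk] .
  have k4': "k \<odot> (k \<odot> (k \<odot> k)) = y \<odot> y" using k4 k by (simp add: mu_assoc)
  have k4'': "k \<odot> (k \<odot> (k \<odot> (k \<odot> x))) = y \<odot> (y \<odot> x)" if "x \<in> B" for x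
    using arg_cong[OF k4', of "\<lambda>a. a \<odot> x"] that k y by (simp add: mu_assoc)
  let ?m = "k \<odot> k \<ominus> y" and ?n = "k \<odot> (k \<odot> k \<ominus> y)"
  \<comment> \<open>Since \<open>k\<close> and \<open>y\<close> commute and
    \<open>k^4 = y^2\<close>, both sides equal \<open>-2 y^2 (k^2 - y)\<close>.\<close>
  have 1: "?m \<odot> (y \<odot> ?m) = (-1) \<cdot> (?n \<odot> ?n)"
    by (rule eqI) (use y k in \<open>simp_all add: ap_simps dist_simps yk yk' k4' k4''\<close>)
  have 2: "pos y" if "?n = \<zero>"
  proof -
    have "?m \<odot> ?m = 2 \<cdot> (k \<odot> ?n)"
      by (rule eqI) (use y k in \<open>simp_all add: ap_simps dist_simps yk yk' k4' k4'' algebra_simps\<close>)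
    then have "?m \<odot> ?m = \<zero>" using that k by simp
    moreover have "st ?m = ?m" "?m \<in> B" using y k by (simp_all add: dist_simps)
    ultimately have "?m = \<zero>" using nm_sa[of ?m] nm_eq_0[of ?m] by simp
    then have "?m \<oplus> y = y" using y by simp
    then have "k \<odot> k = y" using y k by (simp add: ad_assoc)
    then show ?thesis using pos_square k by metis
  qed
  have "st ?n = ?n" using y k by (simp add: dist_simps yk)
  then show thesis using that[OF _ _ _ _ 1 2] y k by (simp add: dist_simps)
qed

text \<open>With \<open>m\<close>, \<open>l\<close> the real and imaginary parts of
  \<open>v\<close>, \<open>v* v + v v* = 2 m^2 + 2 l^2\<close>, so \<open>q = v v*\<close> is a sum
  of squares, hence of the form \<open>r^2\<close>. In place of comparing the spectra of
  \<open>v* v\<close> and \<open>v v*\<close>, one looks at \<open>g = v* (e + q)\<close>: it equals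
  \<open>(e - n^2) v*\<close> and so has norm at most 1, while \<open>g* g = (r + r^3)^2\<close>
  dominates \<open>2 r^4\<close> and \<open>nm (r^2) = 1\<close>.\<close>

lemma minus_square_aux:
  assumes v: "v \<in> B" "nm v = 1" and n: "n \<in> B" "st n = n" and vn: "st v \<odot> v = (-1) \<cdot> (n \<odot> n)"
  shows False
proof -
  let ?q = "v \<odot> st v"
  have "nm (st v \<odot> v) = 1" using v by (simp add: nm_cstar)
  then have "nm n ^ 2 = 1" unfolding vn using n by (simp add: nm_sm nm_sa)
  then have np: "nm (e \<ominus> n \<odot> n) \<le> 1" using nm_scalar_minus_square[OF n, of 1] by simp
  have s2: "complex_of_real (sqrt 2) * (complex_of_real (sqrt 2) * a) = 2 * a" for a
    by (simp flip: of_real_mult mult.assoc)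
  let ?m = "(1/2) \<cdot> (v \<oplus> st v)" and ?l = "(-\<i>/2) \<cdot> (v \<ominus> st v)"
  have "?q = 2 \<cdot> (?m \<odot> ?m) \<oplus> 2 \<cdot> (?l \<odot> ?l) \<oplus> n \<odot> n"
  proof (rule eqI)
    fix \<phi> assume \<phi>: "\<phi> \<in> lf"
    have "ap \<phi> (n \<odot> n) = - ap \<phi> (st v \<odot> v)" unfolding vn using \<phi> n by (simp add: ap_simps)
    then show "ap \<phi> ?q = ap \<phi> (2 \<cdot> (?m \<odot> ?m) \<oplus> 2 \<cdot> (?l \<odot> ?l) \<oplus> n \<odot> n)"
      using \<phi> v n by (simp add: ap_simps dist_simps field_simps)
  qed (use v n in auto)
  moreover have "pos (complex_of_real 2 \<cdot> (?m \<odot> ?m) \<oplus> complex_of_real 2 \<cdot> (?l \<odot> ?l) \<oplus> n \<odot> n)"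
  proof (intro pos_ad pos_sm pos_square)
    show "st ?m = ?m" by (rule eqI) (use v in \<open>simp_all add: ap_simps dist_simps field_simps\<close>)
    show "st ?l = ?l" by (rule eqI) (use v in \<open>simp_all add: ap_simps dist_simps field_simps\<close>)
  qed (use v n in auto)
  ultimately have "pos ?q" by simp
  then obtain r where r: "r \<in> B" "st r = r" and q: "?q = r \<odot> r" by (auto simp: pos_def)
  let ?g = "st v \<odot> (e \<oplus> ?q)"
  have "?g = (e \<ominus> n \<odot> n) \<odot> st v"
  proof -
    have "?g = st v \<oplus> (st v \<odot> v) \<odot> st v" using v by (simp add: dist_simps)
    also have "\<dots> = (e \<ominus> n \<odot> n) \<odot> st v" unfolding vn using v n by (simp add: dist_simps)
    finally show ?thesis .
  qed
  then have "nm ?g \<le> nm (e \<ominus> n \<odot> n) * nm (st v)"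
    using nm_mu[of "e \<ominus> n \<odot> n" "st v"] v n by simp
  then have g: "nm ?g \<le> 1" using np v by (simp add: nm_st)
  let ?k = "r \<oplus> r \<odot> (r \<odot> r)"
  have "st ?g \<odot> ?g = (e \<oplus> ?q) \<odot> (?q \<odot> (e \<oplus> ?q))" using v by (simp add: dist_simps)
  also have "\<dots> = ?k \<odot> ?k"
    unfolding q by (rule eqI) (use r in \<open>simp_all add: ap_simps dist_simps\<close>)
  finally have gk: "st ?g \<odot> ?g = ?k \<odot> ?k" .
  have "nm (st ?g \<odot> ?g) = nm ?g ^ 2" using v by (intro nm_cstar) auto
  also have "\<dots> \<le> 1" using g v by (simp add: power_le_one)
  finally have "nm (?k \<odot> ?k) \<le> 1" using gk by simp
  then have "pos (sc 1 \<ominus> ?k \<odot> ?k)" using r by (intro pos_scalar_minus) (auto simp: st_mu st_ad mu_assoc)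
  \<comment> \<open>\<open>k^2 = r^2 + 2 r^4 + r^6\<close>, so adding the squares \<open>r^2\<close>
    and \<open>r^6\<close> to \<open>e - k^2\<close> leaves \<open>e - 2 r^4\<close>. The resulting
    bound \<open>2 nm (r^2)^2 <= 1\<close> contradicts \<open>nm (r^2) = 1\<close>.\<close>
  then have "pos (sc 1 \<ominus> ?k \<odot> ?k \<oplus> r \<odot> r \<oplus> (r \<odot> (r \<odot> r)) \<odot> (r \<odot> (r \<odot> r)))"
    using r by (intro pos_ad[OF pos_ad pos_square]) (auto simp: pos_square st_mu mu_assoc)
  moreover let ?s = "complex_of_real (sqrt 2) \<cdot> (r \<odot> r)"
  have "sc 1 \<ominus> ?k \<odot> ?k \<oplus> r \<odot> r \<oplus> (r \<odot> (r \<odot> r)) \<odot> (r \<odot> (r \<odot> r)) = sc 1 \<ominus> ?s \<odot> ?s"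
    by (rule eqI) (use r s2 in \<open>simp_all add: ap_simps dist_simps\<close>)
  ultimately have "pos (sc 1 \<ominus> ?s \<odot> ?s)" by simp
  then have "(nm ?s)\<^sup>2 \<le> 1" using r by (intro nm_le_if_pos) (auto simp: st_sm st_mu)
  moreover have "nm (r \<odot> r) = 1"
    using nm_cstar[of "st v"] v by (simp add: nm_st flip: q)
  ultimately show False using r by (simp add: nm_sm)
qed

lemma minus_square_imp_zero:
  assumes v: "v \<in> B" and n: "n \<in> B" "st n = n" and vn: "st v \<odot> v = (-1) \<cdot> (n \<odot> n)"
  shows "v = \<zero>"
proof (rule ccontr)
  assume "v \<noteq> \<zero>"
  then have a: "nm v > 0" using nm_eq_0[OF v] nm_nonneg[OF v] by linarith
  let ?c = "complex_of_real (1 / nm v)"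
  have "st (?c \<cdot> v) \<odot> (?c \<cdot> v) = ?c \<cdot> ?c \<cdot> (st v \<odot> v)" using v by (simp add: dist_simps)
  also have "\<dots> = (-1) \<cdot> ((?c \<cdot> n) \<odot> (?c \<cdot> n))"
    unfolding vn by (rule eqI) (use n in \<open>simp_all add: ap_simps dist_simps\<close>)
  finally show False
    using minus_square_aux[of "?c \<cdot> v" "?c \<cdot> n"] v n a by (simp add: nm_sm st_sm norm_divide)
qed

text \<open>The classical theorem on \<open>a* a\<close>. It depends on \<open>a\<close> lying in
  one algebra: \<open>minus_square_imp_zero\<close>, applied to \<open>v = a m\<close>, forms sums
  of \<open>v\<close> and \<open>v*\<close>.\<close>

lemma pos_star_mult: assumes a: "a \<in> B" shows "pos (st a \<odot> a)"
proof -
  have y: "st a \<odot> a \<in> B" "st (st a \<odot> a) = st a \<odot> a" using a by (simp_all add: st_mu)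
  obtain m n where m: "m \<in> B" "st m = m" and n: "n \<in> B" "st n = n"
    and mn: "m \<odot> (st a \<odot> a \<odot> m) = (-1) \<cdot> (n \<odot> n)" "n = \<zero> \<Longrightarrow> pos (st a \<odot> a)"
    using negative_part[OF y] by blast
  have eq: "st (a \<odot> m) \<odot> (a \<odot> m) = (-1) \<cdot> (n \<odot> n)" using mn(1) a m by (simp add: st_mu mu_assoc)
  then have "a \<odot> m = \<zero>" using minus_square_imp_zero[of "a \<odot> m" n] a m n by simp
  then have "(-1) \<cdot> (n \<odot> n) = \<zero>" using eq by simp
  then have "nm ((-1) \<cdot> (n \<odot> n)) = 0" by simp
  then have "n = \<zero>" using n by (simp add: nm_sm nm_sa nm_eq_0)
  then show ?thesis using mn(2) by blast
qed

text \<open>\<open>p y\<close> is the infimum of the \<open>t >= 0\<close> with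
  \<open>Re y <= t\<close> in the order of the algebra. Using it instead of the norm makes the
  Hahn-Banach functional positive, because \<open>p\<close> vanishes at negatives of positive
  elements. It also bounds the value at \<open>e\<close> by 1, and \<open>p h = nm h\<close> for
  positive \<open>h\<close>.\<close>

lemma state_exists:
  assumes h: "pos h"
  obtains \<phi> where "\<phi> \<in> lf" "\<And>y. pos y \<Longrightarrow> 0 \<le> Re (ap \<phi> y)" "\<And>y. pos y \<Longrightarrow> Im (ap \<phi> y) = 0"
    "\<And>y. y \<in> B \<Longrightarrow> ap \<phi> (st y) = cnj (ap \<phi> y)" "Re (ap \<phi> e) \<le> 1" "ap \<phi> h = complex_of_real (nm h)"
proof -
  define re where "re y = (1/2) \<cdot> (y \<oplus> st y)" for y
  have re_closed [simp]: "re y \<in> B" if "y \<in> B" for y using that by (simp add: re_def)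
  have re_sa: "st (re y) = re y" if "y \<in> B" for y
    using that by (simp add: re_def dist_simps ad_comm)
  define T where "T y = {t. 0 \<le> t \<and> pos (sc t \<ominus> re y)}" for y
  define p where "p y = Inf (T y)" for y
  have low: "bdd_below (T y)" for y by (rule bdd_belowI[of _ 0]) (simp add: T_def)
  have nonempty: "T y \<noteq> {}" if "y \<in> B" for y
  proof -
    have "nm (re y) \<in> T y" using that by (simp add: T_def pos_scalar_minus re_sa)
    then show ?thesis by blast
  qed
  have p_le: "p y \<le> t" if "t \<in> T y" for t y unfolding p_def by (rule cInf_lower[OF that low])
  have p_ge: "b \<le> p y" if "y \<in> B" "\<And>t. t \<in> T y \<Longrightarrow> b \<le> t" for b y
    unfolding p_def using cInf_greatest[OF nonempty[OF that(1)]] that(2) by blast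
  have p0: "0 \<le> p y" if "y \<in> B" for y by (rule p_ge[OF that]) (simp add: T_def)
  have "sublin p"
    unfolding sublin_def
  proof (intro conjI ballI allI impI)
    fix x y assume xy: "x \<in> B" "y \<in> B"
    have *: "p (x \<oplus> y) \<le> t + s" if "t \<in> T x" "s \<in> T y" for t s
    proof (rule p_le)
      have "sc (t + s) \<ominus> re (x \<oplus> y) = (sc t \<ominus> re x) \<oplus> (sc s \<ominus> re y)"
        unfolding re_def by (rule eqI) (use xy in \<open>simp_all add: ap_simps dist_simps algebra_simps\<close>)
      then show "t + s \<in> T (x \<oplus> y)" using that by (simp add: T_def pos_ad del: of_real_add)
    qed
    have "p (x \<oplus> y) - s \<le> p x" if "s \<in> T y" for s
      by (rule p_ge[OF xy(1)]) (use *[OF _ that] in \<open>simp add: algebra_simps\<close>)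
    then have "p (x \<oplus> y) - p x \<le> p y"
      by (intro p_ge[OF xy(2)]) (simp add: algebra_simps)
    then show "p (x \<oplus> y) \<le> p x + p y" by simp
  next
    fix c :: real and x assume c: "0 \<le> c" and x: "x \<in> B"
    have 1: "c * t \<in> T (complex_of_real c \<cdot> x)" if "0 \<le> c" "t \<in> T x" "x \<in> B" for c t x
    proof -
      have "sc (c * t) \<ominus> re (complex_of_real c \<cdot> x) = complex_of_real c \<cdot> (sc t \<ominus> re x)"
        unfolding re_def by (rule eqI) (use that in \<open>simp_all add: ap_simps dist_simps algebra_simps\<close>)
      then show ?thesis using that by (simp add: T_def pos_sm del: of_real_mult)
    qed
    have 2: "p (complex_of_real c \<cdot> x) \<le> c * p x" if "c > 0" "x \<in> B" for c x
    proof -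
      have "p (complex_of_real c \<cdot> x) / c \<le> p x"
      proof (rule p_ge[OF that(2)])
        fix t assume "t \<in> T x"
        then show "p (complex_of_real c \<cdot> x) / c \<le> t"
          using p_le[OF 1[of c t x]] that by (simp add: field_simps)
      qed
      then show ?thesis using that by (simp add: field_simps)
    qed
    show "p (complex_of_real c \<cdot> x) = c * p x"
    proof (cases "c = 0")
      case True
      have "0 \<in> T \<zero>" by (simp add: T_def re_def)
      then have "p \<zero> = 0" using p_le[of 0 \<zero>] p0[of \<zero>] by simp
      then show ?thesis using True x by simp
    next
      case False
      with c have c: "c > 0" by simp
      have "complex_of_real (1/c) \<cdot> complex_of_real c \<cdot> x = x"
        using x c by (simp flip: mult_sm)
      then have "p x \<le> (1/c) * p (complex_of_real c \<cdot> x)"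
        using 2[of "1/c" "complex_of_real c \<cdot> x"] x c by simp
      then show ?thesis using 2[OF c x] c by (simp add: field_simps)
    qed
  qed
  then obtain \<phi> where \<phi>: "\<phi> \<in> lf" and le: "\<And>x. x \<in> B \<Longrightarrow> Re (ap \<phi> x) \<le> p x" and eq: "Re (ap \<phi> h) = p h"
    using hahn_banach pos_closed[OF h] by blast
  have re_id: "re y = y" if "y \<in> B" "st y = y" for y
    unfolding re_def by (rule eqI) (use that in \<open>simp_all add: ap_simps\<close>)
  have neg: "Re (ap \<phi> y) \<le> 0" if "y \<in> B" "\<exists>x. pos x \<and> re y = (-1) \<cdot> x" for y
  proof -
    have "(-1) \<cdot> (-1) \<cdot> x = x" if "x \<in> B" for x using that by (simp flip: mult_sm)
    then have "0 \<in> T y" using that by (auto simp: T_def pos_closed)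
    then show ?thesis using p_le le[OF that(1)] by fastforce
  qed
  \<comment> \<open>A skew-adjoint \<open>y\<close> and its negative both have real part zero, so
    the functional has real part at most 0 at both. Applied to \<open>y - st y\<close>, this makes
    the functional hermitian.\<close>
  have im0: "Re (ap \<phi> y) = 0" if y: "y \<in> B" "st y = (-1) \<cdot> y" for y
  proof -
    have 1: "re y = \<zero>" "re ((-1) \<cdot> y) = \<zero>"
      using y by (simp_all add: re_def dist_simps flip: mult_sm sm_ad)
    have "\<exists>x. pos x \<and> \<zero> = (-1) \<cdot> x" by (rule exI[of _ \<zero>]) simp
    then show ?thesis using neg[of y] neg[of "(-1) \<cdot> y"] 1 y \<phi> by (simp add: ap_simps)
  qed
  have sym: "Re (ap \<phi> (st y)) = Re (ap \<phi> y)" if y: "y \<in> B" for y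
  proof -
    have "st (y \<ominus> st y) = (-1) \<cdot> (y \<ominus> st y)"
      by (rule eqI) (use y in \<open>simp_all add: ap_simps dist_simps\<close>)
    then show ?thesis using im0[of "y \<ominus> st y"] y \<phi> by (simp add: ap_simps)
  qed
  have cnj: "ap \<phi> (st y) = cnj (ap \<phi> y)" if y: "y \<in> B" for y
    using sym[OF y] sym[of "\<i> \<cdot> y"] y \<phi> by (simp add: complex_eq_iff ap_simps st_sm)
  show thesis
  proof (rule that[OF \<phi>])
    fix y assume y: "pos y"
    then have yB: "y \<in> B" "st y = y" by (simp_all add: pos_closed pos_sa)
    then show "Im (ap \<phi> y) = 0" using cnj[OF yB(1)] by (simp add: complex_eq_iff)
    have "re ((-1) \<cdot> y) = (-1) \<cdot> y" using yB by (intro re_id) (simp_all add: st_sm)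
    then show "0 \<le> Re (ap \<phi> y)" using neg[of "(-1) \<cdot> y"] y yB \<phi> by (auto simp: ap_simps)
  next
    have "1 \<in> T e" by (simp add: T_def re_id)
    then show "Re (ap \<phi> e) \<le> 1" using p_le[of 1 e] le[of e] by simp
  next
    obtain r where r: "r \<in> B" "st r = r" "h = r \<odot> r" using h by (auto simp: pos_def)
    have hB: "h \<in> B" "st h = h" using h by (simp_all add: pos_closed pos_sa)
    have "nm h \<le> p h"
    proof (rule p_ge[OF hB(1)])
      fix t assume "t \<in> T h"
      then have "0 \<le> t" "pos (sc t \<ominus> r \<odot> r)" using re_id[OF hB] r by (simp_all add: T_def)
      then show "nm h \<le> t" using nm_le_if_pos[OF r(1,2)] r by (simp add: nm_sa)
    qed
    moreover have "nm h \<in> T h" using hB by (simp add: T_def re_id pos_scalar_minus)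
    then have "p h \<le> nm h" by (rule p_le)
    moreover have "Im (ap \<phi> h) = 0" using cnj[OF hB(1)] hB by (simp add: complex_eq_iff)
    ultimately show "ap \<phi> h = complex_of_real (nm h)" using eq by (simp add: complex_eq_iff)
  qed (use cnj in auto)
qed

end


section \<open>Fibres of algebroids\<close>

locale staralg =
  fixes A :: "('a, 's, 'z) alg_scheme"
  assumes star: "star_algebroid A"
begin

lemma alg: "algebroid A"
  using star by (simp add: star_algebroid_def)

lemma fibreD: "a \<in> fibre A s t \<Longrightarrow> a \<in> Carr A \<and> dm A a = s \<and> cd A a = t"
  by (simp add: fibre_def)

lemma carr_fibre: "a \<in> Carr A \<Longrightarrow> a \<in> fibre A (dm A a) (cd A a)"
  by (simp add: fibre_def)

lemma ends_obj: assumes "a \<in> Carr A" shows dm_obj: "dm A a \<in> Obj A" and cd_obj: "cd A a \<in> Obj A"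
proof -
  have "\<forall>a\<in>Carr A. dm A a \<in> Obj A \<and> cd A a \<in> Obj A"
    using alg unfolding algebroid_def by (elim conjE)
  then show "dm A a \<in> Obj A" "cd A a \<in> Obj A" using assms by auto
qed

lemma fibre_obj: assumes "a \<in> fibre A s t" shows "s \<in> Obj A" "t \<in> Obj A"
  using fibreD[OF assms] ends_obj[of a] by auto

lemma mul_fibre: assumes "a \<in> fibre A u t" "b \<in> fibre A s u" shows "mul A a b \<in> fibre A s t"
proof -
  have "\<forall>a\<in>Carr A. \<forall>b\<in>Carr A. dm A a = cd A b \<longrightarrow>
        mul A a b \<in> Carr A \<and> dm A (mul A a b) = dm A b \<and> cd A (mul A a b) = cd A a"
    using alg unfolding algebroid_def by (elim conjE)
  then show ?thesis using assms by (auto simp: fibre_def)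
qed

lemma mul_assoc:
  assumes "a \<in> fibre A u t" "b \<in> fibre A v u" "c \<in> fibre A s v"
  shows "mul A (mul A a b) c = mul A a (mul A b c)"
proof -
  have "\<forall>a\<in>Carr A. \<forall>b\<in>Carr A. \<forall>c\<in>Carr A. dm A a = cd A b \<longrightarrow> dm A b = cd A c \<longrightarrow>
        mul A (mul A a b) c = mul A a (mul A b c)"
    using alg unfolding algebroid_def by (elim conjE)
  then show ?thesis using assms by (auto simp: fibre_def)
qed

lemma cvs_fibre: assumes "s \<in> Obj A" "t \<in> Obj A"
  shows "cvs (fibre A s t) (add A) (sml A) (zer A s t)"
proof -
  have "\<forall>s\<in>Obj A. \<forall>t\<in>Obj A. zer A s t \<in> fibre A s t \<and>
        (\<forall>a\<in>fibre A s t. \<forall>b\<in>fibre A s t. add A a b \<in> fibre A s t) \<and>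
        (\<forall>c. \<forall>a\<in>fibre A s t. sml A c a \<in> fibre A s t) \<and>
        (\<forall>a\<in>fibre A s t. \<forall>b\<in>fibre A s t. \<forall>c\<in>fibre A s t.
            add A (add A a b) c = add A a (add A b c)) \<and>
        (\<forall>a\<in>fibre A s t. \<forall>b\<in>fibre A s t. add A a b = add A b a) \<and>
        (\<forall>a\<in>fibre A s t. add A (zer A s t) a = a) \<and>
        (\<forall>a\<in>fibre A s t. \<exists>b\<in>fibre A s t. add A a b = zer A s t) \<and>
        (\<forall>c. \<forall>a\<in>fibre A s t. \<forall>b\<in>fibre A s t.
            sml A c (add A a b) = add A (sml A c a) (sml A c b)) \<and>
        (\<forall>c d. \<forall>a\<in>fibre A s t. sml A (c + d) a = add A (sml A c a) (sml A d a)) \<and>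
        (\<forall>c d. \<forall>a\<in>fibre A s t. sml A (c * d) a = sml A c (sml A d a)) \<and>
        (\<forall>a\<in>fibre A s t. sml A 1 a = a)"
    using alg unfolding algebroid_def by (elim conjE)
  from bspec[OF bspec[OF this assms(1)] assms(2)] show ?thesis by unfold_locales metis+
qed

lemma zer_fibre: "s \<in> Obj A \<Longrightarrow> t \<in> Obj A \<Longrightarrow> zer A s t \<in> fibre A s t"
  by (rule cvs.zero_closed[OF cvs_fibre])

lemma add_fibre: assumes "a \<in> fibre A s t" "b \<in> fibre A s t" shows "add A a b \<in> fibre A s t"
  using cvs.ad_closed[OF cvs_fibre[OF fibre_obj[OF assms(1)]]] assms by simp

lemma sml_fibre: assumes "a \<in> fibre A s t" shows "sml A c a \<in> fibre A s t"
  using cvs.sm_closed[OF cvs_fibre[OF fibre_obj[OF assms(1)]]] assms by simp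

lemma bilinear:
  assumes "a \<in> fibre A u t" "b \<in> fibre A s u"
  shows "a' \<in> fibre A u t \<Longrightarrow> mul A (add A a a') b = add A (mul A a b) (mul A a' b)"
    "b' \<in> fibre A s u \<Longrightarrow> mul A a (add A b b') = add A (mul A a b) (mul A a b')"
    "mul A (sml A c a) b = sml A c (mul A a b)" "mul A a (sml A c b) = sml A c (mul A a b)"
proof -
  have "s \<in> Obj A" "u \<in> Obj A" "t \<in> Obj A" using assms fibre_obj by auto
  moreover have "\<forall>s\<in>Obj A. \<forall>u\<in>Obj A. \<forall>t\<in>Obj A.
        \<forall>a\<in>fibre A u t. \<forall>a'\<in>fibre A u t. \<forall>b\<in>fibre A s u. \<forall>b'\<in>fibre A s u. \<forall>c.
          mul A (add A a a') b = add A (mul A a b) (mul A a' b) \<and>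
          mul A a (add A b b') = add A (mul A a b) (mul A a b') \<and>
          mul A (sml A c a) b = sml A c (mul A a b) \<and>
          mul A a (sml A c b) = sml A c (mul A a b)"
    using alg unfolding algebroid_def by (elim conjE)
  ultimately show "a' \<in> fibre A u t \<Longrightarrow> mul A (add A a a') b = add A (mul A a b) (mul A a' b)"
    "b' \<in> fibre A s u \<Longrightarrow> mul A a (add A b b') = add A (mul A a b) (mul A a b')"
    "mul A (sml A c a) b = sml A c (mul A a b)" "mul A a (sml A c b) = sml A c (mul A a b)"
    using assms by metis+
qed

lemma inv_facts: assumes "a \<in> fibre A s t"
  shows inv_fibre: "inv A a \<in> fibre A t s" and inv_inv: "inv A (inv A a) = a"
  using star assms unfolding star_algebroid_def fibre_def by auto

lemma inv_mul: "a \<in> fibre A u t \<Longrightarrow> b \<in> fibre A s u \<Longrightarrow> inv A (mul A a b) = mul A (inv A b) (inv A a)"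
  using star unfolding star_algebroid_def fibre_def by auto

lemma inv_linear:
  assumes "a \<in> fibre A s t"
  shows "b \<in> fibre A s t \<Longrightarrow> inv A (add A a b) = add A (inv A a) (inv A b)"
    "inv A (sml A c a) = sml A (cnj c) (inv A a)"
  using star assms fibre_obj[OF assms] unfolding star_algebroid_def by blast+

lemma sml_zer: "s \<in> Obj A \<Longrightarrow> t \<in> Obj A \<Longrightarrow> sml A c (zer A s t) = zer A s t"
  by (rule cvs.sm_zero[OF cvs_fibre])

lemma zero_sml: assumes "a \<in> fibre A s t" shows "sml A 0 a = zer A s t"
  using cvs.zero_sm[OF cvs_fibre[OF fibre_obj[OF assms]] assms] .

lemma add_zer_facts: assumes "a \<in> fibre A s t"
  shows add_zer: "add A a (zer A s t) = a" and zer_add: "add A (zer A s t) a = a"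
  by (rule cvs.ad_zero[OF cvs_fibre[OF fibre_obj[OF assms]] assms]
      cvs.zero_ad[OF cvs_fibre[OF fibre_obj[OF assms]] assms])+

lemma zer_mul: "b \<in> fibre A s u \<Longrightarrow> t \<in> Obj A \<Longrightarrow> mul A (zer A u t) b = zer A s t"
  using bilinear(3)[of "zer A u t" u t b s 0] zer_fibre[of u t] fibre_obj[of b s u]
    zero_sml[of "zer A u t" u t] zero_sml[of "mul A (zer A u t) b" s t] mul_fibre[of "zer A u t" u t b s] by simp

lemma mul_zer: "a \<in> fibre A u t \<Longrightarrow> s \<in> Obj A \<Longrightarrow> mul A a (zer A s u) = zer A s t"
  using bilinear(4)[of a u t "zer A s u" s 0] zer_fibre[of s u] fibre_obj[of a u t]
    zero_sml[of "zer A s u" s u] zero_sml[of "mul A a (zer A s u)" s t] mul_fibre[of a u t "zer A s u" s] by simp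

lemma inv_zer: "s \<in> Obj A \<Longrightarrow> t \<in> Obj A \<Longrightarrow> inv A (zer A s t) = zer A t s"
  using inv_linear(2)[of "zer A s t" s t 0] zer_fibre[of s t] zero_sml[of "zer A s t" s t]
    zero_sml[of "inv A (zer A s t)" t s] inv_fibre[of "zer A s t" s t] by simp

end

definition posel :: "('a, 's, 'z) alg_scheme \<Rightarrow> 's \<Rightarrow> 'a \<Rightarrow> bool" where
  "posel A s y \<longleftrightarrow> (\<exists>r\<in>fibre A s s. inv A r = r \<and> y = mul A r r)"

definition star_positive :: "('a, 's, 'z) alg_scheme \<Rightarrow> bool" where
  "star_positive A \<longleftrightarrow> (\<forall>s\<in>Obj A. \<forall>t\<in>Obj A. \<forall>x\<in>fibre A s t. posel A s (mul A (inv A x) x))"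

definition unit_at :: "('a, 's, 'z) alg_scheme \<Rightarrow> 's \<Rightarrow> 'a \<Rightarrow> bool" where
  "unit_at A s e \<longleftrightarrow> e \<in> fibre A s s \<and>
     (\<forall>a\<in>Carr A. (cd A a = s \<longrightarrow> mul A e a = a) \<and> (dm A a = s \<longrightarrow> mul A a e = a))"

lemma unital_unit_at: "unital A \<Longrightarrow> \<exists>\<epsilon>. \<forall>s\<in>Obj A. unit_at A s (\<epsilon> s)"
  unfolding unital_def unit_at_def by blast

locale cstaralg =
  fixes A :: "('a, 's, 'z) alg_scheme"
  assumes cstar: "cstar_algebroid A"
begin

sublocale staralg A
  using cstar by unfold_locales (simp add: cstar_algebroid_def)

lemma nrm_facts:
  assumes "a \<in> fibre A s t"
  shows nrm_nonneg: "0 \<le> nrm A a" and nrm_eq_0: "nrm A a = 0 \<longleftrightarrow> a = zer A s t"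
    and nrm_add: "b \<in> fibre A s t \<Longrightarrow> nrm A (add A a b) \<le> nrm A a + nrm A b"
    and nrm_sml: "nrm A (sml A c a) = cmod c * nrm A a"
    and nrm_inv: "nrm A (inv A a) = nrm A a"
    and nrm_cstar: "nrm A (mul A (inv A a) a) = (nrm A a)\<^sup>2"
  using assms fibre_obj[OF assms] fibreD[OF assms] cstar unfolding cstar_algebroid_def by blast+

lemma nrm_mul: "a \<in> fibre A u t \<Longrightarrow> b \<in> fibre A s u \<Longrightarrow> nrm A (mul A a b) \<le> nrm A a * nrm A b"
  using cstar unfolding cstar_algebroid_def fibre_def by auto

lemma nrm_complete:
  assumes "s \<in> Obj A" "t \<in> Obj A" "\<And>n. X n \<in> fibre A s t"
    "\<And>e. e > 0 \<Longrightarrow> \<exists>N. \<forall>m\<ge>N. \<forall>n\<ge>N. nrm A (asub A (X m) (X n)) < e"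
  shows "\<exists>L\<in>fibre A s t. (\<lambda>n. nrm A (asub A (X n) L)) \<longlonglongrightarrow> 0"
  using assms cstar unfolding cstar_algebroid_def by blast

lemma ucalg_fibre:
  assumes e: "unit_at A s e"
  shows "ucalg (fibre A s s) (add A) (sml A) (zer A s s) (mul A) (inv A) (nrm A) e"
proof -
  have s: "e \<in> fibre A s s" "s \<in> Obj A" using e fibre_obj by (auto simp: unit_at_def)
  interpret cvs "fibre A s s" "add A" "sml A" "zer A s s" using cvs_fibre s by blast
  show ?thesis
  proof unfold_locales
    fix X :: "nat \<Rightarrow> 'a" assume "\<And>n. X n \<in> fibre A s s"
      "\<And>\<epsilon>. 0 < \<epsilon> \<Longrightarrow> \<exists>N. \<forall>m\<ge>N. \<forall>n\<ge>N. nrm A (add A (X m) (sml A (-1) (X n))) < \<epsilon>"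
    then show "\<exists>L\<in>fibre A s s. (\<lambda>n. nrm A (add A (X n) (sml A (-1) L))) \<longlonglongrightarrow> 0"
      using nrm_complete[OF s(2) s(2), of X] by (simp add: asub_def)
  qed (use s e in \<open>auto simp: mul_fibre mul_assoc bilinear inv_fibre inv_inv inv_mul inv_linear unit_at_def
      nrm_nonneg nrm_eq_0 nrm_add nrm_sml nrm_inv nrm_cstar nrm_mul dest: fibreD\<close>)
qed

lemma posel_eq_pos: assumes "unit_at A s e"
  shows "posel A s = ucalg.pos (fibre A s s) (mul A) (inv A)"
  by (rule ext) (simp add: posel_def ucalg.pos_def[OF ucalg_fibre[OF assms]])

text \<open>From left to right, \<open>a* a\<close> is positive inside the single algebra
  \<open>A s s\<close>. From right to left, the self-adjoint root serves as
  \<open>a\<close>.\<close>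

lemma star_positive_iff:
  assumes "unital A"
  shows "(\<forall>s\<in>Obj A. \<forall>t\<in>Obj A. \<forall>x\<in>fibre A s t. \<exists>a\<in>fibre A s s.
              mul A (inv A x) x = mul A (inv A a) a) \<longleftrightarrow> star_positive A" (is "?L = ?R")
proof
  assume L: ?L
  show ?R unfolding star_positive_def
  proof (intro ballI)
    fix s t x assume s: "s \<in> Obj A" and t: "t \<in> Obj A" and x: "x \<in> fibre A s t"
    then obtain a where a: "a \<in> fibre A s s" "mul A (inv A x) x = mul A (inv A a) a" using L by blast
    obtain e where e: "unit_at A s e" using unital_unit_at[OF assms] s by blast
    show "posel A s (mul A (inv A x) x)"
      using ucalg.pos_star_mult[OF ucalg_fibre[OF e] a(1)] a(2) posel_eq_pos[OF e] by simp
  qed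
next
  assume R: ?R
  show ?L
  proof (intro ballI)
    fix s t x assume "s \<in> Obj A" "t \<in> Obj A" "x \<in> fibre A s t"
    then have "posel A s (mul A (inv A x) x)" using R by (auto simp: star_positive_def)
    then show "\<exists>a\<in>fibre A s s. mul A (inv A x) x = mul A (inv A a) a" unfolding posel_def by metis
  qed
qed

lemma star_positiveI:
  assumes un: "unital A"
    and *: "\<And>s t v n. v \<in> fibre A s t \<Longrightarrow> n \<in> fibre A s s \<Longrightarrow> inv A n = n \<Longrightarrow>
      mul A (inv A v) v = sml A (-1) (mul A n n) \<Longrightarrow> n = zer A s s"
  shows "star_positive A"
  unfolding star_positive_def
proof (intro ballI)
  fix s t x assume s: "s \<in> Obj A" and t: "t \<in> Obj A" and x: "x \<in> fibre A s t"
  obtain e where e: "unit_at A s e" using unital_unit_at[OF un] s by blast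
  have y: "mul A (inv A x) x \<in> fibre A s s" "inv A (mul A (inv A x) x) = mul A (inv A x) x"
    using x by (simp_all add: mul_fibre[of _ t] inv_fibre inv_mul[of _ t s] inv_inv[of _ s t])
  obtain m n where m: "m \<in> fibre A s s" "inv A m = m" and n: "n \<in> fibre A s s" "inv A n = n"
    and mn: "mul A m (mul A (mul A (inv A x) x) m) = sml A (-1) (mul A n n)"
    and p: "n = zer A s s \<Longrightarrow> posel A s (mul A (inv A x) x)"
    using ucalg.negative_part[OF ucalg_fibre[OF e] y] unfolding posel_eq_pos[OF e] by metis
  have xm: "mul A x m \<in> fibre A s t" using x m by (simp add: mul_fibre)
  have "mul A (inv A (mul A x m)) (mul A x m) = mul A (mul A m (inv A x)) (mul A x m)"
    using x m by (simp add: inv_mul[of x s t m s])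
  also have "\<dots> = mul A m (mul A (inv A x) (mul A x m))"
    using x m by (intro mul_assoc[of _ s _ _ t _ s] inv_fibre mul_fibre[of _ s])
  also have "mul A (inv A x) (mul A x m) = mul A (mul A (inv A x) x) m"
    using x m by (simp add: mul_assoc[of "inv A x" t s x s m s] inv_fibre)
  also note mn
  finally show "posel A s (mul A (inv A x) x)" using *[OF xm n] p by blast
qed

section \<open>Positivity from a Hilbert space representation\<close>

lemma hilbert_spaceD:
  assumes "hilbert_space H" "x \<in> hcarr H" "y \<in> hcarr H"
  shows "hinner H x y = cnj (hinner H y x)" "hinner H (hsml H c x) y = c * hinner H x y"
    "0 \<le> Re (hinner H x x)" "hinner H x x = 0 \<Longrightarrow> x = hzero H"
proof -
  have "\<forall>x\<in>hcarr H. \<forall>y\<in>hcarr H. hinner H x y = cnj (hinner H y x)"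
    using assms(1) unfolding hilbert_space_def by (elim conjE)
  then show "hinner H x y = cnj (hinner H y x)" using assms by blast
  have "\<forall>c. \<forall>x\<in>hcarr H. \<forall>y\<in>hcarr H. hinner H (hsml H c x) y = c * hinner H x y"
    using assms(1) unfolding hilbert_space_def by (elim conjE)
  then show "hinner H (hsml H c x) y = c * hinner H x y" using assms by blast
  have "\<forall>x\<in>hcarr H. 0 \<le> Re (hinner H x x)"
    using assms(1) unfolding hilbert_space_def by (elim conjE)
  then show "0 \<le> Re (hinner H x x)" using assms by blast
  have "\<forall>x\<in>hcarr H. hinner H x x = 0 \<longrightarrow> x = hzero H"
    using assms(1) unfolding hilbert_space_def by (elim conjE)
  then show "hinner H x x = 0 \<Longrightarrow> x = hzero H" using assms by blast
qed

lemma inj_star_repD: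
  assumes "inj_star_rep A H \<Phi>"
  shows "s \<in> Obj A \<Longrightarrow> hilbert_space (H s)"
    "a \<in> fibre A s t \<Longrightarrow> h \<in> hcarr (H s) \<Longrightarrow> \<Phi> a h \<in> hcarr (H t)"
    "a \<in> fibre A s t \<Longrightarrow> h \<in> hcarr (H s) \<Longrightarrow> \<Phi> (sml A c a) h = hsml (H t) c (\<Phi> a h)"
    "a \<in> fibre A u t \<Longrightarrow> b \<in> fibre A s u \<Longrightarrow> h \<in> hcarr (H s) \<Longrightarrow> \<Phi> (mul A a b) h = \<Phi> a (\<Phi> b h)"
    "a \<in> fibre A s t \<Longrightarrow> h \<in> hcarr (H s) \<Longrightarrow> k \<in> hcarr (H t) \<Longrightarrow>
      hinner (H s) (\<Phi> (inv A a) k) h = hinner (H t) k (\<Phi> a h)"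
    "a \<in> fibre A s t \<Longrightarrow> b \<in> fibre A s t \<Longrightarrow> (\<And>h. h \<in> hcarr (H s) \<Longrightarrow> \<Phi> a h = \<Phi> b h) \<Longrightarrow> a = b"
proof -
  have "\<forall>s\<in>Obj A. hilbert_space (H s)"
    using assms unfolding inj_star_rep_def by (elim conjE)
  then show "s \<in> Obj A \<Longrightarrow> hilbert_space (H s)" by blast
  have "\<forall>a\<in>Carr A. bounded_op (H (dm A a)) (H (cd A a)) (\<Phi> a)"
    using assms unfolding inj_star_rep_def by (elim conjE)
  then show "a \<in> fibre A s t \<Longrightarrow> h \<in> hcarr (H s) \<Longrightarrow> \<Phi> a h \<in> hcarr (H t)"
    by (auto simp: bounded_op_def fibre_def)
  have "\<forall>s\<in>Obj A. \<forall>t\<in>Obj A. \<forall>a\<in>fibre A s t. \<forall>b\<in>fibre A s t. \<forall>c. \<forall>x\<in>hcarr (H s).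
        \<Phi> (add A a b) x = hadd (H t) (\<Phi> a x) (\<Phi> b x) \<and>
        \<Phi> (sml A c a) x = hsml (H t) c (\<Phi> a x)"
    using assms unfolding inj_star_rep_def by (elim conjE)
  then show "a \<in> fibre A s t \<Longrightarrow> h \<in> hcarr (H s) \<Longrightarrow> \<Phi> (sml A c a) h = hsml (H t) c (\<Phi> a h)"
    using fibre_obj by metis
  have "\<forall>a\<in>Carr A. \<forall>b\<in>Carr A. dm A a = cd A b \<longrightarrow>
        (\<forall>x\<in>hcarr (H (dm A b)). \<Phi> (mul A a b) x = \<Phi> a (\<Phi> b x))"
    using assms unfolding inj_star_rep_def by (elim conjE)
  then show "a \<in> fibre A u t \<Longrightarrow> b \<in> fibre A s u \<Longrightarrow> h \<in> hcarr (H s) \<Longrightarrow> \<Phi> (mul A a b) h = \<Phi> a (\<Phi> b h)"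
    by (auto simp: fibre_def)
  have "\<forall>a\<in>Carr A. \<forall>x\<in>hcarr (H (cd A a)). \<forall>y\<in>hcarr (H (dm A a)).
        hinner (H (dm A a)) (\<Phi> (inv A a) x) y = hinner (H (cd A a)) x (\<Phi> a y)"
    using assms unfolding inj_star_rep_def by (elim conjE)
  then show "a \<in> fibre A s t \<Longrightarrow> h \<in> hcarr (H s) \<Longrightarrow> k \<in> hcarr (H t) \<Longrightarrow>
      hinner (H s) (\<Phi> (inv A a) k) h = hinner (H t) k (\<Phi> a h)"
    by (auto simp: fibre_def)
  have "\<forall>a\<in>Carr A. \<forall>b\<in>Carr A. dm A a = dm A b \<longrightarrow> cd A a = cd A b \<longrightarrow>
        (\<forall>x\<in>hcarr (H (dm A a)). \<Phi> a x = \<Phi> b x) \<longrightarrow> a = b"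
    using assms unfolding inj_star_rep_def by (elim conjE)
  then show "a \<in> fibre A s t \<Longrightarrow> b \<in> fibre A s t \<Longrightarrow> (\<And>h. h \<in> hcarr (H s) \<Longrightarrow> \<Phi> a h = \<Phi> b h) \<Longrightarrow> a = b"
    by (auto simp: fibre_def)
qed

text \<open>The equation \<open>v* v = -n^2\<close> gives
  \<open>||\<Phi> v h||^2 = - ||\<Phi> n h||^2\<close> for every \<open>h\<close>. Hence
  \<open>\<Phi> n\<close> vanishes, and injectivity identifies \<open>n\<close> with the zero of the
  fibre.\<close>

lemma star_positive_if_rep:
  assumes un: "unital A" and rep: "inj_star_rep A H \<Phi>"
  shows "star_positive A"
proof (rule star_positiveI[OF un])
  fix s t v n
  assume v: "v \<in> fibre A s t" and n: "n \<in> fibre A s s" "inv A n = n"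
    and vn: "mul A (inv A v) v = sml A (-1) (mul A n n)"
  have s: "s \<in> Obj A" "t \<in> Obj A" using v fibre_obj by auto
  note repD = inj_star_repD[OF rep]
  have hs: "hilbert_space (H s)" and ht: "hilbert_space (H t)"
    using repD(1) s by auto
  have adj: "hinner (H r) (\<Phi> a h) (\<Phi> a h) = hinner (H s) (\<Phi> (mul A (inv A a) a) h) h"
    if a: "a \<in> fibre A s r" and h: "h \<in> hcarr (H s)" for a r h
    using repD(5)[OF a h repD(2)[OF a h]] repD(4)[OF inv_fibre[OF a] a h] by simp
  have z: "zer A s s \<in> fibre A s s" using s by (simp add: zer_fibre)
  have nn: "mul A n n \<in> fibre A s s" using n mul_fibre by blast
  have "\<Phi> n h = \<Phi> (zer A s s) h" if h: "h \<in> hcarr (H s)" for h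
  proof -
    have in_s: "\<Phi> a h \<in> hcarr (H r)" if "a \<in> fibre A s r" for a r
      using repD(2)[OF that h] .
    have lin: "hinner (H s) (\<Phi> (sml A c a) h) k = c * hinner (H s) (\<Phi> a h) k"
      if "a \<in> fibre A s s" "k \<in> hcarr (H s)" for c a k
      using repD(3)[OF that(1) h] hilbert_spaceD(2)[OF hs in_s[OF that(1)] that(2)] by simp
    have "hinner (H t) (\<Phi> v h) (\<Phi> v h) = - hinner (H s) (\<Phi> n h) (\<Phi> n h)"
      using adj[OF v h] adj[OF n(1) h] lin[OF nn h] vn n(2) by simp
    moreover have "0 \<le> Re (hinner (H t) (\<Phi> v h) (\<Phi> v h))" "0 \<le> Re (hinner (H s) (\<Phi> n h) (\<Phi> n h))"
      using hilbert_spaceD(3)[OF ht in_s[OF v] in_s[OF v]]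
        hilbert_spaceD(3)[OF hs in_s[OF n(1)] in_s[OF n(1)]] by auto
    ultimately have "Re (hinner (H s) (\<Phi> n h) (\<Phi> n h)) = 0" by simp
    moreover have "Im (hinner (H s) (\<Phi> n h) (\<Phi> n h)) = 0"
      using arg_cong[OF hilbert_spaceD(1)[OF hs in_s[OF n(1)] in_s[OF n(1)]], of Im] by simp
    ultimately have "hinner (H s) (\<Phi> n h) (\<Phi> n h) = 0" by (simp add: complex_eq_iff)
    then have 1: "\<Phi> n h = hzero (H s)" using hilbert_spaceD(4)[OF hs in_s[OF n(1)] in_s[OF n(1)]] by simp
    \<comment> \<open>The zero element is its own multiple by 0, so the scaling law shows that it
      acts as zero.\<close>
    have "hinner (H s) (\<Phi> (sml A 0 (zer A s s)) h) (\<Phi> (zer A s s) h) = 0"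
      using lin[OF z in_s[OF z], of 0] by simp
    then have "hinner (H s) (\<Phi> (zer A s s) h) (\<Phi> (zer A s s) h) = 0" using s by (simp add: sml_zer)
    then have "\<Phi> (zer A s s) h = hzero (H s)" using hilbert_spaceD(4)[OF hs in_s[OF z] in_s[OF z]] by simp
    with 1 show ?thesis by simp
  qed
  then show "n = zer A s s" using repD(6)[OF n(1) z] by blast
qed

end


section \<open>Amplifications\<close>

text \<open>The definitions quantify over carrier elements with matching ends. Here each law is
  asked for typed elements of fibres, the form in which matrices are accessible through their
  entries.\<close>

lemma star_algebroidI:
  assumes ne: "Carr A \<noteq> {}" "Obj A \<noteq> {}"
    and obj: "\<And>a s t. a \<in> fibre A s t \<Longrightarrow> s \<in> Obj A \<and> t \<in> Obj A"
    and mul: "\<And>a b s u t. a \<in> fibre A u t \<Longrightarrow> b \<in> fibre A s u \<Longrightarrow> mul A a b \<in> fibre A s t"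
    and assoc: "\<And>a b c s v u t. a \<in> fibre A u t \<Longrightarrow> b \<in> fibre A v u \<Longrightarrow> c \<in> fibre A s v \<Longrightarrow>
      mul A (mul A a b) c = mul A a (mul A b c)"
    and cvs: "\<And>s t. s \<in> Obj A \<Longrightarrow> t \<in> Obj A \<Longrightarrow> cvs (fibre A s t) (add A) (sml A) (zer A s t)"
    and bil: "\<And>a a' b s u t. a \<in> fibre A u t \<Longrightarrow> a' \<in> fibre A u t \<Longrightarrow> b \<in> fibre A s u \<Longrightarrow>
      mul A (add A a a') b = add A (mul A a b) (mul A a' b)"
      "\<And>a b b' s u t. a \<in> fibre A u t \<Longrightarrow> b \<in> fibre A s u \<Longrightarrow> b' \<in> fibre A s u \<Longrightarrow>
      mul A a (add A b b') = add A (mul A a b) (mul A a b')"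
      "\<And>a b c s u t. a \<in> fibre A u t \<Longrightarrow> b \<in> fibre A s u \<Longrightarrow> mul A (sml A c a) b = sml A c (mul A a b)"
      "\<And>a b c s u t. a \<in> fibre A u t \<Longrightarrow> b \<in> fibre A s u \<Longrightarrow> mul A a (sml A c b) = sml A c (mul A a b)"
    and inv: "\<And>a s t. a \<in> fibre A s t \<Longrightarrow> inv A a \<in> fibre A t s"
      "\<And>a s t. a \<in> fibre A s t \<Longrightarrow> inv A (inv A a) = a"
      "\<And>a b s u t. a \<in> fibre A u t \<Longrightarrow> b \<in> fibre A s u \<Longrightarrow> inv A (mul A a b) = mul A (inv A b) (inv A a)"
      "\<And>a b s t. a \<in> fibre A s t \<Longrightarrow> b \<in> fibre A s t \<Longrightarrow> inv A (add A a b) = add A (inv A a) (inv A b)"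
      "\<And>a c s t. a \<in> fibre A s t \<Longrightarrow> inv A (sml A c a) = sml A (cnj c) (inv A a)"
  shows "star_algebroid A"
proof -
  have f: "a \<in> Carr A \<Longrightarrow> a \<in> fibre A (dm A a) (cd A a)" for a by (simp add: fibre_def)
  have 1: "dm A a \<in> Obj A \<and> cd A a \<in> Obj A" if "a \<in> Carr A" for a using obj f that by blast
  have 2: "mul A a b \<in> Carr A \<and> dm A (mul A a b) = dm A b \<and> cd A (mul A a b) = cd A a"
    if "a \<in> Carr A" "b \<in> Carr A" "dm A a = cd A b" for a b
    using mul[of a "dm A a" "cd A a" b "dm A b"] that by (simp add: fibre_def)
  have 3: "mul A (mul A a b) c = mul A a (mul A b c)"
    if "a \<in> Carr A" "b \<in> Carr A" "c \<in> Carr A" "dm A a = cd A b" "dm A b = cd A c" for a b c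
    using assoc[of a "dm A a" "cd A a" b "dm A b" c "dm A c"] that by (simp add: fibre_def)
  have 4: "inv A a \<in> Carr A \<and> dm A (inv A a) = cd A a \<and> cd A (inv A a) = dm A a \<and> inv A (inv A a) = a"
    if "a \<in> Carr A" for a
    using inv(1,2)[OF f[OF that]] by (simp add: fibre_def)
  have 5: "inv A (mul A a b) = mul A (inv A b) (inv A a)"
    if "a \<in> Carr A" "b \<in> Carr A" "dm A a = cd A b" for a b
    using inv(3)[of a "dm A a" "cd A a" b "dm A b"] that by (simp add: fibre_def)
  have "algebroid A"
    unfolding algebroid_def
    apply (intro conjI)
    subgoal by (fact ne(1))
    subgoal by (fact ne(2))
    subgoal using 1 by blast
    subgoal using 2 by blast
    subgoal using 3 by blast
    subgoal
    proof (intro ballI)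
      fix s t assume "s \<in> Obj A" "t \<in> Obj A"
      then interpret cvs "fibre A s t" "add A" "sml A" "zer A s t" by (rule cvs)
      show "zer A s t \<in> fibre A s t \<and>
        (\<forall>a\<in>fibre A s t. \<forall>b\<in>fibre A s t. add A a b \<in> fibre A s t) \<and>
        (\<forall>c. \<forall>a\<in>fibre A s t. sml A c a \<in> fibre A s t) \<and>
        (\<forall>a\<in>fibre A s t. \<forall>b\<in>fibre A s t. \<forall>c\<in>fibre A s t.
            add A (add A a b) c = add A a (add A b c)) \<and>
        (\<forall>a\<in>fibre A s t. \<forall>b\<in>fibre A s t. add A a b = add A b a) \<and>
        (\<forall>a\<in>fibre A s t. add A (zer A s t) a = a) \<and>
        (\<forall>a\<in>fibre A s t. \<exists>b\<in>fibre A s t. add A a b = zer A s t) \<and>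
        (\<forall>c. \<forall>a\<in>fibre A s t. \<forall>b\<in>fibre A s t.
            sml A c (add A a b) = add A (sml A c a) (sml A c b)) \<and>
        (\<forall>c d. \<forall>a\<in>fibre A s t. sml A (c + d) a = add A (sml A c a) (sml A d a)) \<and>
        (\<forall>c d. \<forall>a\<in>fibre A s t. sml A (c * d) a = sml A c (sml A d a)) \<and>
        (\<forall>a\<in>fibre A s t. sml A 1 a = a)"
        using ad_assoc ad_comm neg_ex sm_ad add_sm mult_sm by (intro conjI ballI allI) simp_all
    qed
    subgoal using bil by (intro ballI allI conjI) (assumption | rule bil)+
    done
  then show ?thesis
    unfolding star_algebroid_def using 4 5 inv(4,5) by (intro conjI ballI allI impI) blast+
qed

context staralg
begin

section \<open>Finite sums in a fibre\<close>

lemma fsum_fibre: "s \<in> Obj A \<Longrightarrow> t \<in> Obj A \<Longrightarrow> (\<And>k. k < n \<Longrightarrow> f k \<in> fibre A s t) \<Longrightarrow>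
    fsum A s t f n \<in> fibre A s t"
  by (induction n) (auto simp: zer_fibre intro: add_fibre)

lemma fsum_cong: "(\<And>k. k < n \<Longrightarrow> f k = g k) \<Longrightarrow> fsum A s t f n = fsum A s t g n"
  by (induction n) auto

lemma add_interchange:
  assumes "a \<in> fibre A s t" "b \<in> fibre A s t" "c \<in> fibre A s t" "d \<in> fibre A s t"
  shows "add A (add A a b) (add A c d) = add A (add A a c) (add A b d)"
proof -
  interpret cvs "fibre A s t" "add A" "sml A" "zer A s t" using cvs_fibre fibre_obj[OF assms(1)] by blast
  show ?thesis using assms by (simp add: ad_ac)
qed

lemma fsum_add:
  assumes "s \<in> Obj A" "t \<in> Obj A" "\<And>k. k < n \<Longrightarrow> f k \<in> fibre A s t" "\<And>k. k < n \<Longrightarrow> g k \<in> fibre A s t"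
  shows "fsum A s t (\<lambda>k. add A (f k) (g k)) n = add A (fsum A s t f n) (fsum A s t g n)"
  using assms(3,4)
proof (induction n)
  case 0 then show ?case using assms(1,2) by (simp add: zer_fibre add_zer)
next
  case (Suc n)
  then show ?case
    using add_interchange[of "fsum A s t f n" s t "fsum A s t g n" "f n" "g n"] assms(1,2)
    by (simp add: fsum_fibre)
qed

lemma fsum_sml:
  assumes "s \<in> Obj A" "t \<in> Obj A" "\<And>k. k < n \<Longrightarrow> f k \<in> fibre A s t"
  shows "fsum A s t (\<lambda>k. sml A c (f k)) n = sml A c (fsum A s t f n)"
  using assms(3)
proof (induction n)
  case 0 then show ?case using assms(1,2) by (simp add: sml_zer)
next
  case (Suc n)
  interpret cvs "fibre A s t" "add A" "sml A" "zer A s t" using cvs_fibre assms by blast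
  show ?case using Suc assms(1,2) by (simp add: fsum_fibre sm_ad)
qed

lemma mul_fsum:
  assumes "a \<in> fibre A u t" "s \<in> Obj A" "\<And>k. k < n \<Longrightarrow> f k \<in> fibre A s u"
  shows "mul A a (fsum A s u f n) = fsum A s t (\<lambda>k. mul A a (f k)) n"
  using assms(3)
proof (induction n)
  case 0 then show ?case using assms(1,2) by (simp add: mul_zer)
next
  case (Suc n)
  then show ?case
    using bilinear(2)[OF assms(1), of "fsum A s u f n" s "f n"] assms(1,2) fibre_obj[OF assms(1)]
    by (simp add: fsum_fibre)
qed

lemma fsum_mul:
  assumes "b \<in> fibre A s u" "t \<in> Obj A" "\<And>k. k < n \<Longrightarrow> f k \<in> fibre A u t"
  shows "mul A (fsum A u t f n) b = fsum A s t (\<lambda>k. mul A (f k) b) n"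
  using assms(3)
proof (induction n)
  case 0 then show ?case using assms(1,2) by (simp add: zer_mul)
next
  case (Suc n)
  then show ?case
    using bilinear(1)[of "fsum A u t f n" u t b s "f n"] assms(1,2) fibre_obj[OF assms(1)]
    by (simp add: fsum_fibre)
qed

lemma inv_fsum:
  assumes "s \<in> Obj A" "t \<in> Obj A" "\<And>k. k < n \<Longrightarrow> f k \<in> fibre A s t"
  shows "inv A (fsum A s t f n) = fsum A t s (\<lambda>k. inv A (f k)) n"
  using assms(3)
proof (induction n)
  case 0 then show ?case using assms(1,2) by (simp add: inv_zer)
next
  case (Suc n)
  then show ?case
    using inv_linear(1)[of "fsum A s t f n" s t "f n"] assms(1,2) by (simp add: fsum_fibre)
qed

lemma fsum_zer: "s \<in> Obj A \<Longrightarrow> t \<in> Obj A \<Longrightarrow> fsum A s t (\<lambda>k. zer A s t) n = zer A s t"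
  by (induction n) (simp_all add: zer_fibre add_zer)

lemma fsum_swap:
  assumes "s \<in> Obj A" "t \<in> Obj A" "\<And>k l. k < n \<Longrightarrow> l < m \<Longrightarrow> f k l \<in> fibre A s t"
  shows "fsum A s t (\<lambda>k. fsum A s t (f k) m) n = fsum A s t (\<lambda>l. fsum A s t (\<lambda>k. f k l) n) m"
  using assms(3)
proof (induction n)
  case 0 then show ?case using assms(1,2) by (simp add: fsum_zer)
next
  case (Suc n)
  then show ?case using assms(1,2) by (simp add: fsum_add fsum_fibre)
qed

lemma fsum_single:
  assumes "s \<in> Obj A" "t \<in> Obj A" "l < n" "f l \<in> fibre A s t" "\<And>k. k < n \<Longrightarrow> k \<noteq> l \<Longrightarrow> f k = zer A s t"
  shows "fsum A s t f n = f l"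
  using assms(3,5)
proof (induction n)
  case (Suc n)
  show ?case
  proof (cases "l = n")
    case True
    have "fsum A s t f n = fsum A s t (\<lambda>k. zer A s t) n" using Suc True by (intro fsum_cong) auto
    then show ?thesis using True assms by (simp add: fsum_zer zer_add)
  next
    case False
    then show ?thesis using Suc assms by (simp add: add_zer)
  qed
qed simp

text \<open>The ends of a matrix are read off row 0 and column 0, and the carrier condition makes
  all other rows and columns agree with them. Later arguments about matrices use only this entrywise
  description.\<close>

lemma fibre_amp:
  assumes "n > 0"
  shows "M \<in> fibre (amp n A N) \<sigma> \<tau> \<longleftrightarrow> \<sigma> \<in> Obj (amp n A N) \<and> \<tau> \<in> Obj (amp n A N) \<and>
    (\<forall>i<n. \<forall>j<n. M i j \<in> fibre A (\<sigma> j) (\<tau> i)) \<and> (\<forall>i j. \<not> (i < n \<and> j < n) \<longrightarrow> M i j = undefined)"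
    (is "?L \<longleftrightarrow> ?R")
proof
  assume L: ?L
  then obtain s t where st: "\<forall>i<n. s i \<in> Obj A \<and> t i \<in> Obj A"
    "\<forall>i<n. \<forall>j<n. M i j \<in> fibre A (s j) (t i)" "\<forall>i j. \<not> (i < n \<and> j < n) \<longrightarrow> M i j = undefined"
    by (auto simp: fibre_def amp_def)
  have "\<sigma> j = (if j < n then s j else undefined)" for j
    using L st(2) assms by (auto simp: fibre_def amp_def)
  moreover have "\<tau> i = (if i < n then t i else undefined)" for i
    using L st(2) assms by (auto simp: fibre_def amp_def)
  ultimately show ?R using st by (auto simp: amp_def)
next
  assume R: ?R
  then have "M \<in> Carr (amp n A N)"
    unfolding amp_def alg.select_convs mem_Collect_eq
    by (intro exI[of _ \<sigma>] exI[of _ \<tau>]) auto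
  moreover have "dm (amp n A N) M = \<sigma>" "cd (amp n A N) M = \<tau>"
    using R assms by (auto simp: amp_def fibre_def fun_eq_iff not_less)
  ultimately show ?L by (simp add: fibre_def)
qed

lemma obj_amp: "\<sigma> \<in> Obj (amp n A N) \<longleftrightarrow> (\<forall>i<n. \<sigma> i \<in> Obj A) \<and> (\<forall>i\<ge>n. \<sigma> i = undefined)"
  by (simp add: amp_def)

context
  fixes n :: nat and N :: "(nat \<Rightarrow> nat \<Rightarrow> 'a) \<Rightarrow> real"
  assumes n: "n > 0"
begin

abbreviation "C \<equiv> amp n A N"

lemma amp_entry: "M \<in> fibre C \<sigma> \<tau> \<Longrightarrow> i < n \<Longrightarrow> j < n \<Longrightarrow> M i j \<in> fibre A (\<sigma> j) (\<tau> i)"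
  and amp_outside: "M \<in> fibre C \<sigma> \<tau> \<Longrightarrow> \<not> (i < n \<and> j < n) \<Longrightarrow> M i j = undefined"
  using fibre_amp[OF n] by blast+

lemma amp_obj: "M \<in> fibre C \<sigma> \<tau> \<Longrightarrow> i < n \<Longrightarrow> \<sigma> i \<in> Obj A"
  and amp_obj': "M \<in> fibre C \<sigma> \<tau> \<Longrightarrow> i < n \<Longrightarrow> \<tau> i \<in> Obj A"
  using fibre_amp[OF n] obj_amp by blast+

lemma amp_eqI:
  assumes "M \<in> fibre C \<sigma> \<tau>" "M' \<in> fibre C \<sigma> \<tau>" "\<And>i j. i < n \<Longrightarrow> j < n \<Longrightarrow> M i j = M' i j"
  shows "M = M'"
proof (intro ext)
  fix i j show "M i j = M' i j"
    by (cases "i < n \<and> j < n") (simp_all add: assms(3) amp_outside[OF assms(1)] amp_outside[OF assms(2)])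
qed

lemma amp_ops:
  "mul C M M' i j = (if i < n \<and> j < n
     then fsum A (dm A (M' 0 j)) (cd A (M i 0)) (\<lambda>k. mul A (M i k) (M' k j)) n else undefined)"
  "add C M M' i j = (if i < n \<and> j < n then add A (M i j) (M' i j) else undefined)"
  "sml C c M i j = (if i < n \<and> j < n then sml A c (M i j) else undefined)"
  "zer C \<sigma> \<tau> i j = (if i < n \<and> j < n then zer A (\<sigma> j) (\<tau> i) else undefined)"
  "inv C M i j = (if i < n \<and> j < n then inv A (M j i) else undefined)"
  by (simp_all add: amp_def)

text \<open>Replaces the ends that the product reads off row 0 and column 0 by those of the typed
  factors; in this form the \<open>fsum\<close> lemmas apply.\<close>

lemma amp_mul_entry:
  assumes "M \<in> fibre C \<rho> \<tau>" "M' \<in> fibre C \<sigma> \<rho>" "i < n" "j < n"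
  shows "mul C M M' i j = fsum A (\<sigma> j) (\<tau> i) (\<lambda>k. mul A (M i k) (M' k j)) n"
  using fibreD[OF amp_entry[OF assms(1), of i 0]] fibreD[OF amp_entry[OF assms(2), of 0 j]] assms n
  by (simp add: amp_ops)

lemma amp_fibreI:
  assumes "\<sigma> \<in> Obj C" "\<tau> \<in> Obj C" "\<And>i j. i < n \<Longrightarrow> j < n \<Longrightarrow> M i j \<in> fibre A (\<sigma> j) (\<tau> i)"
    "\<And>i j. \<not> (i < n \<and> j < n) \<Longrightarrow> M i j = undefined"
  shows "M \<in> fibre C \<sigma> \<tau>"
  using assms fibre_amp[OF n] by blast

lemma amp_fibre_obj: "M \<in> fibre C \<sigma> \<tau> \<Longrightarrow> \<sigma> \<in> Obj C" "M \<in> fibre C \<sigma> \<tau> \<Longrightarrow> \<tau> \<in> Obj C"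
  using fibre_amp[OF n] by blast+

lemma amp_prod_fibre:
  assumes "a \<in> fibre C \<rho> \<tau>" "b \<in> fibre C \<sigma> \<rho>" "i < n" "k < n" "j < n"
  shows "mul A (a i k) (b k j) \<in> fibre A (\<sigma> j) (\<tau> i)"
  using mul_fibre[OF amp_entry[OF assms(1,3,4)] amp_entry[OF assms(2,4,5)]] .

lemma amp_mul_fibre:
  assumes "M \<in> fibre C \<rho> \<tau>" "M' \<in> fibre C \<sigma> \<rho>" shows "mul C M M' \<in> fibre C \<sigma> \<tau>"
proof (rule amp_fibreI)
  fix i j assume ij: "i < n" "j < n"
  show "mul C M M' i j \<in> fibre A (\<sigma> j) (\<tau> i)"
    unfolding amp_mul_entry[OF assms ij] using ij amp_obj[OF assms(2)] amp_obj'[OF assms(1)]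
    by (intro fsum_fibre amp_prod_fibre[OF assms]) auto
qed (use amp_fibre_obj assms in \<open>auto simp: amp_ops\<close>)

lemma amp_add_fibre:
  assumes "M \<in> fibre C \<sigma> \<tau>" "M' \<in> fibre C \<sigma> \<tau>" shows "add C M M' \<in> fibre C \<sigma> \<tau>"
  using amp_fibre_obj[OF assms(1)] amp_entry[OF assms(1)] amp_entry[OF assms(2)]
  by (intro amp_fibreI) (auto simp: amp_ops add_fibre)

lemma amp_sml_fibre: assumes "M \<in> fibre C \<sigma> \<tau>" shows "sml C c M \<in> fibre C \<sigma> \<tau>"
  using amp_fibre_obj[OF assms(1)] amp_entry[OF assms(1)]
  by (intro amp_fibreI) (auto simp: amp_ops sml_fibre)

lemma amp_inv_fibre: assumes "M \<in> fibre C \<sigma> \<tau>" shows "inv C M \<in> fibre C \<tau> \<sigma>"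
  using amp_fibre_obj[OF assms(1)] amp_entry[OF assms(1)]
  by (intro amp_fibreI) (auto simp: amp_ops inv_fibre)

lemma amp_zer_fibre: assumes "\<sigma> \<in> Obj C" "\<tau> \<in> Obj C" shows "zer C \<sigma> \<tau> \<in> fibre C \<sigma> \<tau>"
  using assms by (intro amp_fibreI) (auto simp: amp_ops zer_fibre obj_amp)

lemma cvs_amp:
  assumes \<sigma>: "\<sigma> \<in> Obj C" and \<tau>: "\<tau> \<in> Obj C"
  shows "cvs (fibre C \<sigma> \<tau>) (add C) (sml C) (zer C \<sigma> \<tau>)"
proof -
  have cv: "cvs (fibre A (\<sigma> j) (\<tau> i)) (add A) (sml A) (zer A (\<sigma> j) (\<tau> i))" if "i < n" "j < n" for i j
    using that \<sigma> \<tau> by (intro cvs_fibre) (auto simp: obj_amp)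
  note [simp] = amp_add_fibre amp_sml_fibre amp_zer_fibre[OF \<sigma> \<tau>]
  show ?thesis
  proof
    fix x y z assume "x \<in> fibre C \<sigma> \<tau>" "y \<in> fibre C \<sigma> \<tau>" "z \<in> fibre C \<sigma> \<tau>"
    then show "add C (add C x y) z = add C x (add C y z)"
      by (intro amp_eqI[of _ \<sigma> \<tau>]) (auto simp: amp_ops cvs.ad_assoc[OF cv] amp_entry)
  next
    fix x y assume "x \<in> fibre C \<sigma> \<tau>" "y \<in> fibre C \<sigma> \<tau>"
    then show "add C x y = add C y x"
      by (intro amp_eqI[of _ \<sigma> \<tau>]) (auto simp: amp_ops cvs.ad_comm[OF cv] amp_entry)
  next
    fix x assume "x \<in> fibre C \<sigma> \<tau>"
    then show "add C (zer C \<sigma> \<tau>) x = x"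
      by (intro amp_eqI[of _ \<sigma> \<tau>]) (auto simp: amp_ops cvs.zero_ad[OF cv] amp_entry)
  next
    fix x assume x: "x \<in> fibre C \<sigma> \<tau>"
    then have "add C x (sml C (-1) x) = zer C \<sigma> \<tau>"
      by (intro amp_eqI[of _ \<sigma> \<tau>]) (auto simp: amp_ops cvs.ad_neg[OF cv] amp_entry)
    then show "\<exists>y\<in>fibre C \<sigma> \<tau>. add C x y = zer C \<sigma> \<tau>" using x by (intro bexI[of _ "sml C (-1) x"]) auto
  next
    fix c x y assume "x \<in> fibre C \<sigma> \<tau>" "y \<in> fibre C \<sigma> \<tau>"
    then show "sml C c (add C x y) = add C (sml C c x) (sml C c y)"
      by (intro amp_eqI[of _ \<sigma> \<tau>]) (auto simp: amp_ops cvs.sm_ad[OF cv] amp_entry)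
  next
    fix c d x assume "x \<in> fibre C \<sigma> \<tau>"
    then show "sml C (c + d) x = add C (sml C c x) (sml C d x)"
      by (intro amp_eqI[of _ \<sigma> \<tau>]) (auto simp: amp_ops cvs.add_sm[OF cv] amp_entry)
  next
    fix c d x assume "x \<in> fibre C \<sigma> \<tau>"
    then show "sml C (c * d) x = sml C c (sml C d x)"
      by (intro amp_eqI[of _ \<sigma> \<tau>]) (auto simp: amp_ops cvs.mult_sm[OF cv] amp_entry)
  next
    fix x assume "x \<in> fibre C \<sigma> \<tau>"
    then show "sml C 1 x = x"
      by (intro amp_eqI[of _ \<sigma> \<tau>]) (auto simp: amp_ops cvs.one_sm[OF cv] amp_entry)
  qed auto
qed

lemma amp_assoc:
  assumes a: "a \<in> fibre C \<rho> \<tau>" and b: "b \<in> fibre C \<nu> \<rho>" and c: "c \<in> fibre C \<sigma> \<nu>"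
  shows "mul C (mul C a b) c = mul C a (mul C b c)"
proof (rule amp_eqI[of _ \<sigma> \<tau>])
  fix i j assume ij: "i < n" "j < n"
  note ent = amp_entry[OF a] amp_entry[OF b] amp_entry[OF c]
  have obj: "\<sigma> j \<in> Obj A" "\<tau> i \<in> Obj A" "\<And>k. k < n \<Longrightarrow> \<rho> k \<in> Obj A" "\<And>k. k < n \<Longrightarrow> \<nu> k \<in> Obj A"
    using ij amp_obj[OF c] amp_obj'[OF a] amp_obj[OF a] amp_obj[OF b] by auto
  have "mul C (mul C a b) c i j
      = fsum A (\<sigma> j) (\<tau> i) (\<lambda>k. mul A (fsum A (\<nu> k) (\<tau> i) (\<lambda>l. mul A (a i l) (b l k)) n) (c k j)) n"
    unfolding amp_mul_entry[OF amp_mul_fibre[OF a b] c ij]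
    by (rule fsum_cong) (simp add: amp_mul_entry[OF a b ij(1)])
  also have "\<dots> = fsum A (\<sigma> j) (\<tau> i) (\<lambda>k. fsum A (\<sigma> j) (\<tau> i) (\<lambda>l. mul A (mul A (a i l) (b l k)) (c k j)) n) n"
    using ij obj by (intro fsum_cong fsum_mul amp_prod_fibre[OF a b] ent) auto
  also have "\<dots> = fsum A (\<sigma> j) (\<tau> i) (\<lambda>l. fsum A (\<sigma> j) (\<tau> i) (\<lambda>k. mul A (mul A (a i l) (b l k)) (c k j)) n) n"
    using ij obj by (intro fsum_swap mul_fibre[OF amp_prod_fibre[OF a b]] ent) auto
  also have "\<dots> = fsum A (\<sigma> j) (\<tau> i) (\<lambda>l. fsum A (\<sigma> j) (\<tau> i) (\<lambda>k. mul A (a i l) (mul A (b l k) (c k j))) n) n"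
    using ij by (intro fsum_cong mul_assoc[OF ent]) auto
  also have "\<dots> = fsum A (\<sigma> j) (\<tau> i) (\<lambda>l. mul A (a i l) (fsum A (\<sigma> j) (\<rho> l) (\<lambda>k. mul A (b l k) (c k j)) n)) n"
    using ij obj by (intro fsum_cong mul_fsum[symmetric] amp_prod_fibre[OF b c] ent) auto
  also have "\<dots> = mul C a (mul C b c) i j"
    unfolding amp_mul_entry[OF a amp_mul_fibre[OF b c] ij]
    by (rule fsum_cong) (simp add: amp_mul_entry[OF b c _ ij(2)])
  finally show "mul C (mul C a b) c i j = mul C a (mul C b c) i j" .
qed (use a b c amp_mul_fibre in blast)+

lemma star_algebroid_amp: "star_algebroid C"
proof (rule star_algebroidI)
  obtain a where "a \<in> Carr A" using alg by (auto simp: algebroid_def)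
  define \<sigma> where "\<sigma> i = (if i < n then dm A a else undefined)" for i
  have \<sigma>: "\<sigma> \<in> Obj C" using dm_obj[OF \<open>a \<in> Carr A\<close>] by (auto simp: obj_amp \<sigma>_def)
  then show "Obj C \<noteq> {}" by blast
  show "Carr C \<noteq> {}" using amp_zer_fibre[OF \<sigma> \<sigma>] unfolding fibre_def by blast
next
  fix a a' b \<sigma> \<rho> \<tau> assume a: "a \<in> fibre C \<rho> \<tau>" "a' \<in> fibre C \<rho> \<tau>" and b: "b \<in> fibre C \<sigma> \<rho>"
  show "mul C (add C a a') b = add C (mul C a b) (mul C a' b)"
  proof (rule amp_eqI[of _ \<sigma> \<tau>])
    fix i j assume ij: "i < n" "j < n"
    have "mul C (add C a a') b i j
        = fsum A (\<sigma> j) (\<tau> i) (\<lambda>k. add A (mul A (a i k) (b k j)) (mul A (a' i k) (b k j))) n"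
      unfolding amp_mul_entry[OF amp_add_fibre[OF a] b ij] using ij
      by (intro fsum_cong)
        (simp add: amp_ops bilinear(1)[OF amp_entry[OF a(1) ij(1)] amp_entry[OF b _ ij(2)] amp_entry[OF a(2) ij(1)]])
    also have "\<dots> = add C (mul C a b) (mul C a' b) i j"
      using ij amp_obj[OF b] amp_obj'[OF a(1)]
      by (simp add: amp_ops(2) amp_mul_entry[OF a(1) b ij] amp_mul_entry[OF a(2) b ij])
        (intro fsum_add amp_prod_fibre[OF a(1) b] amp_prod_fibre[OF a(2) b]; simp)
    finally show "mul C (add C a a') b i j = add C (mul C a b) (mul C a' b) i j" .
  qed (use a b amp_mul_fibre amp_add_fibre in blast)+
next
  fix a b b' \<sigma> \<rho> \<tau> assume a: "a \<in> fibre C \<rho> \<tau>" and b: "b \<in> fibre C \<sigma> \<rho>" "b' \<in> fibre C \<sigma> \<rho>"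
  show "mul C a (add C b b') = add C (mul C a b) (mul C a b')"
  proof (rule amp_eqI[of _ \<sigma> \<tau>])
    fix i j assume ij: "i < n" "j < n"
    have "mul C a (add C b b') i j
        = fsum A (\<sigma> j) (\<tau> i) (\<lambda>k. add A (mul A (a i k) (b k j)) (mul A (a i k) (b' k j))) n"
      unfolding amp_mul_entry[OF a amp_add_fibre[OF b] ij] using ij
      by (intro fsum_cong)
        (simp add: amp_ops bilinear(2)[OF amp_entry[OF a ij(1)] amp_entry[OF b(1) _ ij(2)] amp_entry[OF b(2) _ ij(2)]])
    also have "\<dots> = add C (mul C a b) (mul C a b') i j"
      using ij amp_obj[OF b(1)] amp_obj'[OF a]
      by (simp add: amp_ops(2) amp_mul_entry[OF a b(1) ij] amp_mul_entry[OF a b(2) ij])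
        (intro fsum_add amp_prod_fibre[OF a b(1)] amp_prod_fibre[OF a b(2)]; simp)
    finally show "mul C a (add C b b') i j = add C (mul C a b) (mul C a b') i j" .
  qed (use a b amp_mul_fibre amp_add_fibre in blast)+
next
  fix a b c \<sigma> \<rho> \<tau> assume a: "a \<in> fibre C \<rho> \<tau>" and b: "b \<in> fibre C \<sigma> \<rho>"
  have sc: "fsum A (\<sigma> j) (\<tau> i) (\<lambda>k. sml A c (mul A (a i k) (b k j))) n = sml C c (mul C a b) i j"
    if ij: "i < n" "j < n" for i j
    using ij amp_obj[OF b] amp_obj'[OF a]
    by (simp add: amp_ops(3) amp_mul_entry[OF a b ij])
      (intro fsum_sml amp_prod_fibre[OF a b]; simp)
  show "mul C (sml C c a) b = sml C c (mul C a b)"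
  proof (rule amp_eqI[of _ \<sigma> \<tau>])
    fix i j assume ij: "i < n" "j < n"
    show "mul C (sml C c a) b i j = sml C c (mul C a b) i j"
      unfolding amp_mul_entry[OF amp_sml_fibre[OF a] b ij] sc[OF ij, symmetric] using ij
      by (intro fsum_cong)
        (simp add: amp_ops bilinear(3)[OF amp_entry[OF a ij(1)] amp_entry[OF b _ ij(2)]])
  qed (use a b amp_mul_fibre amp_sml_fibre in blast)+
  show "mul C a (sml C c b) = sml C c (mul C a b)"
  proof (rule amp_eqI[of _ \<sigma> \<tau>])
    fix i j assume ij: "i < n" "j < n"
    show "mul C a (sml C c b) i j = sml C c (mul C a b) i j"
      unfolding amp_mul_entry[OF a amp_sml_fibre[OF b] ij] sc[OF ij, symmetric] using ij
      by (intro fsum_cong)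
        (simp add: amp_ops bilinear(4)[OF amp_entry[OF a ij(1)] amp_entry[OF b _ ij(2)]])
  qed (use a b amp_mul_fibre amp_sml_fibre in blast)+
next
  fix a \<sigma> \<tau> assume a: "a \<in> fibre C \<sigma> \<tau>"
  show "inv C (inv C a) = a"
    by (rule amp_eqI[of _ \<sigma> \<tau>])
      (use a amp_inv_fibre in \<open>auto simp: amp_ops inv_inv[OF amp_entry[OF a]]\<close>)
  show "inv C (sml C c a) = sml C (cnj c) (inv C a)" for c
    by (rule amp_eqI[of _ \<tau> \<sigma>])
      (use a amp_inv_fibre amp_sml_fibre in \<open>auto simp: amp_ops inv_linear(2)[OF amp_entry[OF a]]\<close>)
next
  fix a b \<sigma> \<tau> assume a: "a \<in> fibre C \<sigma> \<tau>" and b: "b \<in> fibre C \<sigma> \<tau>"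
  show "inv C (add C a b) = add C (inv C a) (inv C b)"
    by (rule amp_eqI[of _ \<tau> \<sigma>])
      (use a b amp_inv_fibre amp_add_fibre in \<open>auto simp: amp_ops inv_linear(1)[OF amp_entry[OF a]] amp_entry[OF b]\<close>)
next
  fix a b \<sigma> \<rho> \<tau> assume a: "a \<in> fibre C \<rho> \<tau>" and b: "b \<in> fibre C \<sigma> \<rho>"
  show "inv C (mul C a b) = mul C (inv C b) (inv C a)"
  proof (rule amp_eqI[of _ \<tau> \<sigma>])
    fix i j assume ij: "i < n" "j < n"
    have "inv C (mul C a b) i j = inv A (fsum A (\<sigma> i) (\<tau> j) (\<lambda>k. mul A (a j k) (b k i)) n)"
      using ij by (simp add: amp_ops(5) amp_mul_entry[OF a b])
    also have "\<dots> = fsum A (\<tau> j) (\<sigma> i) (\<lambda>k. inv A (mul A (a j k) (b k i))) n"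
      using ij amp_obj[OF b] amp_obj'[OF a]
      by (intro inv_fsum amp_prod_fibre[OF a b]) auto
    also have "\<dots> = fsum A (\<tau> j) (\<sigma> i) (\<lambda>k. mul A (inv C b i k) (inv C a k j)) n"
      using ij by (intro fsum_cong)
        (simp add: amp_ops(5) inv_mul[OF amp_entry[OF a ij(2)] amp_entry[OF b _ ij(1)]])
    also have "\<dots> = mul C (inv C b) (inv C a) i j"
      by (rule amp_mul_entry[OF amp_inv_fibre[OF b] amp_inv_fibre[OF a] ij, symmetric])
    finally show "inv C (mul C a b) i j = mul C (inv C b) (inv C a) i j" .
  qed (use a b amp_mul_fibre amp_inv_fibre in blast)+
qed (erule (2) amp_assoc | erule (1) amp_mul_fibre | erule (1) cvs_amp | erule amp_inv_fibre
    | (rule conjI; erule amp_fibre_obj))+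

lemma single_entry_fibre:
  assumes "\<sigma> \<in> Obj C" "\<tau> \<in> Obj C" "a \<in> fibre A (\<sigma> j) (\<tau> i)"
  shows "single_entry n A \<sigma> \<tau> i j a \<in> fibre C \<sigma> \<tau>"
  using assms by (intro amp_fibreI) (auto simp: single_entry_def zer_fibre obj_amp)

text \<open>In entry \<open>(p, q)\<close> of the product every summand with index other than
  \<open>k\<close> has a zero factor, and so does the \<open>k\<close>-th unless
  \<open>(p, q) = (i, j)\<close>.\<close>

lemma single_entry_mul:
  assumes "\<sigma> \<in> Obj C" "\<rho> \<in> Obj C" "\<tau> \<in> Obj C" "i < n" "k < n" "j < n"
    and a: "a \<in> fibre A (\<rho> k) (\<tau> i)" and b: "b \<in> fibre A (\<sigma> j) (\<rho> k)"
  shows "mul C (single_entry n A \<rho> \<tau> i k a) (single_entry n A \<sigma> \<rho> k j b)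
    = single_entry n A \<sigma> \<tau> i j (mul A a b)" (is "mul C ?a ?b = ?c")
proof (rule amp_eqI[of _ \<sigma> \<tau>])
  have a': "?a \<in> fibre C \<rho> \<tau>" and b': "?b \<in> fibre C \<sigma> \<rho>" using assms single_entry_fibre by blast+
  then show "mul C ?a ?b \<in> fibre C \<sigma> \<tau>" by (rule amp_mul_fibre)
  show "?c \<in> fibre C \<sigma> \<tau>" using assms by (intro single_entry_fibre mul_fibre[OF a b])
  fix p q assume pq: "p < n" "q < n"
  have obj: "\<And>l. l < n \<Longrightarrow> \<sigma> l \<in> Obj A" "\<And>l. l < n \<Longrightarrow> \<tau> l \<in> Obj A" "\<And>l. l < n \<Longrightarrow> \<rho> l \<in> Obj A"
    using assms by (auto simp: obj_amp)
  have z: "mul A (?a p l) (?b l q) = zer A (\<sigma> q) (\<tau> p)" if "l < n" "l \<noteq> k \<or> p \<noteq> i \<or> q \<noteq> j" for l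
    using that pq obj a b assms
    by (auto simp: single_entry_def intro!: zer_mul mul_zer zer_fibre)
  have "mul C ?a ?b p q = mul A (?a p k) (?b k q)"
    unfolding amp_mul_entry[OF a' b' pq] using pq obj assms z
    by (intro fsum_single mul_fibre[of _ "\<rho> k"] amp_entry[OF a'] amp_entry[OF b']) auto
  also have "\<dots> = ?c p q"
    using z[of k] pq assms by (auto simp: single_entry_def)
  finally show "mul C ?a ?b p q = ?c p q" .
qed

lemma single_entry_inv:
  assumes "\<sigma> \<in> Obj C" "\<tau> \<in> Obj C"
  shows "inv C (single_entry n A \<sigma> \<tau> i j a) = single_entry n A \<tau> \<sigma> j i (inv A a)"
  using assms by (auto simp: amp_ops single_entry_def fun_eq_iff inv_zer obj_amp)

lemma single_entry_sml:
  assumes "\<sigma> \<in> Obj C" "\<tau> \<in> Obj C"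
  shows "sml C c (single_entry n A \<sigma> \<tau> i j a) = single_entry n A \<sigma> \<tau> i j (sml A c a)"
  using assms by (auto simp: amp_ops single_entry_def fun_eq_iff sml_zer obj_amp)

lemma single_entry_add:
  assumes "\<sigma> \<in> Obj C" "\<tau> \<in> Obj C"
  shows "add C (single_entry n A \<sigma> \<tau> i j a) (single_entry n A \<sigma> \<tau> i j b)
    = single_entry n A \<sigma> \<tau> i j (add A a b)"
  using assms by (auto simp: amp_ops single_entry_def fun_eq_iff zer_add zer_fibre obj_amp)

lemma unit_at_amp:
  assumes \<sigma>: "\<sigma> \<in> Obj C" and \<epsilon>: "\<And>s. s \<in> Obj A \<Longrightarrow> unit_at A s (\<epsilon> s)"
  shows "unit_at C \<sigma> (\<lambda>i j. if i < n \<and> j < n then if i = j then \<epsilon> (\<sigma> i) else zer A (\<sigma> j) (\<sigma> i) else undefined)"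
    (is "unit_at C \<sigma> ?E")
proof -
  have obj: "\<And>l. l < n \<Longrightarrow> \<sigma> l \<in> Obj A" using \<sigma> by (auto simp: obj_amp)
  have eps: "\<epsilon> s \<in> fibre A s s" if "s \<in> Obj A" for s using \<epsilon>[OF that] by (simp add: unit_at_def)
  have E: "?E \<in> fibre C \<sigma> \<sigma>"
    using \<sigma> obj by (intro amp_fibreI) (auto simp: zer_fibre eps)
  have 1: "mul C ?E M = M" if M: "M \<in> fibre C \<rho> \<sigma>" for M \<rho>
  proof (rule amp_eqI[OF amp_mul_fibre[OF E M] M])
    fix i j assume ij: "i < n" "j < n"
    have e: "mul A (\<epsilon> (\<sigma> i)) (M i j) = M i j"
      using \<epsilon>[OF obj[OF ij(1)]] fibreD[OF amp_entry[OF M ij]] by (simp add: unit_at_def)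
    have "mul C ?E M i j = mul A (?E i i) (M i j)"
      unfolding amp_mul_entry[OF E M ij] using ij obj amp_obj[OF M]
      by (intro fsum_single mul_fibre[of _ "\<sigma> i"] amp_entry[OF E] amp_entry[OF M])
        (auto intro!: zer_mul amp_entry[OF M])
    then show "mul C ?E M i j = M i j" using e ij by simp
  qed
  have 2: "mul C M ?E = M" if M: "M \<in> fibre C \<sigma> \<rho>" for M \<rho>
  proof (rule amp_eqI[OF amp_mul_fibre[OF M E] M])
    fix i j assume ij: "i < n" "j < n"
    have e: "mul A (M i j) (\<epsilon> (\<sigma> j)) = M i j"
      using \<epsilon>[OF obj[OF ij(2)]] fibreD[OF amp_entry[OF M ij]] by (simp add: unit_at_def)
    have "mul C M ?E i j = mul A (M i j) (?E j j)"
      unfolding amp_mul_entry[OF M E ij] using ij obj amp_obj'[OF M]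
      by (intro fsum_single mul_fibre[of _ "\<sigma> j"] amp_entry[OF E] amp_entry[OF M])
        (auto intro!: mul_zer amp_entry[OF M])
    then show "mul C M ?E i j = M i j" using e ij by simp
  qed
  have f: "a \<in> Carr C \<Longrightarrow> a \<in> fibre C (dm C a) (cd C a)" for a by (simp add: fibre_def)
  show ?thesis unfolding unit_at_def using E 1 2 f by blast
qed

end

end

section \<open>Positivity from the 2-fold amplification\<close>

context cstaralg
begin

lemma star_positive_if_amp2:
  assumes un: "unital A" and ext: "extends_norms 2 A N" and cs: "cstar_algebroid (amp 2 A N)"
  shows "star_positive A"
  unfolding star_positive_def
proof (intro ballI)
  fix s t x assume s: "s \<in> Obj A" and t: "t \<in> Obj A" and x: "x \<in> fibre A s t"
  let ?C = "amp 2 A N"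
  interpret C: cstaralg ?C using cs by unfold_locales
  have two: "(2::nat) > 0" by simp
  obtain \<epsilon> where \<epsilon>: "\<And>s. s \<in> Obj A \<Longrightarrow> unit_at A s (\<epsilon> s)" using unital_unit_at[OF un] by blast
  \<comment> \<open>At the object \<open>(s, t)\<close> the arrow \<open>x\<close> becomes an
    off-diagonal entry of an element of one unital C*-algebra, where \<open>pos_star_mult\<close>
    applies.\<close>
  define \<sigma> where "\<sigma> i = (if i = 0 then s else if i = Suc 0 then t else undefined)" for i :: nat
  have \<sigma>: "\<sigma> \<in> Obj ?C" using s t by (auto simp: obj_amp \<sigma>_def)
  have \<sigma>01: "\<sigma> 0 = s" "\<sigma> (Suc 0) = t" by (simp_all add: \<sigma>_def)
  obtain E where E: "unit_at ?C \<sigma> E" using unit_at_amp[OF two \<sigma> \<epsilon>] by blast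
  interpret U: ucalg "fibre ?C \<sigma> \<sigma>" "add ?C" "sml ?C" "zer ?C \<sigma> \<sigma>" "mul ?C" "inv ?C" "nrm ?C" E
    by (rule C.ucalg_fibre[OF E])
  interpret F: ucalg "fibre A s s" "add A" "sml A" "zer A s s" "mul A" "inv A" "nrm A" "\<epsilon> s"
    by (rule ucalg_fibre[OF \<epsilon>[OF s]])
  let ?se = "single_entry 2 A \<sigma> \<sigma>"
  have nC: "nrm ?C (?se 0 0 a) = nrm A a" if "a \<in> fibre A s s" for a
    using ext that \<sigma> \<sigma>01 unfolding extends_norms_def by (simp add: amp_def)
  let ?y = "mul A (inv A x) x" and ?X = "?se 1 0 x" and ?P = "?se 0 0 (\<epsilon> s)"
  have y: "?y \<in> fibre A s s" "inv A ?y = ?y"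
    using x inv_fibre[OF x] by (simp_all add: mul_fibre[of _ t] inv_mul[of _ t s] inv_inv[of _ s t])
  have X: "?X \<in> fibre ?C \<sigma> \<sigma>" using single_entry_fibre[OF two \<sigma> \<sigma>, of x 0 1] x \<sigma>01 by simp
  have P: "?P \<in> fibre ?C \<sigma> \<sigma>" using single_entry_fibre[OF two \<sigma> \<sigma>, of "\<epsilon> s" 0 0] \<sigma>01 by simp
  have XX: "mul ?C (inv ?C ?X) ?X = ?se 0 0 ?y"
    using single_entry_mul[OF two \<sigma> \<sigma> \<sigma>, of 0 1 0 "inv A x" x] single_entry_inv[OF two \<sigma> \<sigma>] x inv_fibre[OF x] \<sigma>01
    by simp
  let ?Y = "?se 0 0 ?y" and ?t = "nrm A ?y + 1"
  have t0: "?t > 0" using y by (simp add: add_nonneg_pos)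
  have "U.pos ?Y" using U.pos_star_mult[OF X] XX by simp
  then have "nrm ?C (U.mi (U.sc ?t) ?Y) \<le> ?t" and Y: "?Y \<in> fibre ?C \<sigma> \<sigma>"
    using U.pos_nm[of ?Y ?t] U.pos_closed t0 nC[OF y(1)] by auto
  have PP: "mul ?C ?P (?se 0 0 a) = ?se 0 0 a" "mul ?C (?se 0 0 a) ?P = ?se 0 0 a" if "a \<in> fibre A s s" for a
    using single_entry_mul[OF two \<sigma> \<sigma> \<sigma>, of 0 0 0 "\<epsilon> s" a] single_entry_mul[OF two \<sigma> \<sigma> \<sigma>, of 0 0 0 a "\<epsilon> s"]
      that \<sigma>01 by simp_all
  \<comment> \<open>Compression by \<open>?P\<close> turns the unit \<open>E\<close> into
    \<open>?P\<close> and fixes \<open>?Y\<close>, leaving the single entry \<open>t e - y\<close>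
    with \<open>t = ?t\<close>, whose norm \<open>extends_norms\<close> identifies with that in
    \<open>A s s\<close>. Compressing does not increase norms, since \<open>?P\<close> has norm at
    most 1.\<close>
  have "mul ?C ?P (mul ?C (U.mi (U.sc ?t) ?Y) ?P) = ?se 0 0 (F.mi (F.sc ?t) ?y)"
  proof -
    have "mul ?C ?P (mul ?C (U.mi (U.sc ?t) ?Y) ?P) = U.mi (sml ?C (complex_of_real ?t) ?P) ?Y"
      using P Y PP[OF y(1)] PP[of "\<epsilon> s"] by (simp add: U.dist_simps)
    then show ?thesis by (simp add: single_entry_sml[OF two \<sigma> \<sigma>] single_entry_add[OF two \<sigma> \<sigma>])
  qed
  then have "nrm A (F.mi (F.sc ?t) ?y) = nrm ?C (mul ?C ?P (mul ?C (U.mi (U.sc ?t) ?Y) ?P))"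
    using nC[of "F.mi (F.sc ?t) ?y"] y by simp
  also have "\<dots> \<le> nrm ?C ?P * (nrm ?C (U.mi (U.sc ?t) ?Y) * nrm ?C ?P)"
    using P Y by (intro order_trans[OF U.nm_mu] mult_left_mono U.nm_mu) auto
  also have "\<dots> \<le> 1 * (?t * 1)"
    using P Y nC[of "\<epsilon> s"] F.nm_e t0 \<open>nrm ?C (U.mi (U.sc ?t) ?Y) \<le> ?t\<close>
    by (intro mult_mono) auto
  finally have "F.pos ?y" using F.nm_pos[OF t0 y] by simp
  then show "posel A s ?y" using posel_eq_pos[OF \<epsilon>[OF s]] by simp
qed

end


section \<open>Representations on semi-inner product spaces\<close>

text \<open>None of the vector space laws is needed: only the values of the semi-inner product matter.\<close>
locale sip =
  fixes V :: "'v set" and vadd :: "'v \<Rightarrow> 'v \<Rightarrow> 'v" and vsml :: "complex \<Rightarrow> 'v \<Rightarrow> 'v" and vz :: 'v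
    and ip :: "'v \<Rightarrow> 'v \<Rightarrow> complex"
  assumes vz_closed [simp]: "vz \<in> V"
    and vadd_closed [simp]: "\<And>x y. x \<in> V \<Longrightarrow> y \<in> V \<Longrightarrow> vadd x y \<in> V"
    and vsml_closed [simp]: "\<And>c x. x \<in> V \<Longrightarrow> vsml c x \<in> V"
    and ip_vz [simp]: "\<And>x. x \<in> V \<Longrightarrow> ip vz x = 0"
    and ip_add: "\<And>x y z. x \<in> V \<Longrightarrow> y \<in> V \<Longrightarrow> z \<in> V \<Longrightarrow> ip (vadd x y) z = ip x z + ip y z"
    and ip_sml: "\<And>c x y. x \<in> V \<Longrightarrow> y \<in> V \<Longrightarrow> ip (vsml c x) y = c * ip x y"
    and ip_sym: "\<And>x y. x \<in> V \<Longrightarrow> y \<in> V \<Longrightarrow> ip x y = cnj (ip y x)"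
    and ip_nonneg: "\<And>x. x \<in> V \<Longrightarrow> 0 \<le> Re (ip x x)"

text \<open>Depends on \<open>ip\<close> alone, so that one norm serves the spaces attached to all
  objects.\<close>

definition vn :: "('v \<Rightarrow> 'v \<Rightarrow> complex) \<Rightarrow> 'v \<Rightarrow> real" where
  "vn ip v = sqrt (Re (ip v v))"

context sip
begin

lemma ip_add_right: "x \<in> V \<Longrightarrow> y \<in> V \<Longrightarrow> z \<in> V \<Longrightarrow> ip z (vadd x y) = ip z x + ip z y"
  using ip_sym[of z "vadd x y"] ip_sym[of z x] ip_sym[of z y] ip_add[of x y z] by simp

lemma ip_sml_right: "x \<in> V \<Longrightarrow> y \<in> V \<Longrightarrow> ip y (vsml c x) = cnj c * ip y x"
  using ip_sym[of y "vsml c x"] ip_sym[of y x] ip_sml[of x y c] by simp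

lemma ip_vz_right [simp]: "x \<in> V \<Longrightarrow> ip x vz = 0"
  using ip_sym[of x vz] by simp

lemma vn_nonneg [simp]: "x \<in> V \<Longrightarrow> 0 \<le> vn ip x"
  by (simp add: vn_def ip_nonneg)

lemma ip_self: assumes "x \<in> V" shows "ip x x = complex_of_real ((vn ip x)\<^sup>2)"
proof -
  have "Im (ip x x) = 0" using arg_cong[OF ip_sym[OF assms assms], of Im] by simp
  then show ?thesis using ip_nonneg[OF assms] by (simp add: vn_def complex_eq_iff)
qed

lemma vn_sq: "x \<in> V \<Longrightarrow> (vn ip x)\<^sup>2 = Re (ip x x)"
  by (simp add: vn_def ip_nonneg)

lemma Cauchy_Schwarz: assumes x: "x \<in> V" and y: "y \<in> V" shows "cmod (ip x y) \<le> vn ip x * vn ip y"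
proof -
  define z where "z = ip x y"
  have yx: "ip y x = cnj z" using ip_sym[OF y x] by (simp add: z_def)
  \<comment> \<open>Nonnegativity of the form at \<open>x - t z y\<close>. Restricting to real
    multiples of \<open>z\<close> reduces the complex case to a real quadratic in
    \<open>t\<close>.\<close>
  have quad: "0 \<le> (vn ip x)\<^sup>2 - 2 * t * (cmod z)\<^sup>2 + t\<^sup>2 * (cmod z)\<^sup>2 * (vn ip y)\<^sup>2" for t :: real
  proof -
    define c where "c = - complex_of_real t * z"
    have "ip (vadd x (vsml c y)) (vadd x (vsml c y)) = ip x x + cnj c * z + (c * cnj z + c * cnj c * ip y y)"
      using x y by (simp add: ip_add ip_add_right ip_sml ip_sml_right yx algebra_simps flip: z_def)
    also have "\<dots> = complex_of_real ((vn ip x)\<^sup>2) - complex_of_real (2 * t) * (z * cnj z)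
        + complex_of_real (t\<^sup>2) * (z * cnj z) * complex_of_real ((vn ip y)\<^sup>2)"
      unfolding ip_self[OF x] ip_self[OF y] c_def by (simp add: algebra_simps power2_eq_square)
    also have "\<dots> = complex_of_real ((vn ip x)\<^sup>2 - 2 * t * (cmod z)\<^sup>2 + t\<^sup>2 * (cmod z)\<^sup>2 * (vn ip y)\<^sup>2)"
      unfolding complex_norm_square[symmetric] by simp
    finally show ?thesis using ip_nonneg[of "vadd x (vsml c y)"] x y by simp
  qed
  show ?thesis
  proof (cases "vn ip y = 0")
    case True
    have "z = 0"
    proof (rule ccontr)
      assume "z \<noteq> 0"
      then have pos: "(cmod z)\<^sup>2 > 0" by simp
      \<comment> \<open>For \<open>vn ip y = 0\<close> the quadratic is linear in \<open>t\<close>,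
        and at this \<open>t\<close> its value is -1.\<close>
      have "2 * (((vn ip x)\<^sup>2 + 1) / (2 * (cmod z)\<^sup>2)) * (cmod z)\<^sup>2 = (vn ip x)\<^sup>2 + 1"
        using pos by (simp add: field_simps)
      then show False using quad[of "((vn ip x)\<^sup>2 + 1) / (2 * (cmod z)\<^sup>2)"] True by simp
    qed
    then show ?thesis using x y by (simp flip: z_def)
  next
    case False
    then have b: "(vn ip y)\<^sup>2 > 0" by simp
    have "(1 / b)\<^sup>2 * q * b = q / b" if "b > 0" for b q :: real
      using that by (simp add: power2_eq_square)
    from this[OF b] have "0 \<le> (vn ip x)\<^sup>2 - (cmod z)\<^sup>2 / (vn ip y)\<^sup>2"
      using quad[of "1 / (vn ip y)\<^sup>2"] by simp
    then have "(cmod z)\<^sup>2 \<le> (vn ip x * vn ip y)\<^sup>2"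
      using b by (simp add: field_simps power_mult_distrib)
    then have "cmod z \<le> vn ip x * vn ip y" by (rule power2_le_imp_le) (simp add: x y)
    then show ?thesis by (simp only: z_def)
  qed
qed

lemma vn_sml: assumes x: "x \<in> V" shows "vn ip (vsml c x) = cmod c * vn ip x"
proof -
  have "ip (vsml c x) (vsml c x) = (c * cnj c) * ip x x"
    using x by (simp add: ip_sml ip_sml_right)
  then have "Re (ip (vsml c x) (vsml c x)) = (cmod c)\<^sup>2 * Re (ip x x)"
    unfolding complex_norm_square[symmetric] by simp
  then show ?thesis by (simp add: vn_def real_sqrt_mult)
qed

lemma vn_add: assumes x: "x \<in> V" and y: "y \<in> V" shows "vn ip (vadd x y) \<le> vn ip x + vn ip y"
proof -
  have "(vn ip (vadd x y))\<^sup>2 = Re (ip x x) + Re (ip x y) + Re (ip y x) + Re (ip y y)"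
    using x y by (simp add: vn_sq ip_add ip_add_right)
  also have "\<dots> \<le> (vn ip x)\<^sup>2 + vn ip x * vn ip y + vn ip y * vn ip x + (vn ip y)\<^sup>2"
    using complex_Re_le_cmod[of "ip x y"] complex_Re_le_cmod[of "ip y x"]
      Cauchy_Schwarz[OF x y] Cauchy_Schwarz[OF y x] x y unfolding vn_sq[OF x] vn_sq[OF y] by linarith
  also have "\<dots> = (vn ip x + vn ip y)\<^sup>2" by (simp add: power2_eq_square algebra_simps)
  finally show ?thesis by (rule power2_le_imp_le) (simp add: x y)
qed

text \<open>The substitute for equality of vectors: vectors with the same pairings may differ by a
  null vector, but their norms agree.\<close>

lemma vn_cong:
  assumes x: "x \<in> V" and y: "y \<in> V" and eq: "\<And>w. w \<in> V \<Longrightarrow> ip x w = ip y w"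
  shows "vn ip x = vn ip y"
proof -
  have "ip x x = ip y x" using eq x by blast
  also have "\<dots> = cnj (ip x y)" using ip_sym x y by blast
  also have "\<dots> = ip y y" using eq[OF y] ip_self[OF y] by simp
  finally show ?thesis by (simp add: vn_def)
qed

end

text \<open>The laws of the action are required only after pairing with a vector \<open>w\<close>,
  that is, up to null vectors. Since adjoints exist in this weak sense, linearity in the vector is a
  consequence.\<close>

locale sip_rep = staralg A for A :: "('a, 's, 'z) alg_scheme" +
  fixes V :: "'s \<Rightarrow> 'v set" and vadd :: "'v \<Rightarrow> 'v \<Rightarrow> 'v" and vsml :: "complex \<Rightarrow> 'v \<Rightarrow> 'v"
    and vz :: "'s \<Rightarrow> 'v" and ip :: "'v \<Rightarrow> 'v \<Rightarrow> complex" and act :: "'a \<Rightarrow> 'v \<Rightarrow> 'v"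
  assumes sip: "\<And>s. s \<in> Obj A \<Longrightarrow> sip (V s) vadd vsml (vz s) ip"
    and act_closed: "\<And>a s t v. a \<in> fibre A s t \<Longrightarrow> v \<in> V s \<Longrightarrow> act a v \<in> V t"
    and act_add: "\<And>a b s t v w. a \<in> fibre A s t \<Longrightarrow> b \<in> fibre A s t \<Longrightarrow> v \<in> V s \<Longrightarrow> w \<in> V t \<Longrightarrow>
      ip (act (add A a b) v) w = ip (act a v) w + ip (act b v) w"
    and act_sml: "\<And>a c s t v w. a \<in> fibre A s t \<Longrightarrow> v \<in> V s \<Longrightarrow> w \<in> V t \<Longrightarrow>
      ip (act (sml A c a) v) w = c * ip (act a v) w"
    and act_mul: "\<And>a b s u t v w. a \<in> fibre A u t \<Longrightarrow> b \<in> fibre A s u \<Longrightarrow> v \<in> V s \<Longrightarrow> w \<in> V t \<Longrightarrow>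
      ip (act (mul A a b) v) w = ip (act a (act b v)) w"
    and act_inv: "\<And>a s t v w. a \<in> fibre A s t \<Longrightarrow> v \<in> V s \<Longrightarrow> w \<in> V t \<Longrightarrow>
      ip (act (inv A a) w) v = ip w (act a v)"
    and bounded: "\<And>a s t. a \<in> fibre A s t \<Longrightarrow> \<exists>K. \<forall>v\<in>V s. vn ip (act a v) \<le> K * vn ip v"
begin

definition opn :: "'a \<Rightarrow> real" where
  "opn a = (SUP v\<in>{v \<in> V (dm A a). vn ip v \<le> 1}. vn ip (act a v))"

context
  fixes a s t assumes a: "a \<in> fibre A s t"
begin

interpretation S: sip "V s" vadd vsml "vz s" ip using sip fibre_obj[OF a] by blast
interpretation T: sip "V t" vadd vsml "vz t" ip using sip fibre_obj[OF a] by blast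

lemma act_adj: assumes "v \<in> V s" "w \<in> V t" shows "ip (act a v) w = ip v (act (inv A a) w)"
  using act_inv[OF inv_fibre[OF a] assms(2,1)] inv_inv[OF a] by simp

text \<open>Move \<open>a\<close> to the other side as its adjoint and use additivity of
  \<open>ip\<close> in its first argument.\<close>

lemma act_vadd: "v \<in> V s \<Longrightarrow> v' \<in> V s \<Longrightarrow> w \<in> V t \<Longrightarrow>
    ip (act a (vadd v v')) w = ip (act a v) w + ip (act a v') w"
  using act_closed[OF inv_fibre[OF a]] by (simp add: act_adj S.ip_add)

lemma act_vsml: "v \<in> V s \<Longrightarrow> w \<in> V t \<Longrightarrow> ip (act a (vsml c v)) w = c * ip (act a v) w"
  using act_closed[OF inv_fibre[OF a]] by (simp add: act_adj S.ip_sml)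

lemma act_vz: "w \<in> V t \<Longrightarrow> ip (act a (vz s)) w = 0"
  using act_closed[OF inv_fibre[OF a]] by (simp add: act_adj)

lemma vn_act_vsml: assumes v: "v \<in> V s" shows "vn ip (act a (vsml c v)) = cmod c * vn ip (act a v)"
proof -
  have "vn ip (act a (vsml c v)) = vn ip (vsml c (act a v))"
    using v by (intro T.vn_cong) (simp_all add: act_closed[OF a] act_vsml T.ip_sml)
  then show ?thesis using v by (simp add: T.vn_sml act_closed[OF a])
qed

lemma opn_bdd: "bdd_above ((\<lambda>v. vn ip (act a v)) ` {v \<in> V s. vn ip v \<le> 1})"
proof -
  obtain K where K: "\<And>v. v \<in> V s \<Longrightarrow> vn ip (act a v) \<le> K * vn ip v" using bounded[OF a] by blast
  show ?thesis
  proof (rule bdd_aboveI2)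
    fix v assume v: "v \<in> {v \<in> V s. vn ip v \<le> 1}"
    have "vn ip (act a v) \<le> K * vn ip v" using K v by blast
    also have "\<dots> \<le> \<bar>K\<bar> * vn ip v" using v by (intro mult_right_mono) auto
    also have "\<dots> \<le> \<bar>K\<bar> * 1" using v by (intro mult_left_mono) auto
    finally show "vn ip (act a v) \<le> \<bar>K\<bar>" by simp
  qed
qed

lemma vz_norm: "vn ip (vz s) = 0"
  by (simp add: vn_def)

lemma opn_unit: "v \<in> V s \<Longrightarrow> vn ip v \<le> 1 \<Longrightarrow> vn ip (act a v) \<le> opn a"
  unfolding opn_def using opn_bdd fibreD[OF a] by (auto intro!: cSUP_upper)

lemma opn_nonneg: "0 \<le> opn a"
  using opn_unit[of "vz s"] T.vn_nonneg[OF act_closed[OF a], of "vz s"] by (simp add: vz_norm)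

lemma opn_bound: assumes v: "v \<in> V s" shows "vn ip (act a v) \<le> opn a * vn ip v"
proof (cases "vn ip v = 0")
  case True
  \<comment> \<open>A null vector cannot be normalised; boundedness sends it to a null
    vector.\<close>
  obtain K where "vn ip (act a v) \<le> K * vn ip v" using bounded[OF a] v by blast
  then show ?thesis using True by simp
next
  case False
  then have pos: "vn ip v > 0" using S.vn_nonneg[OF v] by linarith
  let ?c = "complex_of_real (1 / vn ip v)"
  have "vn ip (vsml ?c v) \<le> 1" using pos v by (simp add: S.vn_sml norm_divide)
  then have "vn ip (act a (vsml ?c v)) \<le> opn a" using v by (intro opn_unit) auto
  then show ?thesis using pos v by (simp add: vn_act_vsml norm_divide field_simps)
qed

lemma opn_le: assumes "0 \<le> K" "\<And>v. v \<in> V s \<Longrightarrow> vn ip (act a v) \<le> K * vn ip v" shows "opn a \<le> K"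
proof -
  have "(SUP v\<in>{v \<in> V s. vn ip v \<le> 1}. vn ip (act a v)) \<le> K"
  proof (rule cSUP_least)
    show "{v \<in> V s. vn ip v \<le> 1} \<noteq> {}" by (auto intro!: exI[of _ "vz s"] simp: vz_norm)
    fix v assume v: "v \<in> {v \<in> V s. vn ip v \<le> 1}"
    then have "vn ip (act a v) \<le> K * vn ip v" using assms by blast
    also have "\<dots> \<le> K * 1" using v assms by (intro mult_left_mono) auto
    finally show "vn ip (act a v) \<le> K" by simp
  qed
  then show ?thesis using fibreD[OF a] by (simp add: opn_def)
qed

end

lemma opn_add: assumes a: "a \<in> fibre A s t" and b: "b \<in> fibre A s t"
  shows "opn (add A a b) \<le> opn a + opn b"
proof (rule opn_le[OF add_fibre[OF a b]])
  interpret T: sip "V t" vadd vsml "vz t" ip using sip fibre_obj[OF a] by blast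
  show "0 \<le> opn a + opn b" using opn_nonneg[OF a] opn_nonneg[OF b] by simp
  fix v assume v: "v \<in> V s"
  note cl [simp] = act_closed[OF a v] act_closed[OF b v] act_closed[OF add_fibre[OF a b] v]
  have "vn ip (act (add A a b) v) = vn ip (vadd (act a v) (act b v))"
    using v by (intro T.vn_cong) (simp_all add: act_add[OF a b] T.ip_add)
  also have "\<dots> \<le> vn ip (act a v) + vn ip (act b v)" by (intro T.vn_add) simp_all
  also have "\<dots> \<le> opn a * vn ip v + opn b * vn ip v"
    using v by (intro add_mono opn_bound[OF a] opn_bound[OF b])
  finally show "vn ip (act (add A a b) v) \<le> (opn a + opn b) * vn ip v" by (simp add: algebra_simps)
qed

lemma vn_act_sml: assumes a: "a \<in> fibre A s t" and v: "v \<in> V s"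
  shows "vn ip (act (sml A c a) v) = cmod c * vn ip (act a v)"
proof -
  interpret T: sip "V t" vadd vsml "vz t" ip using sip fibre_obj[OF a] by blast
  have "vn ip (act (sml A c a) v) = vn ip (vsml c (act a v))"
    using act_closed[OF a v] act_closed[OF sml_fibre[OF a] v] v
    by (intro T.vn_cong) (simp_all add: act_sml[OF a] T.ip_sml)
  then show ?thesis using act_closed[OF a v] by (simp add: T.vn_sml)
qed

lemma opn_sml: assumes a: "a \<in> fibre A s t" shows "opn (sml A c a) = cmod c * opn a"
proof (rule antisym)
  show "opn (sml A c a) \<le> cmod c * opn a"
    using opn_nonneg[OF a] mult_left_mono[OF opn_bound[OF a], of _ "cmod c"]
    by (intro opn_le[OF sml_fibre[OF a]]) (simp_all add: vn_act_sml[OF a] mult.assoc)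
  show "cmod c * opn a \<le> opn (sml A c a)"
  proof (cases "c = 0")
    case True then show ?thesis using opn_nonneg[OF sml_fibre[OF a]] by simp
  next
    case False
    have "opn a \<le> opn (sml A c a) / cmod c"
    proof (rule opn_le[OF a])
      fix v assume v: "v \<in> V s"
      have "cmod c * vn ip (act a v) \<le> opn (sml A c a) * vn ip v"
        using opn_bound[OF sml_fibre[OF a] v, of c] by (simp add: vn_act_sml[OF a v])
      then show "vn ip (act a v) \<le> opn (sml A c a) / cmod c * vn ip v" using False by (simp add: field_simps)
    qed (use opn_nonneg[OF sml_fibre[OF a]] in simp)
    then show ?thesis using False by (simp add: field_simps)
  qed
qed

lemma opn_mul: assumes a: "a \<in> fibre A u t" and b: "b \<in> fibre A s u"
  shows "opn (mul A a b) \<le> opn a * opn b"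
proof (rule opn_le[OF mul_fibre[OF a b]])
  interpret T: sip "V t" vadd vsml "vz t" ip using sip fibre_obj[OF a] by blast
  show "0 \<le> opn a * opn b" using opn_nonneg[OF a] opn_nonneg[OF b] by simp
  fix v assume v: "v \<in> V s"
  note bv = act_closed[OF b v]
  have "vn ip (act (mul A a b) v) = vn ip (act a (act b v))"
    using act_closed[OF a bv] act_closed[OF mul_fibre[OF a b] v] v
    by (intro T.vn_cong) (simp_all add: act_mul[OF a b])
  also have "\<dots> \<le> opn a * vn ip (act b v)" by (rule opn_bound[OF a bv])
  also have "\<dots> \<le> opn a * (opn b * vn ip v)"
    by (rule mult_left_mono[OF opn_bound[OF b v] opn_nonneg[OF a]])
  finally show "vn ip (act (mul A a b) v) \<le> opn a * opn b * vn ip v" by (simp add: mult.assoc)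
qed

text \<open>With \<open>v = a* w\<close>, \<open>||v||^2 = <w, a v> <= ||w|| opn a ||v||\<close>,
  from which \<open>||v||\<close> is cancelled.\<close>

lemma opn_inv_le: assumes a: "a \<in> fibre A s t" shows "opn (inv A a) \<le> opn a"
proof (rule opn_le[OF inv_fibre[OF a] opn_nonneg[OF a]])
  interpret S: sip "V s" vadd vsml "vz s" ip using sip fibre_obj[OF a] by blast
  interpret T: sip "V t" vadd vsml "vz t" ip using sip fibre_obj[OF a] by blast
  fix w assume w: "w \<in> V t"
  let ?v = "act (inv A a) w"
  note v = act_closed[OF inv_fibre[OF a] w]
  have "(vn ip ?v)\<^sup>2 = Re (ip w (act a ?v))" using act_inv[OF a v w] v by (simp add: S.vn_sq)
  also have "\<dots> \<le> vn ip w * vn ip (act a ?v)"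
    using complex_Re_le_cmod T.Cauchy_Schwarz[OF w act_closed[OF a v]] by (rule order_trans)
  also have "\<dots> \<le> vn ip w * (opn a * vn ip ?v)"
    using opn_bound[OF a v] w by (intro mult_left_mono) auto
  finally have *: "vn ip ?v * vn ip ?v \<le> (opn a * vn ip w) * vn ip ?v"
    by (simp add: power2_eq_square ac_simps)
  show "vn ip ?v \<le> opn a * vn ip w"
  proof (cases "vn ip ?v = 0")
    case True then show ?thesis using opn_nonneg[OF a] w by simp
  next
    case False
    then show ?thesis using * S.vn_nonneg[OF v] by (simp add: mult_le_cancel_right)
  qed
qed

lemma opn_inv: assumes a: "a \<in> fibre A s t" shows "opn (inv A a) = opn a"
  using opn_inv_le[OF a] opn_inv_le[OF inv_fibre[OF a]] inv_inv[OF a] by simp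

text \<open>The direction not following from submultiplicativity is
  \<open>||a v||^2 = <a* a v, v>\<close> with Cauchy-Schwarz.\<close>

lemma opn_cstar: assumes a: "a \<in> fibre A s t" shows "opn (mul A (inv A a) a) = (opn a)\<^sup>2"
proof (rule antisym)
  interpret S: sip "V s" vadd vsml "vz s" ip using sip fibre_obj[OF a] by blast
  interpret T: sip "V t" vadd vsml "vz t" ip using sip fibre_obj[OF a] by blast
  let ?aa = "mul A (inv A a) a"
  have aa: "?aa \<in> fibre A s s" using a inv_fibre[OF a] mul_fibre by blast
  show "opn ?aa \<le> (opn a)\<^sup>2"
    using opn_mul[OF inv_fibre[OF a] a] opn_inv[OF a] by (simp add: power2_eq_square)
  have "opn a \<le> sqrt (opn ?aa)"
  proof (rule opn_le[OF a])
    fix v assume v: "v \<in> V s"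
    have "(vn ip (act a v))\<^sup>2 = Re (ip (act ?aa v) v)"
      using act_inv[OF a v act_closed[OF a v]] act_mul[OF inv_fibre[OF a] a v v] act_closed[OF a v]
      by (simp add: T.vn_sq)
    also have "\<dots> \<le> vn ip (act ?aa v) * vn ip v"
      using complex_Re_le_cmod S.Cauchy_Schwarz[OF act_closed[OF aa v] v] by (rule order_trans)
    also have "\<dots> \<le> (opn ?aa * vn ip v) * vn ip v"
      using opn_bound[OF aa v] v by (intro mult_right_mono) auto
    also have "\<dots> = (sqrt (opn ?aa) * vn ip v)\<^sup>2"
      using opn_nonneg[OF aa] by (simp add: power2_eq_square ac_simps power_mult_distrib)
    finally show "vn ip (act a v) \<le> sqrt (opn ?aa) * vn ip v"
      by (rule power2_le_imp_le) (simp add: opn_nonneg[OF aa] v)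
  qed (use opn_nonneg[OF aa] in simp)
  then have "(opn a)\<^sup>2 \<le> (sqrt (opn ?aa))\<^sup>2" using opn_nonneg[OF a] by (intro power_mono)
  then show "(opn a)\<^sup>2 \<le> opn ?aa" using opn_nonneg[OF aa] by simp
qed

lemma opn_zer: "s \<in> Obj A \<Longrightarrow> t \<in> Obj A \<Longrightarrow> opn (zer A s t) = 0"
  using opn_sml[OF zer_fibre, of s t 0] zero_sml[OF zer_fibre, of s t] by simp

text \<open>An operator norm satisfies all axioms by itself except definiteness and completeness;
  these depend on the representation and remain as premises.\<close>

lemma cstar_algebroid_opn:
  assumes nrm: "nrm A = opn"
    and faithful: "\<And>a s t. a \<in> fibre A s t \<Longrightarrow> opn a = 0 \<Longrightarrow> a = zer A s t"
    and complete: "\<And>s t X. s \<in> Obj A \<Longrightarrow> t \<in> Obj A \<Longrightarrow> (\<And>n. X n \<in> fibre A s t) \<Longrightarrow>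
      (\<And>e. e > 0 \<Longrightarrow> \<exists>N. \<forall>m\<ge>N. \<forall>n\<ge>N. opn (asub A (X m) (X n)) < e) \<Longrightarrow>
      \<exists>L\<in>fibre A s t. (\<lambda>n. opn (asub A (X n) L)) \<longlonglongrightarrow> 0"
  shows "cstar_algebroid A"
  unfolding cstar_algebroid_def nrm
proof (intro conjI ballI allI impI)
  fix s t assume s: "s \<in> Obj A" "t \<in> Obj A"
  {
    fix a assume a: "a \<in> fibre A s t"
    show "0 \<le> opn a" by (rule opn_nonneg[OF a])
    show "opn a = 0 \<longleftrightarrow> a = zer A s t" using faithful[OF a] opn_zer[OF s] by auto
    show "opn (sml A c a) = cmod c * opn a" for c by (rule opn_sml[OF a])
    show "opn (add A a b) \<le> opn a + opn b" if "b \<in> fibre A s t" for b by (rule opn_add[OF a that])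
  }
  fix X :: "nat \<Rightarrow> 'a" assume "\<forall>n. X n \<in> fibre A s t" "\<forall>e>0. \<exists>N. \<forall>m\<ge>N. \<forall>n\<ge>N. opn (asub A (X m) (X n)) < e"
  then show "\<exists>L\<in>fibre A s t. (\<lambda>n. opn (asub A (X n) L)) \<longlonglongrightarrow> 0" using complete[OF s] by blast
next
  fix a b assume "a \<in> Carr A" "b \<in> Carr A" "dm A a = cd A b"
  then show "opn (mul A a b) \<le> opn a * opn b" using opn_mul carr_fibre by metis
next
  fix a assume "a \<in> Carr A"
  then show "opn (inv A a) = opn a" "opn (mul A (inv A a) a) = (opn a)\<^sup>2"
    using opn_inv opn_cstar carr_fibre by blast+
qed (fact star)

end

subsection \<open>Amplified representations\<close>

context sip_rep
begin

primrec vsum :: "'s \<Rightarrow> (nat \<Rightarrow> 'v) \<Rightarrow> nat \<Rightarrow> 'v" where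
  "vsum s f 0 = vz s"
| "vsum s f (Suc k) = vadd (vsum s f k) (f k)"

lemma vsum_closed: "s \<in> Obj A \<Longrightarrow> (\<And>k. k < n \<Longrightarrow> f k \<in> V s) \<Longrightarrow> vsum s f n \<in> V s"
proof (induction n)
  case 0 then show ?case using sip.vz_closed[OF sip] by simp
next
  case (Suc n) then show ?case using sip.vadd_closed[OF sip] by simp
qed

lemma ip_vsum: "s \<in> Obj A \<Longrightarrow> (\<And>k. k < n \<Longrightarrow> f k \<in> V s) \<Longrightarrow> w \<in> V s \<Longrightarrow>
    ip (vsum s f n) w = (\<Sum>k<n. ip (f k) w)"
proof (induction n)
  case 0 then show ?case using sip.ip_vz[OF sip] by simp
next
  case (Suc n) then show ?case using sip.ip_add[OF sip] by (simp add: vsum_closed)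
qed

lemma ip_vsum_right: "s \<in> Obj A \<Longrightarrow> (\<And>k. k < n \<Longrightarrow> f k \<in> V s) \<Longrightarrow> w \<in> V s \<Longrightarrow>
    ip w (vsum s f n) = (\<Sum>k<n. ip w (f k))"
proof (induction n)
  case 0 then show ?case using sip.ip_vz_right[OF sip] by simp
next
  case (Suc n) then show ?case using sip.ip_add_right[OF sip] by (simp add: vsum_closed)
qed

lemma vn_vsum: "s \<in> Obj A \<Longrightarrow> (\<And>k. k < n \<Longrightarrow> f k \<in> V s) \<Longrightarrow> vn ip (vsum s f n) \<le> (\<Sum>k<n. vn ip (f k))"
proof (induction n)
  case 0 then show ?case using sip.ip_vz[OF sip] sip.vz_closed[OF sip] by (simp add: vn_def)
next
  case (Suc n)
  have "vn ip (vsum s f (Suc n)) \<le> vn ip (vsum s f n) + vn ip (f n)"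
    using Suc.prems by (simp add: sip.vn_add[OF sip] vsum_closed)
  also have "vn ip (vsum s f n) \<le> (\<Sum>k<n. vn ip (f k))" using Suc by simp
  finally show ?case by simp
qed

lemma act_fsum:
  assumes "s \<in> Obj A" "t \<in> Obj A" "\<And>k. k < n \<Longrightarrow> f k \<in> fibre A s t" "v \<in> V s" "w \<in> V t"
  shows "ip (act (fsum A s t f n) v) w = (\<Sum>k<n. ip (act (f k) v) w)"
  using assms(3)
proof (induction n)
  case 0
  then show ?case using act_sml[OF zer_fibre[OF assms(1,2)] assms(4,5), of 0] assms by (simp add: sml_zer)
next
  case (Suc n)
  then show ?case using assms by (simp add: act_add[OF fsum_fibre])
qed

lemma act_vsum:
  assumes "a \<in> fibre A s t" "\<And>k. k < n \<Longrightarrow> f k \<in> V s" "w \<in> V t"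
  shows "ip (act a (vsum s f n)) w = (\<Sum>k<n. ip (act a (f k)) w)"
  using assms(2)
proof (induction n)
  case 0
  then show ?case using act_vz[OF assms(1,3)] by simp
next
  case (Suc n)
  then show ?case using assms fibre_obj[OF assms(1)] by (simp add: act_vadd[OF assms(1)] vsum_closed)
qed

context
  fixes n :: nat and N :: "(nat \<Rightarrow> nat \<Rightarrow> 'a) \<Rightarrow> real"
  assumes n: "n > 0"
begin

text \<open>The direct sum of the spaces \<open>V (\<sigma> i)\<close> for \<open>i < n\<close>.
  Coordinates from \<open>n\<close> on are unconstrained: \<open>wip\<close> ignores them, so they
  only contribute null vectors.\<close>

definition "W \<sigma> = {w. \<forall>i<n. w i \<in> V (\<sigma> i)}" for \<sigma> :: "nat \<Rightarrow> 's"
definition "wadd w w' = (\<lambda>i. vadd (w i) (w' i))" for w w' :: "nat \<Rightarrow> 'v"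
definition "wsml c w = (\<lambda>i. vsml c (w i))" for w :: "nat \<Rightarrow> 'v"
definition "wz \<sigma> = (\<lambda>i. vz (\<sigma> i))" for \<sigma> :: "nat \<Rightarrow> 's"
definition "wip w w' = (\<Sum>i<n. ip (w i) (w' i))"
definition "wact M w = (\<lambda>i. vsum (cd A (M i 0)) (\<lambda>j. act (M i j) (w j)) n)"

abbreviation "D \<equiv> amp n A N"

lemma sip_amp: assumes "\<sigma> \<in> Obj D" shows "sip (W \<sigma>) wadd wsml (wz \<sigma>) wip"
proof -
  have sp: "sip (V (\<sigma> i)) vadd vsml (vz (\<sigma> i)) ip" if "i < n" for i
    using that assms sip by (simp add: obj_amp)
  show ?thesis
  proof
    fix x y assume xy: "x \<in> W \<sigma>" "y \<in> W \<sigma>"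
    show "wip x y = cnj (wip y x)"
      unfolding wip_def cnj_sum
      by (intro sum.cong refl sip.ip_sym[OF sp]) (use xy in \<open>auto simp: W_def\<close>)
    fix z assume "z \<in> W \<sigma>"
    then show "wip (wadd x y) z = wip x z + wip y z"
      unfolding wip_def wadd_def sum.distrib[symmetric]
      by (intro sum.cong refl sip.ip_add[OF sp]) (use xy in \<open>auto simp: W_def\<close>)
  next
    fix c x y assume xy: "x \<in> W \<sigma>" "y \<in> W \<sigma>"
    show "wip (wsml c x) y = c * wip x y"
      unfolding wip_def wsml_def sum_distrib_left
      by (intro sum.cong refl sip.ip_sml[OF sp]) (use xy in \<open>auto simp: W_def\<close>)
  next
    fix x assume "x \<in> W \<sigma>"
    then show "0 \<le> Re (wip x x)" "wip (wz \<sigma>) x = 0"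
      by (auto simp: wip_def wz_def W_def intro!: sum_nonneg sum.neutral sip.ip_nonneg[OF sp] sip.ip_vz[OF sp])
  qed (auto simp: W_def wadd_def wsml_def wz_def sip.vz_closed[OF sp] sip.vadd_closed[OF sp] sip.vsml_closed[OF sp])
qed

lemma wact_entry:
  assumes M: "M \<in> fibre D \<sigma> \<tau>" and i: "i < n"
  shows "wact M w i = vsum (\<tau> i) (\<lambda>j. act (M i j) (w j)) n"
  using fibreD[OF amp_entry[OF n M i n]] by (simp add: wact_def)

lemma act_entry_closed: "M \<in> fibre D \<sigma> \<tau> \<Longrightarrow> w \<in> W \<sigma> \<Longrightarrow> i < n \<Longrightarrow> j < n \<Longrightarrow> act (M i j) (w j) \<in> V (\<tau> i)"
  using act_closed[OF amp_entry[OF n]] by (simp add: W_def)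

lemma wact_closed: assumes M: "M \<in> fibre D \<sigma> \<tau>" and w: "w \<in> W \<sigma>" shows "wact M w \<in> W \<tau>"
  unfolding W_def using amp_obj'[OF n M] act_entry_closed[OF M w]
  by (auto simp: wact_entry[OF M] intro!: vsum_closed)

lemma ip_wact:
  assumes M: "M \<in> fibre D \<sigma> \<tau>" and w: "w \<in> W \<sigma>" and i: "i < n" and u: "u \<in> V (\<tau> i)"
  shows "ip (wact M w i) u = (\<Sum>j<n. ip (act (M i j) (w j)) u)"
  unfolding wact_entry[OF M i] using amp_obj'[OF n M i] act_entry_closed[OF M w i] u
  by (intro ip_vsum) auto

lemma wip_wact:
  assumes M: "M \<in> fibre D \<sigma> \<tau>" and w: "w \<in> W \<sigma>" and u: "u \<in> W \<tau>"
  shows "wip (wact M w) u = (\<Sum>i<n. \<Sum>j<n. ip (act (M i j) (w j)) (u i))"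
  unfolding wip_def using u by (intro sum.cong refl ip_wact[OF M w]) (auto simp: W_def)

lemma vn_le_wvn: assumes "\<sigma> \<in> Obj D" "w \<in> W \<sigma>" "i < n" shows "vn ip (w i) \<le> vn wip w"
proof -
  have "Re (ip (w j) (w j)) \<ge> 0" if "j < n" for j
    using sip.ip_nonneg[OF sip] assms that by (auto simp: W_def obj_amp)
  then have "Re (ip (w i) (w i)) \<le> (\<Sum>j<n. Re (ip (w j) (w j)))"
    using assms(3) by (intro member_le_sum[of i "{..<n}" "\<lambda>j. Re (ip (w j) (w j))"]) auto
  then show ?thesis by (simp add: vn_def wip_def)
qed

lemma wvn_le_sum: assumes "\<sigma> \<in> Obj D" "w \<in> W \<sigma>" shows "vn wip w \<le> (\<Sum>i<n. vn ip (w i))"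
proof -
  have nn: "0 \<le> vn ip (w j)" if "j < n" for j
    using sip.vn_nonneg[OF sip] assms that by (auto simp: W_def obj_amp)
  have "Re (wip w w) = (\<Sum>i<n. (vn ip (w i))\<^sup>2)"
    unfolding wip_def Re_sum using sip.vn_sq[OF sip] assms by (intro sum.cong refl) (auto simp: W_def obj_amp)
  also have "\<dots> \<le> (\<Sum>i<n. vn ip (w i) * (\<Sum>j<n. vn ip (w j)))"
    using nn by (intro sum_mono) (auto simp: power2_eq_square intro!: mult_left_mono member_le_sum)
  also have "\<dots> = (\<Sum>i<n. vn ip (w i))\<^sup>2" by (simp add: power2_eq_square sum_distrib_right)
  finally have "Re (wip w w) \<le> (\<Sum>i<n. vn ip (w i))\<^sup>2" .
  then show ?thesis unfolding vn_def[of wip] using nn by (intro real_le_lsqrt sum_nonneg) auto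
qed

text \<open>A crude estimate by the sum of the entry norms. It suffices for boundedness, and it is
  sharp on matrices with a single nonzero entry.\<close>

lemma wact_bound:
  assumes M: "M \<in> fibre D \<sigma> \<tau>" and w: "w \<in> W \<sigma>"
  shows "vn wip (wact M w) \<le> (\<Sum>i<n. \<Sum>j<n. opn (M i j)) * vn wip w"
proof -
  have "vn wip (wact M w) \<le> (\<Sum>i<n. vn ip (wact M w i))"
    using wvn_le_sum[OF amp_fibre_obj(2)[OF n M] wact_closed[OF M w]] .
  also have "\<dots> \<le> (\<Sum>i<n. \<Sum>j<n. vn ip (act (M i j) (w j)))"
    using amp_obj'[OF n M] act_entry_closed[OF M w]
    by (intro sum_mono) (auto simp: wact_entry[OF M] intro!: vn_vsum)
  also have "\<dots> \<le> (\<Sum>i<n. \<Sum>j<n. opn (M i j) * vn wip w)"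
  proof (intro sum_mono)
    fix i j assume ij: "i \<in> {..<n}" "j \<in> {..<n}"
    then have e: "M i j \<in> fibre A (\<sigma> j) (\<tau> i)" "w j \<in> V (\<sigma> j)" using amp_entry[OF n M] w by (auto simp: W_def)
    have "vn ip (act (M i j) (w j)) \<le> opn (M i j) * vn ip (w j)" by (rule opn_bound[OF e])
    also have "\<dots> \<le> opn (M i j) * vn wip w"
      using vn_le_wvn[OF amp_fibre_obj(1)[OF n M] w] opn_nonneg[OF e(1)] ij by (intro mult_left_mono) auto
    finally show "vn ip (act (M i j) (w j)) \<le> opn (M i j) * vn wip w" .
  qed
  finally show ?thesis by (simp add: sum_distrib_right)
qed

lemma sip_rep_amp: "sip_rep D W wadd wsml wz wip wact"
proof
  show "star_algebroid D" by (rule star_algebroid_amp[OF n])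
next
  fix a b \<sigma> \<tau> v w assume a: "a \<in> fibre D \<sigma> \<tau>" and b: "b \<in> fibre D \<sigma> \<tau>" and v: "v \<in> W \<sigma>" and w: "w \<in> W \<tau>"
  show "wip (wact (add D a b) v) w = wip (wact a v) w + wip (wact b v) w"
    unfolding wip_wact[OF a v w] wip_wact[OF b v w] wip_wact[OF amp_add_fibre[OF n a b] v w] sum.distrib[symmetric]
    using v w by (intro sum.cong refl)
      (auto simp: amp_ops[OF n] W_def intro!: act_add[OF amp_entry[OF n a] amp_entry[OF n b]])
next
  fix a c \<sigma> \<tau> v w assume a: "a \<in> fibre D \<sigma> \<tau>" and v: "v \<in> W \<sigma>" and w: "w \<in> W \<tau>"
  show "wip (wact (sml D c a) v) w = c * wip (wact a v) w"
    unfolding wip_wact[OF a v w] wip_wact[OF amp_sml_fibre[OF n a] v w] sum_distrib_left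
    using v w by (intro sum.cong refl)
      (auto simp: amp_ops[OF n] W_def intro!: act_sml[OF amp_entry[OF n a]])
next
  fix a b \<sigma> \<rho> \<tau> v w assume a: "a \<in> fibre D \<rho> \<tau>" and b: "b \<in> fibre D \<sigma> \<rho>" and v: "v \<in> W \<sigma>" and w: "w \<in> W \<tau>"
  have "ip (act (mul D a b i j) (v j)) (w i) = (\<Sum>k<n. ip (act (a i k) (act (b k j) (v j))) (w i))"
    if ij: "i < n" "j < n" for i j
  proof -
    have vw: "v j \<in> V (\<sigma> j)" "w i \<in> V (\<tau> i)" using v w ij by (auto simp: W_def)
    have "ip (act (mul D a b i j) (v j)) (w i) = (\<Sum>k<n. ip (act (mul A (a i k) (b k j)) (v j)) (w i))"
      unfolding amp_mul_entry[OF n a b ij]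
      using vw ij amp_obj[OF n b] amp_obj'[OF n a] by (intro act_fsum amp_prod_fibre[OF n a b]) auto
    also have "\<dots> = (\<Sum>k<n. ip (act (a i k) (act (b k j) (v j))) (w i))"
      using vw ij by (intro sum.cong refl act_mul[OF amp_entry[OF n a] amp_entry[OF n b]]) auto
    finally show ?thesis .
  qed
  then have "wip (wact (mul D a b) v) w = (\<Sum>i<n. \<Sum>j<n. \<Sum>k<n. ip (act (a i k) (act (b k j) (v j))) (w i))"
    unfolding wip_wact[OF amp_mul_fibre[OF n a b] v w] by (intro sum.cong refl) auto
  also have "\<dots> = (\<Sum>i<n. \<Sum>k<n. \<Sum>j<n. ip (act (a i k) (act (b k j) (v j))) (w i))"
    by (intro sum.cong refl sum.swap)
  also have "\<dots> = (\<Sum>i<n. \<Sum>k<n. ip (act (a i k) (wact b v k)) (w i))"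
    using w act_entry_closed[OF b v]
    by (intro sum.cong refl) (auto simp: wact_entry[OF b] W_def intro!: act_vsum[OF amp_entry[OF n a], symmetric])
  also have "\<dots> = wip (wact a (wact b v)) w" by (rule wip_wact[OF a wact_closed[OF b v] w, symmetric])
  finally show "wip (wact (mul D a b) v) w = wip (wact a (wact b v)) w" .
next
  fix a \<sigma> \<tau> v w assume a: "a \<in> fibre D \<sigma> \<tau>" and v: "v \<in> W \<sigma>" and w: "w \<in> W \<tau>"
  have "wip (wact (inv D a) w) v = (\<Sum>i<n. \<Sum>j<n. ip (w j) (act (a j i) (v i)))"
    unfolding wip_wact[OF amp_inv_fibre[OF n a] w v]
    using v w by (intro sum.cong refl) (auto simp: amp_ops[OF n] W_def intro!: act_inv[OF amp_entry[OF n a]])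
  also have "\<dots> = (\<Sum>j<n. \<Sum>i<n. ip (w j) (act (a j i) (v i)))" by (rule sum.swap)
  also have "\<dots> = wip w (wact a v)"
    unfolding wip_def using w amp_obj'[OF n a] act_entry_closed[OF a v]
    by (intro sum.cong refl) (auto simp: wact_entry[OF a] W_def intro!: ip_vsum_right[symmetric])
  finally show "wip (wact (inv D a) w) v = wip w (wact a v)" .
next
  fix a \<sigma> \<tau> assume "a \<in> fibre D \<sigma> \<tau>"
  then show "\<exists>K. \<forall>v\<in>W \<sigma>. vn wip (wact a v) \<le> K * vn wip v" using wact_bound by blast
qed (rule sip.vz_closed[OF sip_amp] sip.vadd_closed[OF sip_amp] sip.vsml_closed[OF sip_amp] sip.ip_vz[OF sip_amp]
    sip.ip_add[OF sip_amp] sip.ip_sml[OF sip_amp] sip.ip_sym[OF sip_amp] sip.ip_nonneg[OF sip_amp] wact_closed; assumption)+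

interpretation R: sip_rep D W wadd wsml wz wip wact by (rule sip_rep_amp)

lemma R_opn_le: assumes M: "M \<in> fibre D \<sigma> \<tau>" shows "R.opn M \<le> (\<Sum>i<n. \<Sum>j<n. opn (M i j))"
  using wact_bound[OF M] opn_nonneg[OF amp_entry[OF n M]] by (intro R.opn_le[OF M] sum_nonneg) auto

text \<open>Test the matrix on the vector with \<open>v\<close> in coordinate \<open>j\<close> and
  zero elsewhere, and keep only coordinate \<open>i\<close> of the image.\<close>

lemma opn_entry_le: assumes M: "M \<in> fibre D \<sigma> \<tau>" and ij: "i < n" "j < n" shows "opn (M i j) \<le> R.opn M"
proof (rule opn_le[OF amp_entry[OF n M ij] R.opn_nonneg[OF M]])
  fix v assume v: "v \<in> V (\<sigma> j)"
  define w where "w k = (if k = j then v else vz (\<sigma> k))" for k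
  have \<sigma>: "\<And>k. k < n \<Longrightarrow> \<sigma> k \<in> Obj A" and \<tau>: "\<tau> i \<in> Obj A" using amp_obj[OF n M] amp_obj'[OF n M] ij by auto
  have w: "w \<in> W \<sigma>" using v sip.vz_closed[OF sip[OF \<sigma>]] by (auto simp: W_def w_def)
  have wa: "wact M w i \<in> V (\<tau> i)" using wact_closed[OF M w] ij by (simp add: W_def)
  have "vn ip (act (M i j) v) = vn ip (wact M w i)"
  proof (rule sip.vn_cong[OF sip[OF \<tau>] act_closed[OF amp_entry[OF n M ij] v] wa])
    fix u assume u: "u \<in> V (\<tau> i)"
    have "ip (wact M w i) u = (\<Sum>k<n. if k = j then ip (act (M i j) v) u else 0)"
      unfolding ip_wact[OF M w ij(1) u] using ij
      by (intro sum.cong refl) (auto simp: w_def act_vz[OF amp_entry[OF n M] u])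
    then show "ip (act (M i j) v) u = ip (wact M w i) u" using ij by simp
  qed
  also have "\<dots> \<le> vn wip (wact M w)" by (rule vn_le_wvn[OF amp_fibre_obj(2)[OF n M] wact_closed[OF M w] ij(1)])
  also have "\<dots> \<le> R.opn M * vn wip w" by (rule R.opn_bound[OF M w])
  also have "vn wip w = vn ip v"
  proof -
    have "wip w w = (\<Sum>k<n. if k = j then ip v v else 0)"
      unfolding wip_def by (intro sum.cong refl)
        (auto simp: w_def sip.ip_vz[OF sip[OF \<sigma>]] sip.vz_closed[OF sip[OF \<sigma>]])
    then show ?thesis using ij by (simp add: vn_def)
  qed
  finally show "vn ip (act (M i j) v) \<le> R.opn M * vn ip v" .
qed

end

end

section \<open>C*-norms on the amplifications\<close>

locale isometric_sip_rep = cstaralg A + sip_rep A V vadd vsml vz ip act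
  for A :: "('a, 's, 'z) alg_scheme" and V vadd vsml vz ip and act :: "'a \<Rightarrow> 'v \<Rightarrow> 'v" +
  assumes isometric: "\<And>a s t. a \<in> fibre A s t \<Longrightarrow> opn a = nrm A a"
begin

text \<open>The operator norm of a matrix lies between each entry norm and the sum of all entry
  norms. On single-entry matrices the two bounds coincide, so the norms of \<open>A\<close> are
  extended; in general they reduce definiteness and completeness to the entries.\<close>

lemma amp_norm_exists:
  assumes n: "n > 0"
  shows "\<exists>N. extends_norms n A N \<and> cstar_algebroid (amp n A N)"
proof -
  \<comment> \<open>\<open>amp\<close> takes the norm as an argument, whereas the operator norm is
    computed from an amplification. The zero norm breaks the circle, and \<open>RR\<close> shows
    that the norm field has no influence on the result.\<close>
  define R where "R = sip_rep.opn (amp n A (\<lambda>_. 0)) (W n) (wip n) (wact n)"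
  let ?C = "amp n A R"
  interpret R: sip_rep ?C "W n" wadd wsml wz "wip n" "wact n" by (rule sip_rep_amp[OF n])
  have RR: "R = R.opn"
    unfolding R_def R.opn_def sip_rep.opn_def[OF sip_rep_amp[OF n]] by (simp add: amp_def)

  note le = R_opn_le[OF n, where N=R, folded RR]
  note ge = opn_entry_le[OF n, where N=R, folded RR]
  have "extends_norms n A R"
    unfolding extends_norms_def
  proof (intro ballI allI impI)
    fix \<sigma> \<tau> i j a assume \<sigma>: "\<sigma> \<in> Obj ?C" and \<tau>: "\<tau> \<in> Obj ?C" and ij: "i < n" "j < n"
      and a: "a \<in> fibre A (\<sigma> j) (\<tau> i)"
    let ?M = "single_entry n A \<sigma> \<tau> i j a"
    have M: "?M \<in> fibre ?C \<sigma> \<tau>" by (rule single_entry_fibre[OF n \<sigma> \<tau> a])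
    have "R ?M \<le> (\<Sum>k<n. \<Sum>l<n. opn (?M k l))" by (rule le[OF M])
    also have "\<dots> = (\<Sum>k<n. \<Sum>l<n. if k = i \<and> l = j then opn a else 0)"
      using \<sigma> \<tau> by (intro sum.cong refl) (auto simp: single_entry_def opn_zer obj_amp)
    also have "\<dots> = (\<Sum>k<n. if k = i then opn a else 0)"
      using ij by (intro sum.cong refl) auto
    also have "\<dots> = opn a" using ij by simp
    finally have "R ?M \<le> opn a" .
    moreover have "opn a \<le> R ?M" using ge[OF M ij] ij by (simp add: single_entry_def)
    ultimately show "R ?M = nrm A a" using isometric[OF a] by simp
  qed
  moreover have "cstar_algebroid ?C"
  proof (rule R.cstar_algebroid_opn)
    show "nrm ?C = R.opn" using RR by (simp add: amp_def)
  next
    fix M \<sigma> \<tau> assume M: "M \<in> fibre ?C \<sigma> \<tau>" and 0: "R.opn M = 0"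
    show "M = zer ?C \<sigma> \<tau>"
    proof (rule amp_eqI[OF n M amp_zer_fibre[OF n amp_fibre_obj[OF n M]]])
      fix i j assume ij: "i < n" "j < n"
      note e = amp_entry[OF n M ij]
      have "nrm A (M i j) = 0"
        using ge[OF M ij] 0 RR isometric[OF e] nrm_nonneg[OF e] by simp
      then show "M i j = zer ?C \<sigma> \<tau> i j" using nrm_eq_0[OF e] ij by (simp add: amp_ops[OF n])
    qed
  next
    fix \<sigma> \<tau> and X :: "nat \<Rightarrow> nat \<Rightarrow> nat \<Rightarrow> 'a"
    assume \<sigma>: "\<sigma> \<in> Obj ?C" and \<tau>: "\<tau> \<in> Obj ?C" and X: "\<And>k. X k \<in> fibre ?C \<sigma> \<tau>"
      and Cau: "\<And>e. e > 0 \<Longrightarrow> \<exists>K. \<forall>m\<ge>K. \<forall>k\<ge>K. R.opn (asub ?C (X m) (X k)) < e"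
    have sub: "asub ?C M M' \<in> fibre ?C \<sigma> \<tau>" "i < n \<Longrightarrow> j < n \<Longrightarrow> asub ?C M M' i j = asub A (M i j) (M' i j)"
      if "M \<in> fibre ?C \<sigma> \<tau>" "M' \<in> fibre ?C \<sigma> \<tau>" for M M' i j
      using that by (simp_all add: asub_def amp_add_fibre[OF n] amp_sml_fibre[OF n] amp_ops[OF n])
    have "\<exists>L\<in>fibre A (\<sigma> j) (\<tau> i). (\<lambda>k. nrm A (asub A (X k i j) L)) \<longlonglongrightarrow> 0" if ij: "i < n" "j < n" for i j
    proof (rule nrm_complete)
      show "\<sigma> j \<in> Obj A" "\<tau> i \<in> Obj A" using \<sigma> \<tau> ij by (auto simp: obj_amp)
      show "X k i j \<in> fibre A (\<sigma> j) (\<tau> i)" for k using amp_entry[OF n X ij] .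
      fix e :: real assume "e > 0"
      then obtain K where K: "\<And>m k. m \<ge> K \<Longrightarrow> k \<ge> K \<Longrightarrow> R.opn (asub ?C (X m) (X k)) < e" using Cau by blast
      have "nrm A (asub A (X m i j) (X k i j)) \<le> R.opn (asub ?C (X m) (X k))" for m k
        using ge[OF sub(1)[OF X X] ij] isometric[OF amp_entry[OF n sub(1)[OF X X] ij]] RR sub(2)[OF X X ij] by simp
      then show "\<exists>K. \<forall>m\<ge>K. \<forall>k\<ge>K. nrm A (asub A (X m i j) (X k i j)) < e" using K by (meson le_less_trans)
    qed
    then obtain L where L: "\<And>i j. i < n \<Longrightarrow> j < n \<Longrightarrow> L i j \<in> fibre A (\<sigma> j) (\<tau> i)"
      "\<And>i j. i < n \<Longrightarrow> j < n \<Longrightarrow> (\<lambda>k. nrm A (asub A (X k i j) (L i j))) \<longlonglongrightarrow> 0" by metis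
    define L' where "L' i j = (if i < n \<and> j < n then L i j else undefined)" for i j
    have L': "L' \<in> fibre ?C \<sigma> \<tau>" using \<sigma> \<tau> L(1) by (intro amp_fibreI[OF n]) (auto simp: L'_def)
    have "(\<lambda>k. R.opn (asub ?C (X k) L')) \<longlonglongrightarrow> 0"
    proof (rule tendsto_sandwich[of "\<lambda>_. 0"])
      show "\<forall>\<^sub>F k in sequentially. 0 \<le> R.opn (asub ?C (X k) L')"
        using R.opn_nonneg[OF sub(1)[OF X L']] by simp
      have "R.opn (asub ?C (X k) L') \<le> (\<Sum>i<n. \<Sum>j<n. nrm A (asub A (X k i j) (L i j)))" for k
      proof -
        have "R.opn (asub ?C (X k) L') \<le> (\<Sum>i<n. \<Sum>j<n. opn (asub ?C (X k) L' i j))"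
          using le[OF sub(1)[OF X L']] RR by simp
        also have "\<dots> = (\<Sum>i<n. \<Sum>j<n. nrm A (asub A (X k i j) (L i j)))"
          using sub(2)[OF X L'] isometric[OF amp_entry[OF n sub(1)[OF X L']]]
          by (intro sum.cong refl) (auto simp: L'_def)
        finally show ?thesis .
      qed
      then show "\<forall>\<^sub>F k in sequentially. R.opn (asub ?C (X k) L') \<le> (\<Sum>i<n. \<Sum>j<n. nrm A (asub A (X k i j) (L i j)))"
        by simp
      show "(\<lambda>k. \<Sum>i<n. \<Sum>j<n. nrm A (asub A (X k i j) (L i j))) \<longlonglongrightarrow> 0"
        using L(2) by (intro tendsto_null_sum) auto
    qed simp
    then show "\<exists>L\<in>fibre ?C \<sigma> \<tau>. (\<lambda>k. R.opn (asub ?C (X k) L)) \<longlonglongrightarrow> 0" using L' by blast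
  qed
  ultimately show ?thesis by blast
qed

end


section \<open>The universal representation\<close>

context cstaralg
begin

text \<open>The value at the unit is only bounded by 1: in a zero fibre the unit is the zero element
  and no functional takes the value 1 there. Quantifying over units avoids fixing one.\<close>

definition state :: "'s \<Rightarrow> ('a \<Rightarrow> complex) \<Rightarrow> bool" where
  "state s \<phi> \<longleftrightarrow> (\<forall>x\<in>fibre A s s. \<forall>y\<in>fibre A s s. \<phi> (add A x y) = \<phi> x + \<phi> y) \<and>
     (\<forall>c. \<forall>x\<in>fibre A s s. \<phi> (sml A c x) = c * \<phi> x) \<and>
     (\<forall>x\<in>fibre A s s. \<phi> (inv A x) = cnj (\<phi> x)) \<and>
     (\<forall>y. posel A s y \<longrightarrow> 0 \<le> Re (\<phi> y)) \<and> (\<forall>e. unit_at A s e \<longrightarrow> Re (\<phi> e) \<le> 1)"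

lemma unit_at_unique: assumes "unit_at A s e" "unit_at A s e'" shows "e = e'"
proof -
  have "e \<in> Carr A" "e' \<in> Carr A" "dm A e = s" "cd A e' = s" using assms by (auto simp: unit_at_def fibre_def)
  then have "mul A e e' = e'" "mul A e e' = e" using assms unfolding unit_at_def by blast+
  then show ?thesis by simp
qed

lemma norming_state_exists:
  assumes e: "unit_at A s e" and sp: "star_positive A" and a: "a \<in> fibre A s t"
  shows "\<exists>\<phi>. state s \<phi> \<and> \<phi> (mul A (inv A a) a) = complex_of_real ((nrm A a)\<^sup>2)"
proof -
  interpret U: ucalg "fibre A s s" "add A" "sml A" "zer A s s" "mul A" "inv A" "nrm A" e
    by (rule ucalg_fibre[OF e])
  have "posel A s (mul A (inv A a) a)" using sp a fibre_obj[OF a] by (auto simp: star_positive_def)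
  then have h: "U.pos (mul A (inv A a) a)" by (simp add: posel_eq_pos[OF e])
  obtain \<phi> where \<phi>: "\<phi> \<in> U.lf" "\<And>y. U.pos y \<Longrightarrow> 0 \<le> Re (U.ap \<phi> y)"
    "\<And>y. y \<in> fibre A s s \<Longrightarrow> U.ap \<phi> (inv A y) = cnj (U.ap \<phi> y)" "Re (U.ap \<phi> e) \<le> 1"
    "U.ap \<phi> (mul A (inv A a) a) = complex_of_real (nrm A (mul A (inv A a) a))"
    using U.state_exists[OF h] by metis
  have "state s \<phi>"
    using \<phi> unit_at_unique[OF e] U.ap_simps[OF \<phi>(1)]
    by (auto simp: state_def posel_eq_pos[OF e] U.ap_def)
  then show ?thesis using \<phi>(5) nrm_cstar[OF a] by (auto simp: U.ap_def)
qed

text \<open>Write \<open>||x||^2 - x* x = c^2\<close> with \<open>c\<close> self-adjoint in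
  \<open>A s s\<close>. Then \<open>||x||^2 b* b - (x b)* (x b) = (c b)* (c b)\<close>, which is
  positive by \<open>star_positive\<close> for the arrow \<open>c b\<close> from \<open>u\<close> to
  \<open>s\<close>.\<close>

lemma state_contraction:
  assumes e: "unit_at A s e" and sp: "star_positive A" and \<phi>: "state u \<phi>"
    and x: "x \<in> fibre A s t" and b: "b \<in> fibre A u s"
  shows "Re (\<phi> (mul A (inv A (mul A x b)) (mul A x b))) \<le> (nrm A x)\<^sup>2 * Re (\<phi> (mul A (inv A b) b))"
proof -
  interpret U: ucalg "fibre A s s" "add A" "sml A" "zer A s s" "mul A" "inv A" "nrm A" e
    by (rule ucalg_fibre[OF e])
  let ?y = "mul A (inv A x) x" and ?t = "(nrm A x)\<^sup>2"
  have ix: "inv A x \<in> fibre A t s" and ib: "inv A b \<in> fibre A s u" using inv_fibre x b by auto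
  have y: "?y \<in> fibre A s s" using mul_fibre[OF ix x] .
  have "U.pos (U.mi (U.sc ?t) ?y)"
    using y nrm_cstar[OF x] inv_mul[OF ix x] inv_inv[OF x] by (intro U.pos_scalar_minus) auto
  then obtain c where c: "c \<in> fibre A s s" "inv A c = c" and cc: "U.mi (U.sc ?t) ?y = mul A c c"
    by (auto simp: U.pos_def)
  have cb: "mul A c b \<in> fibre A u s" using mul_fibre[OF c(1) b] .
  have yb: "mul A ?y b \<in> fibre A u s" using mul_fibre[OF y b] .
  have bb: "mul A (inv A b) b \<in> fibre A u u" using mul_fibre[OF ib b] .
  have eb: "mul A e b = b" using e b by (simp add: unit_at_def fibre_def)
  have xb: "mul A (inv A (mul A x b)) (mul A x b) = mul A (inv A b) (mul A ?y b)"
    using mul_assoc[OF ib ix mul_fibre[OF x b]] mul_assoc[OF ix x b] by (simp add: inv_mul[OF x b])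
  have byb: "mul A (inv A b) (mul A ?y b) \<in> fibre A u u" using mul_fibre[OF ib yb] .
  have "mul A (inv A (mul A c b)) (mul A c b) = mul A (inv A b) (mul A (mul A c c) b)"
    using mul_assoc[OF ib c(1) cb] mul_assoc[OF c(1) c(1) b] by (simp add: inv_mul[OF c(1) b] c(2))
  also have "mul A (mul A c c) b = add A (sml A (complex_of_real ?t) b) (sml A (-1) (mul A ?y b))"
    unfolding cc[symmetric] using y b
    by (simp add: bilinear(1)[of _ s s b u] bilinear(3)[of _ s s b u] eb)
  also have "mul A (inv A b) \<dots> = add A (sml A (complex_of_real ?t) (mul A (inv A b) b))
      (sml A (-1) (mul A (inv A b) (mul A ?y b)))"
    using b yb by (simp add: bilinear(2)[OF ib, of _ u] bilinear(4)[OF ib, of _ u] sml_fibre)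
  finally have eq: "mul A (inv A (mul A c b)) (mul A c b) = add A (sml A (complex_of_real ?t) (mul A (inv A b) b))
      (sml A (-1) (mul A (inv A b) (mul A ?y b)))" .
  have "posel A u (mul A (inv A (mul A c b)) (mul A c b))"
    using sp cb fibre_obj[OF cb] unfolding star_positive_def by blast
  then have "0 \<le> Re (\<phi> (mul A (inv A (mul A c b)) (mul A c b)))" using \<phi> by (simp add: state_def)
  also have "\<phi> (mul A (inv A (mul A c b)) (mul A c b))
      = complex_of_real ?t * \<phi> (mul A (inv A b) b) - \<phi> (mul A (inv A b) (mul A ?y b))"
    unfolding eq using \<phi> bb byb by (simp add: state_def sml_fibre)
  finally show ?thesis unfolding xb by simp
qed

end

text \<open>Vectors over the object \<open>s\<close> are finitely supported sections \<open>v\<close> with \<open>v a\<close> in the fibre from \<open>dm a\<close> to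
  \<open>s\<close>; the component at \<open>a\<close> is the GNS pre-Hilbert space of a state \<open>f a\<close> that attains the norm of \<open>a\<close>.\<close>
locale section_rep = cstaralg A for A :: "('a, 's, 'z) alg_scheme" +
  fixes \<epsilon> :: "'s \<Rightarrow> 'a" and f :: "'a \<Rightarrow> 'a \<Rightarrow> complex"
  assumes unit: "\<And>s. s \<in> Obj A \<Longrightarrow> unit_at A s (\<epsilon> s)"
    and sp: "star_positive A"
    and f_state: "\<And>a. a \<in> Carr A \<Longrightarrow> state (dm A a) (f a)"
    and f_norming: "\<And>a. a \<in> Carr A \<Longrightarrow> f a (mul A (inv A a) a) = complex_of_real ((nrm A a)\<^sup>2)"
begin

definition supp :: "'s \<Rightarrow> ('a \<Rightarrow> 'a) \<Rightarrow> 'a set" where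
  "supp s v = {a \<in> Carr A. v a \<noteq> zer A (dm A a) s}"

definition Sec :: "'s \<Rightarrow> ('a \<Rightarrow> 'a) set" where
  "Sec s = {v. (\<forall>a\<in>Carr A. v a \<in> fibre A (dm A a) s) \<and> finite (supp s v)}"

definition sadd :: "('a \<Rightarrow> 'a) \<Rightarrow> ('a \<Rightarrow> 'a) \<Rightarrow> 'a \<Rightarrow> 'a" where "sadd v w = (\<lambda>a. add A (v a) (w a))"
definition ssml :: "complex \<Rightarrow> ('a \<Rightarrow> 'a) \<Rightarrow> 'a \<Rightarrow> 'a" where "ssml c v = (\<lambda>a. sml A c (v a))"
definition sz :: "'s \<Rightarrow> 'a \<Rightarrow> 'a" where "sz s = (\<lambda>a. zer A (dm A a) s)"
definition sact :: "'a \<Rightarrow> ('a \<Rightarrow> 'a) \<Rightarrow> 'a \<Rightarrow> 'a" where "sact x v = (\<lambda>a. mul A x (v a))"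

definition trm :: "('a \<Rightarrow> 'a) \<Rightarrow> ('a \<Rightarrow> 'a) \<Rightarrow> 'a \<Rightarrow> complex" where
  "trm v w a = f a (mul A (inv A (w a)) (v a))"

text \<open>Summing over the nonzero terms keeps the object out of the definition, because
  \<open>sip_rep\<close> has one \<open>ip\<close> for all spaces. For sections these terms lie in
  the finite support, and \<open>sip_eq\<close> allows any finite set containing it.\<close>

definition ips :: "('a \<Rightarrow> 'a) \<Rightarrow> ('a \<Rightarrow> 'a) \<Rightarrow> complex" where
  "ips v w = (\<Sum>a\<in>{a \<in> Carr A. trm v w a \<noteq> 0}. trm v w a)"

lemma f_zer: "a \<in> Carr A \<Longrightarrow> f a (zer A (dm A a) (dm A a)) = 0"
  using f_state[of a] zer_fibre[OF dm_obj dm_obj, of a a] sml_zer[OF dm_obj dm_obj, of a a 0]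
  unfolding state_def by (metis mult_zero_left)

lemma f_simps:
  assumes "a \<in> Carr A" "x \<in> fibre A (dm A a) (dm A a)"
  shows "y \<in> fibre A (dm A a) (dm A a) \<Longrightarrow> f a (add A x y) = f a x + f a y"
    "f a (sml A c x) = c * f a x" "f a (inv A x) = cnj (f a x)"
  using f_state[OF assms(1)] assms(2) by (auto simp: state_def)

lemma Sec_fibre: "v \<in> Sec s \<Longrightarrow> a \<in> Carr A \<Longrightarrow> v a \<in> fibre A (dm A a) s"
  and Sec_finite: "v \<in> Sec s \<Longrightarrow> finite (supp s v)"
  by (auto simp: Sec_def)

lemma supp_Carr: "supp s v \<subseteq> Carr A" by (auto simp: supp_def)

lemma term_zero:
  assumes "v \<in> Sec s" "w \<in> Sec s" "a \<in> Carr A" "a \<notin> supp s v" shows "trm v w a = 0"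
proof -
  have "v a = zer A (dm A a) s" using assms by (simp add: supp_def)
  then show ?thesis
    using mul_zer[OF inv_fibre[OF Sec_fibre[OF assms(2,3)]] dm_obj[OF assms(3)]] f_zer[OF assms(3)]
    by (simp add: trm_def)
qed

lemma sip_eq:
  assumes "v \<in> Sec s" "w \<in> Sec s" "finite F" "supp s v \<subseteq> F" "F \<subseteq> Carr A"
  shows "ips v w = (\<Sum>a\<in>F. trm v w a)"
  unfolding ips_def using assms term_zero[OF assms(1,2)] by (intro sum.mono_neutral_left) auto

lemma Sec_mono:
  assumes "v \<in> Sec s" "\<And>a. a \<in> Carr A \<Longrightarrow> v' a \<in> fibre A (dm A a) t" "supp t v' \<subseteq> supp s v"
  shows "v' \<in> Sec t"
  using assms finite_subset[OF assms(3)] by (auto simp: Sec_def)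

lemma sadd_supp: assumes "s \<in> Obj A" "v \<in> Sec s" "w \<in> Sec s" shows "supp s (sadd v w) \<subseteq> supp s v \<union> supp s w"
  using assms by (auto simp: supp_def sadd_def zer_add zer_fibre dm_obj)

lemma sadd_closed: assumes "s \<in> Obj A" "v \<in> Sec s" "w \<in> Sec s" shows "sadd v w \<in> Sec s"
proof -
  have "finite (supp s (sadd v w))"
    using finite_subset[OF sadd_supp[OF assms]] Sec_finite assms by blast
  then show ?thesis
    using add_fibre[OF Sec_fibre[OF assms(2)] Sec_fibre[OF assms(3)]] by (simp add: Sec_def sadd_def)
qed

lemma ssml_supp: "s \<in> Obj A \<Longrightarrow> supp s (ssml c v) \<subseteq> supp s v"
  by (auto simp: supp_def ssml_def sml_zer dm_obj)

lemma ssml_closed: "s \<in> Obj A \<Longrightarrow> v \<in> Sec s \<Longrightarrow> ssml c v \<in> Sec s"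
  by (rule Sec_mono[OF _ _ ssml_supp]) (auto simp: ssml_def intro!: sml_fibre Sec_fibre)

lemma sact_supp: "x \<in> fibre A s t \<Longrightarrow> supp t (sact x v) \<subseteq> supp s v"
  by (auto simp: supp_def sact_def mul_zer dm_obj)

lemma sact_closed: "x \<in> fibre A s t \<Longrightarrow> v \<in> Sec s \<Longrightarrow> sact x v \<in> Sec t"
  using mul_fibre[OF _ Sec_fibre] by (intro Sec_mono[OF _ _ sact_supp]) (auto simp: sact_def)

lemma sz_closed: "s \<in> Obj A \<Longrightarrow> sz s \<in> Sec s"
  by (auto simp: Sec_def sz_def supp_def zer_fibre dm_obj)

lemma sip_sections: assumes s: "s \<in> Obj A" shows "sip (Sec s) sadd ssml (sz s) ips"
proof
  show "sz s \<in> Sec s" by (rule sz_closed[OF s])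
next
  fix x assume x: "x \<in> Sec s"
  show "ips (sz s) x = 0"
    using sip_eq[OF sz_closed[OF s] x, of "{}"] by (simp add: supp_def sz_def)
  \<comment> \<open>The form on the fibre from \<open>dm A a\<close> to \<open>s\<close> is
    nonnegative because \<open>star_positive\<close> covers arrows between different
    objects.\<close>
  have "0 \<le> Re (trm x x a)" if "a \<in> Carr A" for a
    using sp f_state[OF that] Sec_fibre[OF x that] s dm_obj[OF that]
    unfolding trm_def star_positive_def state_def by blast
  then show "0 \<le> Re (ips x x)"
    using sip_eq[OF x x Sec_finite[OF x] order_refl supp_Carr] by (auto intro!: sum_nonneg simp: supp_def)
next
  fix x y assume xy: "x \<in> Sec s" "y \<in> Sec s"
  show "sadd x y \<in> Sec s" using sadd_closed[OF s] xy by blast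
  let ?F = "supp s x \<union> supp s y"
  have F: "finite ?F" "supp s x \<subseteq> ?F" "supp s y \<subseteq> ?F" "?F \<subseteq> Carr A"
    using xy Sec_finite supp_Carr by auto
  have "trm x y a = cnj (trm y x a)" if "a \<in> Carr A" for a
  proof -
    have xa: "x a \<in> fibre A (dm A a) s" and ya: "y a \<in> fibre A (dm A a) s" using Sec_fibre xy that by auto
    have "inv A (mul A (inv A (x a)) (y a)) = mul A (inv A (y a)) (x a)"
      by (simp add: inv_mul[OF inv_fibre[OF xa] ya] inv_inv[OF xa])
    then show ?thesis
      using f_simps(3)[OF that mul_fibre[OF inv_fibre[OF xa] ya]] by (simp add: trm_def)
  qed
  then show "ips x y = cnj (ips y x)"
    unfolding sip_eq[OF xy F(1,2,4)] sip_eq[OF xy(2,1) F(1,3,4)] cnj_sum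
    using F by (intro sum.cong refl) auto
  fix z assume z: "z \<in> Sec s"
  have "trm (sadd x y) z a = trm x z a + trm y z a" if a: "a \<in> Carr A" for a
  proof -
    have xa: "x a \<in> fibre A (dm A a) s" and ya: "y a \<in> fibre A (dm A a) s" and za: "inv A (z a) \<in> fibre A s (dm A a)"
      using Sec_fibre xy z that inv_fibre by auto
    show ?thesis
      using f_simps(1)[OF a mul_fibre[OF za xa] mul_fibre[OF za ya]]
      by (simp add: trm_def sadd_def bilinear(2)[OF za xa ya])
  qed
  then show "ips (sadd x y) z = ips x z + ips y z"
    unfolding sip_eq[OF xy(1) z F(1,2,4)] sip_eq[OF xy(2) z F(1,3,4)]
      sip_eq[OF sadd_closed[OF s xy] z F(1) sadd_supp[OF s xy] F(4)] sum.distrib[symmetric]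
    using F by (intro sum.cong refl) auto
next
  fix c x assume x: "x \<in> Sec s"
  show "ssml c x \<in> Sec s" using ssml_closed[OF s x] .
  fix y assume y: "y \<in> Sec s"
  have "trm (ssml c x) y a = c * trm x y a" if a: "a \<in> Carr A" for a
  proof -
    have xa: "x a \<in> fibre A (dm A a) s" and ya: "inv A (y a) \<in> fibre A s (dm A a)"
      using Sec_fibre x y that inv_fibre by auto
    show ?thesis
      using f_simps(2)[OF a mul_fibre[OF ya xa]] by (simp add: trm_def ssml_def bilinear(4)[OF ya xa])
  qed
  then show "ips (ssml c x) y = c * ips x y"
    unfolding sip_eq[OF x y Sec_finite[OF x] order_refl supp_Carr]
      sip_eq[OF ssml_closed[OF s x] y Sec_finite[OF x] ssml_supp[OF s] supp_Carr] sum_distrib_left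
    using supp_Carr by (intro sum.cong refl) auto
qed

lemma sip_sact_eq:
  assumes x: "x \<in> fibre A s t" and v: "v \<in> Sec s" and w: "w \<in> Sec t"
  shows "ips (sact x v) w = (\<Sum>a\<in>supp s v. trm (sact x v) w a)"
  by (rule sip_eq[OF sact_closed[OF x v] w Sec_finite[OF v] sact_supp[OF x] supp_Carr])

lemma vn_sact_le:
  assumes x: "x \<in> fibre A s t" and v: "v \<in> Sec s"
  shows "vn ips (sact x v) \<le> nrm A x * vn ips v"
proof -
  have "Re (ips (sact x v) (sact x v)) = (\<Sum>a\<in>supp s v. Re (trm (sact x v) (sact x v) a))"
    unfolding sip_sact_eq[OF x v sact_closed[OF x v]] by simp
  also have "\<dots> \<le> (\<Sum>a\<in>supp s v. (nrm A x)\<^sup>2 * Re (trm v v a))"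
  proof (rule sum_mono)
    fix a assume "a \<in> supp s v"
    then have a: "a \<in> Carr A" by (simp add: supp_def)
    show "Re (trm (sact x v) (sact x v) a) \<le> (nrm A x)\<^sup>2 * Re (trm v v a)"
      using state_contraction[OF unit[OF fibre_obj(1)[OF x]] sp f_state[OF a] x Sec_fibre[OF v a]]
      by (simp add: trm_def sact_def)
  qed
  also have "\<dots> = (nrm A x)\<^sup>2 * Re (ips v v)"
    using sip_eq[OF v v Sec_finite[OF v] order_refl supp_Carr] by (simp add: sum_distrib_left)
  finally have "vn ips (sact x v) \<le> sqrt ((nrm A x)\<^sup>2 * Re (ips v v))"
    unfolding vn_def by (rule real_sqrt_le_mono)
  then show ?thesis using nrm_nonneg[OF x] by (simp add: vn_def real_sqrt_mult)
qed

definition delta :: "'s \<Rightarrow> 'a \<Rightarrow> 'a \<Rightarrow> 'a \<Rightarrow> 'a" where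
  "delta s a b = (\<lambda>a'. if a' = a then b else zer A (dm A a') s)"

lemma delta_closed: assumes "a \<in> Carr A" "b \<in> fibre A (dm A a) s" shows "delta s a b \<in> Sec s"
proof -
  have "supp s (delta s a b) \<subseteq> {a}" by (auto simp: supp_def delta_def)
  then show ?thesis
    using assms fibre_obj[OF assms(2)] finite_subset[of _ "{a}"]
    by (auto simp: Sec_def delta_def zer_fibre dm_obj)
qed

lemma sip_delta:
  assumes v: "v \<in> Sec s" and a: "a \<in> Carr A" and b: "b \<in> fibre A (dm A a) s"
  shows "ips v (delta s a b) = f a (mul A (inv A b) (v a))"
proof -
  have d: "delta s a b \<in> Sec s" by (rule delta_closed[OF a b])
  have t: "trm v (delta s a b) a' = (if a' = a then f a (mul A (inv A b) (v a)) else 0)"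
    if a': "a' \<in> Carr A" for a'
    using zer_mul[OF Sec_fibre[OF v a'] dm_obj[OF a']] f_zer[OF a'] fibre_obj[OF b]
    by (auto simp: trm_def delta_def inv_zer dm_obj[OF a'])
  have "ips v (delta s a b) = (\<Sum>a'\<in>insert a (supp s v). trm v (delta s a b) a')"
    using a supp_Carr by (intro sip_eq[OF v d]) (auto intro: Sec_finite[OF v])
  also have "\<dots> = (\<Sum>a'\<in>insert a (supp s v). if a' = a then f a (mul A (inv A b) (v a)) else 0)"
    using t a supp_Carr by (intro sum.cong refl) blast
  finally show ?thesis by (simp add: Sec_finite[OF v])
qed

lemma sip_decompose:
  assumes v: "v \<in> Sec s" and w: "w \<in> Sec s"
  shows "ips v w = (\<Sum>a\<in>supp s w. ips v (delta s a (w a)))"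
proof -
  have wa: "a \<in> Carr A \<Longrightarrow> w a \<in> fibre A (dm A a) s" for a by (rule Sec_fibre[OF w])
  have "trm v w a = 0" if a: "a \<in> Carr A" "a \<notin> supp s w" for a
    using zer_mul[OF Sec_fibre[OF v a(1)] dm_obj[OF a(1)]] f_zer[OF a(1)] fibre_obj[OF wa[OF a(1)]] a
    by (simp add: trm_def supp_def inv_zer dm_obj[OF a(1)])
  then have "(\<Sum>a\<in>supp s v \<union> supp s w. trm v w a) = (\<Sum>a\<in>supp s w. trm v w a)"
    using Sec_finite[OF v] Sec_finite[OF w] supp_Carr by (intro sum.mono_neutral_right) auto
  moreover have "ips v w = (\<Sum>a\<in>supp s v \<union> supp s w. trm v w a)"
    using Sec_finite[OF v] Sec_finite[OF w] supp_Carr by (intro sip_eq[OF v w]) auto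
  moreover have "trm v w a = ips v (delta s a (w a))" if "a \<in> supp s w" for a
    using that sip_delta[OF v _ wa, of a] by (simp add: trm_def supp_def)
  ultimately show ?thesis by simp
qed

sublocale sip_rep A Sec sadd ssml sz ips sact
proof
  fix a b s t v w assume a: "a \<in> fibre A s t" and b: "b \<in> fibre A s t" and v: "v \<in> Sec s" and w: "w \<in> Sec t"
  have "trm (sact (add A a b) v) w k = trm (sact a v) w k + trm (sact b v) w k" if k: "k \<in> Carr A" for k
  proof -
    have vk: "v k \<in> fibre A (dm A k) s" and wk: "inv A (w k) \<in> fibre A t (dm A k)"
      using Sec_fibre v w k inv_fibre by auto
    note av = mul_fibre[OF a vk] and bv = mul_fibre[OF b vk]
    show ?thesis
      using f_simps(1)[OF k mul_fibre[OF wk av] mul_fibre[OF wk bv]]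
      by (simp add: trm_def sact_def bilinear(1)[OF a vk b] bilinear(2)[OF wk av bv])
  qed
  then show "ips (sact (add A a b) v) w = ips (sact a v) w + ips (sact b v) w"
    unfolding sip_sact_eq[OF a v w] sip_sact_eq[OF b v w] sip_sact_eq[OF add_fibre[OF a b] v w]
      sum.distrib[symmetric] using supp_Carr by (intro sum.cong refl) auto
next
  fix a c s t v w assume a: "a \<in> fibre A s t" and v: "v \<in> Sec s" and w: "w \<in> Sec t"
  have "trm (sact (sml A c a) v) w k = c * trm (sact a v) w k" if k: "k \<in> Carr A" for k
  proof -
    have vk: "v k \<in> fibre A (dm A k) s" and wk: "inv A (w k) \<in> fibre A t (dm A k)"
      using Sec_fibre v w k inv_fibre by auto
    note av = mul_fibre[OF a vk]
    show ?thesis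
      using f_simps(2)[OF k mul_fibre[OF wk av]]
      by (simp add: trm_def sact_def bilinear(3)[OF a vk] bilinear(4)[OF wk av])
  qed
  then show "ips (sact (sml A c a) v) w = c * ips (sact a v) w"
    unfolding sip_sact_eq[OF a v w] sip_sact_eq[OF sml_fibre[OF a] v w]
      sum_distrib_left using supp_Carr by (intro sum.cong refl) auto
next
  fix a b s u t v w assume a: "a \<in> fibre A u t" and b: "b \<in> fibre A s u" and v: "v \<in> Sec s" and w: "w \<in> Sec t"
  have "trm (sact (mul A a b) v) w k = trm (sact a (sact b v)) w k" if k: "k \<in> Carr A" for k
    using mul_assoc[OF a b Sec_fibre[OF v k]] by (simp add: trm_def sact_def)
  then show "ips (sact (mul A a b) v) w = ips (sact a (sact b v)) w"
    unfolding sip_sact_eq[OF mul_fibre[OF a b] v w]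
      sip_eq[OF sact_closed[OF a sact_closed[OF b v]] w Sec_finite[OF v]
        order_trans[OF sact_supp[OF a] sact_supp[OF b]] supp_Carr]
    using supp_Carr by (intro sum.cong refl) auto
next
  fix a s t v w assume a: "a \<in> fibre A s t" and v: "v \<in> Sec s" and w: "w \<in> Sec t"
  let ?F = "supp s v \<union> supp t w"
  have F: "finite ?F" "supp s v \<subseteq> ?F" "supp t w \<subseteq> ?F" "?F \<subseteq> Carr A"
    using v w Sec_finite supp_Carr by auto
  have "trm (sact (inv A a) w) v k = trm w (sact a v) k" if k: "k \<in> Carr A" for k
  proof -
    have vk: "v k \<in> fibre A (dm A k) s" and wk: "w k \<in> fibre A (dm A k) t" using Sec_fibre v w k by auto
    show ?thesis
      by (simp add: trm_def sact_def inv_mul[OF a vk] mul_assoc[OF inv_fibre[OF vk] inv_fibre[OF a] wk])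
  qed
  then show "ips (sact (inv A a) w) v = ips w (sact a v)"
    unfolding sip_eq[OF w sact_closed[OF a v] F(1,3,4)]
      sip_eq[OF sact_closed[OF inv_fibre[OF a] w] v F(1) order_trans[OF sact_supp[OF inv_fibre[OF a]] F(3)] F(4)]
    using F by (intro sum.cong refl) auto
next
  fix a s t assume "a \<in> fibre A s t"
  then show "\<exists>K. \<forall>v\<in>Sec s. vn ips (sact a v) \<le> K * vn ips v" using vn_sact_le by blast
qed (fact sact_closed | rule sip.vz_closed[OF sip_sections] sip.vadd_closed[OF sip_sections]
    sip.vsml_closed[OF sip_sections] sip.ip_vz[OF sip_sections] sip.ip_add[OF sip_sections]
    sip.ip_sml[OF sip_sections] sip.ip_sym[OF sip_sections] sip.ip_nonneg[OF sip_sections]; assumption)+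

text \<open>The norm is attained in the component at \<open>a\<close>: its cyclic vector, the unit
  of the domain, has norm at most 1, and \<open>a\<close> sends it to a vector of norm
  \<open>nrm A a\<close> by the choice of \<open>f a\<close>.\<close>

sublocale isometric_sip_rep A Sec sadd ssml sz ips sact
proof
  fix a s t assume a: "a \<in> fibre A s t"
  then have aC: "a \<in> Carr A" "dm A a = s" by (auto simp: fibre_def)
  have s: "s \<in> Obj A" using fibre_obj[OF a] by simp
  note u = unit[OF s]
  interpret U: ucalg "fibre A s s" "add A" "sml A" "zer A s s" "mul A" "inv A" "nrm A" "\<epsilon> s"
    by (rule ucalg_fibre[OF u])
  have e: "\<epsilon> s \<in> fibre A (dm A a) s" using aC by simp
  let ?d = "delta s a (\<epsilon> s)"
  have d: "?d \<in> Sec s" by (rule delta_closed[OF aC(1) e])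
  have ae: "mul A a (\<epsilon> s) = a" using u aC by (simp add: unit_at_def)
  have "ips ?d ?d = f a (\<epsilon> s)" unfolding sip_delta[OF d aC(1) e] by (simp add: delta_def)
  then have d1: "vn ips ?d \<le> 1" using f_state[OF aC(1)] u aC(2) by (simp add: vn_def state_def)
  have "supp s ?d \<subseteq> {a}" by (auto simp: supp_def delta_def)
  then have "supp t (sact a ?d) \<subseteq> {a}" using sact_supp[OF a] by blast
  then have "ips (sact a ?d) (sact a ?d) = (\<Sum>k\<in>{a}. trm (sact a ?d) (sact a ?d) k)"
    using aC sact_closed[OF a d] by (intro sip_eq) auto
  also have "\<dots> = complex_of_real ((nrm A a)\<^sup>2)"
    using f_norming[OF aC(1)] ae by (simp add: trm_def sact_def delta_def)
  finally have "vn ips (sact a ?d) = nrm A a" using nrm_nonneg[OF a] by (simp add: vn_def)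
  moreover have "vn ips (sact a ?d) \<le> opn a" by (rule opn_unit[OF a d d1])
  moreover have "opn a \<le> nrm A a" using opn_le[OF a nrm_nonneg[OF a] vn_sact_le[OF a]] .
  ultimately show "opn a = nrm A a" by simp
qed

end

text \<open>One norming state is chosen for each element; these are the states over which the direct
  sum runs.\<close>

lemma (in cstaralg) section_rep_exists:
  assumes un: "unital A" and sp: "star_positive A"
  shows "\<exists>\<epsilon> f. section_rep A \<epsilon> f"
proof -
  obtain \<epsilon> where \<epsilon>: "\<And>s. s \<in> Obj A \<Longrightarrow> unit_at A s (\<epsilon> s)" using unital_unit_at[OF un] by blast
  have "\<exists>\<phi>. state (dm A a) \<phi> \<and> \<phi> (mul A (inv A a) a) = complex_of_real ((nrm A a)\<^sup>2)"
    if "a \<in> Carr A" for a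
    using norming_state_exists[OF \<epsilon>[OF dm_obj[OF that]] sp carr_fibre[OF that]] .
  then obtain f where "\<And>a. a \<in> Carr A \<Longrightarrow> state (dm A a) (f a) \<and>
      f a (mul A (inv A a) a) = complex_of_real ((nrm A a)\<^sup>2)" by metis
  then have "section_rep A \<epsilon> f" using \<epsilon> sp by unfold_locales auto
  then show ?thesis by blast
qed


section \<open>Completion\<close>

lemma Cauchy_contraction:
  fixes d d' :: "nat \<Rightarrow> nat \<Rightarrow> real"
  assumes d: "\<And>e. e > 0 \<Longrightarrow> \<exists>N. \<forall>m\<ge>N. \<forall>n\<ge>N. d m n < e" "\<And>m n. 0 \<le> d m n"
    and K: "K \<ge> 0" "\<And>m n. d' m n \<le> K * d m n" and e: "e > 0"
  shows "\<exists>N. \<forall>m\<ge>N. \<forall>n\<ge>N. d' m n < e"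
proof -
  \<comment> \<open>\<open>K + 1\<close> instead of \<open>K\<close> accommodates
    \<open>K = 0\<close>.\<close>
  have "e / (K + 1) > 0" using K(1) e by simp
  then obtain N where N: "\<And>m n. m \<ge> N \<Longrightarrow> n \<ge> N \<Longrightarrow> d m n < e / (K + 1)"
    using d(1) by meson
  have "d' m n < e" if "m \<ge> N" "n \<ge> N" for m n
  proof -
    have "d' m n \<le> K * d m n" by (rule K(2))
    also have "\<dots> \<le> (K + 1) * d m n" using d(2) by (intro mult_right_mono) auto
    also have "\<dots> < (K + 1) * (e / (K + 1))" using N[OF that] K by (intro mult_strict_left_mono) auto
    finally show ?thesis using K by simp
  qed
  then show ?thesis by blast
qed

text \<open>A semi-inner product space whose semi-inner product is determined by the vectors \<open>\<tau> p\<close>, \<open>p \<in> P\<close>.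
  An element of the completion is identified with the function \<open>p \<mapsto> \<langle>x, \<tau> p\<rangle>\<close> on \<open>P\<close>.\<close>
locale tested_sip = sip V vadd vsml vz ip
  for V :: "'v set" and vadd vsml vz ip +
  fixes P :: "'x set" and \<tau> :: "'x \<Rightarrow> 'v"
  assumes \<tau>_closed [simp]: "\<And>p. p \<in> P \<Longrightarrow> \<tau> p \<in> V"
    and tests: "\<And>w. w \<in> V \<Longrightarrow> \<exists>F. finite F \<and> F \<subseteq> P \<and> (\<forall>v\<in>V. ip v w = (\<Sum>p\<in>F. ip v (\<tau> p)))"
begin

abbreviation "vsub x y \<equiv> vadd x (vsml (-1) y)"

lemma ip_vsub: "x \<in> V \<Longrightarrow> y \<in> V \<Longrightarrow> z \<in> V \<Longrightarrow> ip (vsub x y) z = ip x z - ip y z"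
  by (simp add: ip_add ip_sml)

lemma ip_vsub_right: "x \<in> V \<Longrightarrow> y \<in> V \<Longrightarrow> z \<in> V \<Longrightarrow> ip z (vsub x y) = ip z x - ip z y"
  by (simp add: ip_add_right ip_sml_right)

lemma vn_vz: "vn ip vz = 0"
  by (simp add: vn_def)

lemma vn_vsub_triangle: assumes "x \<in> V" "y \<in> V" "z \<in> V"
  shows "vn ip (vsub x z) \<le> vn ip (vsub x y) + vn ip (vsub y z)"
proof -
  have "vn ip (vsub x z) = vn ip (vadd (vsub x y) (vsub y z))"
    using assms by (intro vn_cong) (simp_all add: ip_add ip_sml)
  then show ?thesis using assms vn_add[of "vsub x y" "vsub y z"] by simp
qed

lemma vn_vsub_comm: assumes "x \<in> V" "y \<in> V" shows "vn ip (vsub x y) = vn ip (vsub y x)"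
proof -
  have "vn ip (vsub x y) = vn ip (vsml (-1) (vsub y x))"
    using assms by (intro vn_cong) (simp_all add: ip_add ip_sml)
  then show ?thesis using assms by (simp add: vn_sml)
qed

lemma vn_diff_le: assumes "x \<in> V" "y \<in> V" shows "\<bar>vn ip x - vn ip y\<bar> \<le> vn ip (vsub x y)"
proof -
  have *: "vn ip x \<le> vn ip y + vn ip (vsub x y)" if "x \<in> V" "y \<in> V" for x y
  proof -
    have "vn ip x = vn ip (vadd y (vsub x y))"
      using that by (intro vn_cong) (simp_all add: ip_add ip_sml)
    then show ?thesis using that vn_add[of y "vsub x y"] by simp
  qed
  show ?thesis using *[OF assms] *[OF assms(2,1)] vn_vsub_comm[OF assms] by simp
qed

section \<open>Cauchy sequences and limits of their pairings\<close>

definition cau :: "(nat \<Rightarrow> 'v) \<Rightarrow> bool" where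
  "cau X \<longleftrightarrow> (\<forall>n. X n \<in> V) \<and> (\<forall>e>0. \<exists>N. \<forall>m\<ge>N. \<forall>n\<ge>N. vn ip (vsub (X m) (X n)) < e)"

lemma cau_closed [simp]: "cau X \<Longrightarrow> X n \<in> V"
  by (simp add: cau_def)

lemma cauD: "cau X \<Longrightarrow> e > 0 \<Longrightarrow> \<exists>N. \<forall>m\<ge>N. \<forall>n\<ge>N. vn ip (vsub (X m) (X n)) < e"
  by (simp add: cau_def)

lemma cau_const: "v \<in> V \<Longrightarrow> cau (\<lambda>_. v)"
proof -
  assume v: "v \<in> V"
  have "vn ip (vsub v v) = vn ip vz" using v by (intro vn_cong) (simp_all add: ip_vsub)
  then show ?thesis using v by (simp add: cau_def vn_vz)
qed

lemma cau_add: assumes X: "cau X" and Y: "cau Y" shows "cau (\<lambda>n. vadd (X n) (Y n))"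
  unfolding cau_def
proof (intro conjI allI impI)
  fix e :: real assume "e > 0"
  then have "e/2 > 0" by simp
  then obtain N M where N: "\<And>m n. m \<ge> N \<Longrightarrow> n \<ge> N \<Longrightarrow> vn ip (vsub (X m) (X n)) < e/2"
    and M: "\<And>m n. m \<ge> M \<Longrightarrow> n \<ge> M \<Longrightarrow> vn ip (vsub (Y m) (Y n)) < e/2"
    using cauD[OF X] cauD[OF Y] by meson
  have "vn ip (vsub (vadd (X m) (Y m)) (vadd (X n) (Y n))) < e" if "m \<ge> max N M" "n \<ge> max N M" for m n
  proof -
    have "vn ip (vsub (vadd (X m) (Y m)) (vadd (X n) (Y n))) = vn ip (vadd (vsub (X m) (X n)) (vsub (Y m) (Y n)))"
      using X Y by (intro vn_cong) (simp_all add: ip_add ip_sml)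
    also have "\<dots> \<le> vn ip (vsub (X m) (X n)) + vn ip (vsub (Y m) (Y n))" using X Y by (intro vn_add) auto
    also have "\<dots> < e" using N[of m n] M[of m n] that by simp
    finally show ?thesis .
  qed
  then show "\<exists>N. \<forall>m\<ge>N. \<forall>n\<ge>N. vn ip (vsub (vadd (X m) (Y m)) (vadd (X n) (Y n))) < e" by blast
qed (use X Y in auto)

lemma cau_sml: assumes X: "cau X" shows "cau (\<lambda>n. vsml c (X n))"
  unfolding cau_def
proof (intro conjI allI impI)
  have "vn ip (vsub (vsml c (X m)) (vsml c (X n))) = vn ip (vsml c (vsub (X m) (X n)))" for m n
    using X by (intro vn_cong) (simp_all add: ip_add ip_sml algebra_simps)
  then have le: "vn ip (vsub (vsml c (X m)) (vsml c (X n))) \<le> cmod c * vn ip (vsub (X m) (X n))" for m n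
    using X by (simp add: vn_sml)
  fix e :: real assume e: "e > 0"
  show "\<exists>N. \<forall>m\<ge>N. \<forall>n\<ge>N. vn ip (vsub (vsml c (X m)) (vsml c (X n))) < e"
    by (rule Cauchy_contraction[OF cauD[OF X] _ norm_ge_zero le e]) (use X in auto)
qed (use X in auto)

lemma cau_vn_Cauchy: assumes X: "cau X" shows "Cauchy (\<lambda>n. vn ip (X n))"
  unfolding Cauchy_def dist_real_def
proof (intro allI impI)
  fix e :: real assume "e > 0"
  then obtain N where "\<forall>m\<ge>N. \<forall>n\<ge>N. vn ip (vsub (X m) (X n)) < e" using cauD[OF X] by blast
  then show "\<exists>N. \<forall>m\<ge>N. \<forall>n\<ge>N. \<bar>vn ip (X m) - vn ip (X n)\<bar> < e"
    using vn_diff_le[OF cau_closed[OF X] cau_closed[OF X]] by (meson le_less_trans)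
qed

lemma cau_bounded: assumes X: "cau X" shows "\<exists>K>0. \<forall>n. vn ip (X n) \<le> K"
proof -
  have "Bseq (\<lambda>n. vn ip (X n))" using cau_vn_Cauchy[OF X] by (rule Cauchy_Bseq)
  then show ?thesis using X unfolding Bseq_def by (auto simp: abs_of_nonneg)
qed

lemma cau_ip_Cauchy: assumes X: "cau X" and Y: "cau Y" shows "Cauchy (\<lambda>n. ip (X n) (Y n))"
  unfolding Cauchy_def dist_norm
proof (intro allI impI)
  fix e :: real assume e: "e > 0"
  obtain K where K: "K > 0" "\<And>n. vn ip (X n) \<le> K" using cau_bounded[OF X] by blast
  obtain L where L: "L > 0" "\<And>n. vn ip (Y n) \<le> L" using cau_bounded[OF Y] by blast
  have "e / (2 * L) > 0" "e / (2 * K) > 0" using e K L by auto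
  then obtain N M where N: "\<And>m n. m \<ge> N \<Longrightarrow> n \<ge> N \<Longrightarrow> vn ip (vsub (X m) (X n)) < e / (2 * L)"
    and M: "\<And>m n. m \<ge> M \<Longrightarrow> n \<ge> M \<Longrightarrow> vn ip (vsub (Y m) (Y n)) < e / (2 * K)"
    using cauD[OF X] cauD[OF Y] by meson
  have "cmod (ip (X m) (Y m) - ip (X n) (Y n)) < e" if "m \<ge> max N M" "n \<ge> max N M" for m n
  proof -
    have "ip (X m) (Y m) - ip (X n) (Y n) = ip (vsub (X m) (X n)) (Y m) + ip (X n) (vsub (Y m) (Y n))"
      using X Y by (simp add: ip_vsub ip_vsub_right)
    then have "cmod (ip (X m) (Y m) - ip (X n) (Y n))
        \<le> cmod (ip (vsub (X m) (X n)) (Y m)) + cmod (ip (X n) (vsub (Y m) (Y n)))"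
      by (simp add: norm_triangle_ineq)
    also have "\<dots> \<le> vn ip (vsub (X m) (X n)) * vn ip (Y m) + vn ip (X n) * vn ip (vsub (Y m) (Y n))"
      using X Y by (intro add_mono Cauchy_Schwarz) auto
    also have "\<dots> \<le> vn ip (vsub (X m) (X n)) * L + K * vn ip (vsub (Y m) (Y n))"
      using X Y K L by (intro add_mono mult_left_mono mult_right_mono) auto
    also have "\<dots> < e / (2 * L) * L + K * (e / (2 * K))"
      using N[of m n] M[of m n] that K L by (intro add_strict_mono mult_strict_left_mono mult_strict_right_mono) auto
    also have "\<dots> = e" using K L by (simp add: field_simps)
    finally show ?thesis .
  qed
  then show "\<exists>N. \<forall>m\<ge>N. \<forall>n\<ge>N. cmod (ip (X m) (Y m) - ip (X n) (Y n)) < e" by blast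
qed

definition lip :: "(nat \<Rightarrow> 'v) \<Rightarrow> (nat \<Rightarrow> 'v) \<Rightarrow> complex" where
  "lip X Y = lim (\<lambda>n. ip (X n) (Y n))"

lemma lip_lim: "cau X \<Longrightarrow> cau Y \<Longrightarrow> (\<lambda>n. ip (X n) (Y n)) \<longlonglongrightarrow> lip X Y"
  unfolding lip_def using cau_ip_Cauchy Cauchy_convergent convergent_LIMSEQ_iff by blast

lemma lip_eqI: "(\<lambda>n. ip (X n) (Y n)) \<longlonglongrightarrow> l \<Longrightarrow> lip X Y = l"
  unfolding lip_def by (rule limI)

lemma lip_add: "cau X \<Longrightarrow> cau Y \<Longrightarrow> cau Z \<Longrightarrow> lip (\<lambda>n. vadd (X n) (Y n)) Z = lip X Z + lip Y Z"
  by (rule lip_eqI) (use tendsto_add[OF lip_lim lip_lim, of X Z Y Z] in \<open>simp add: ip_add\<close>)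

lemma lip_sml: "cau X \<Longrightarrow> cau Z \<Longrightarrow> lip (\<lambda>n. vsml c (X n)) Z = c * lip X Z"
  by (rule lip_eqI) (use tendsto_mult[OF tendsto_const lip_lim, of X Z c] in \<open>simp add: ip_sml\<close>)

lemma lip_sym: "cau X \<Longrightarrow> cau Y \<Longrightarrow> lip X Y = cnj (lip Y X)"
proof (rule lip_eqI)
  assume XY: "cau X" "cau Y"
  have "(\<lambda>n. cnj (ip (Y n) (X n))) \<longlonglongrightarrow> cnj (lip Y X)"
    using lip_lim[OF XY(2,1)] by (rule tendsto_cnj)
  then show "(\<lambda>n. ip (X n) (Y n)) \<longlonglongrightarrow> cnj (lip Y X)"
    using XY by (simp flip: ip_sym)
qed

lemma vn_lim: assumes "cau X" shows "(\<lambda>n. vn ip (X n)) \<longlonglongrightarrow> sqrt (Re (lip X X))"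
  unfolding vn_def by (intro tendsto_intros lip_lim assms)

text \<open>A Cauchy sequence that tends weakly to zero tends to zero in norm:
  \<open>||Z n||^2 = <Z n, Z n - Z N> + <Z n, Z N>\<close>, where the first term is small by the
  Cauchy property for large \<open>N\<close> and the second by weak convergence for that fixed
  \<open>N\<close>.\<close>

lemma vn_lim_zero:
  assumes Z: "cau Z" and 0: "\<And>p. p \<in> P \<Longrightarrow> lip Z (\<lambda>_. \<tau> p) = 0"
  shows "(\<lambda>n. vn ip (Z n)) \<longlonglongrightarrow> 0"
proof -
  have w0: "(\<lambda>n. ip (Z n) w) \<longlonglongrightarrow> 0" if w: "w \<in> V" for w
  proof -
    obtain F where F: "finite F" "F \<subseteq> P" "\<And>v. v \<in> V \<Longrightarrow> ip v w = (\<Sum>p\<in>F. ip v (\<tau> p))"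
      using tests[OF w] by blast
    have "(\<lambda>n. \<Sum>p\<in>F. ip (Z n) (\<tau> p)) \<longlonglongrightarrow> 0"
    proof (intro tendsto_null_sum)
      fix p assume "p \<in> F"
      then have p: "p \<in> P" using F by blast
      then have "cau (\<lambda>_. \<tau> p)" by (simp add: cau_const)
      then show "(\<lambda>n. ip (Z n) (\<tau> p)) \<longlonglongrightarrow> 0" using lip_lim[OF Z, of "\<lambda>_. \<tau> p"] 0[OF p] by simp
    qed
    then show ?thesis using F(3) Z by simp
  qed
  obtain K where K: "K > 0" "\<And>n. vn ip (Z n) \<le> K" using cau_bounded[OF Z] by blast
  have "(\<lambda>n. (vn ip (Z n))\<^sup>2) \<longlonglongrightarrow> 0"
  proof (rule LIMSEQ_I)
    fix e :: real assume e: "e > 0"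
    then have "e / (2 * K) > 0" using K by simp
    then obtain N where N: "\<And>m n. m \<ge> N \<Longrightarrow> n \<ge> N \<Longrightarrow> vn ip (vsub (Z m) (Z n)) < e / (2 * K)"
      using cauD[OF Z] by meson
    obtain M where M: "\<And>n. n \<ge> M \<Longrightarrow> cmod (ip (Z n) (Z N)) < e / 2"
      using LIMSEQ_D[OF w0[of "Z N"], of "e / 2"] Z e by auto
    have "(vn ip (Z n))\<^sup>2 < e" if n: "n \<ge> max N M" for n
    proof -
      have "complex_of_real ((vn ip (Z n))\<^sup>2) = ip (Z n) (vsub (Z n) (Z N)) + ip (Z n) (Z N)"
        using Z by (simp add: ip_vsub_right ip_self)
      then have "(vn ip (Z n))\<^sup>2 \<le> cmod (ip (Z n) (vsub (Z n) (Z N))) + cmod (ip (Z n) (Z N))"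
        by (metis norm_of_real abs_of_nonneg zero_le_power2 norm_triangle_ineq)
      also have "cmod (ip (Z n) (vsub (Z n) (Z N))) \<le> vn ip (Z n) * vn ip (vsub (Z n) (Z N))"
        using Z by (intro Cauchy_Schwarz) auto
      also have "\<dots> \<le> K * (e / (2 * K))"
        using N[of n N] n K Z by (intro mult_mono) auto
      also have "K * (e / (2 * K)) = e / 2" using K by simp
      finally show ?thesis using M[of n] n by simp
    qed
    then show "\<exists>N. \<forall>n\<ge>N. norm ((vn ip (Z n))\<^sup>2 - 0) < e" by (intro exI[of _ "max N M"]) simp
  qed
  then have "(\<lambda>n. sqrt ((vn ip (Z n))\<^sup>2)) \<longlonglongrightarrow> sqrt 0" by (rule tendsto_real_sqrt)
  then show ?thesis using Z by simp
qed

text \<open>The value 0 outside \<open>P\<close> is preserved by pointwise sums and multiples, so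
  the vector space laws hold for total functions.\<close>

definition cls :: "(nat \<Rightarrow> 'v) \<Rightarrow> 'x \<Rightarrow> complex" where
  "cls X = (\<lambda>p. if p \<in> P then lip X (\<lambda>_. \<tau> p) else 0)"

lemma cau_\<tau> [simp]: "p \<in> P \<Longrightarrow> cau (\<lambda>_. \<tau> p)"
  by (simp add: cau_const)

lemma cls_add: "cau X \<Longrightarrow> cau Y \<Longrightarrow> cls (\<lambda>n. vadd (X n) (Y n)) = (\<lambda>p. cls X p + cls Y p)"
  by (auto simp: cls_def lip_add fun_eq_iff)

lemma cls_sml: "cau X \<Longrightarrow> cls (\<lambda>n. vsml c (X n)) = (\<lambda>p. c * cls X p)"
  by (auto simp: cls_def lip_sml fun_eq_iff)

text \<open>If the classes agree, the difference sequence pairs to zero with all tests, so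
  \<open>vn_lim_zero\<close> makes it null, and Cauchy-Schwarz kills its pairing with
  \<open>Y\<close>. Thus the inner product is well defined on classes.\<close>

lemma lip_cong:
  assumes X: "cau X" "cau X'" and Y: "cau Y" and eq: "cls X = cls X'"
  shows "lip X Y = lip X' Y"
proof -
  let ?Z = "\<lambda>n. vsub (X n) (X' n)"
  have Z: "cau ?Z" using X by (intro cau_add cau_sml)
  have "lip ?Z (\<lambda>_. \<tau> p) = 0" if p: "p \<in> P" for p
  proof -
    have "lip ?Z (\<lambda>_. \<tau> p) = lip X (\<lambda>_. \<tau> p) - lip X' (\<lambda>_. \<tau> p)"
      using X p by (simp add: lip_add cau_sml lip_sml)
    then show ?thesis using fun_cong[OF eq, of p] p by (simp add: cls_def)
  qed
  then have z0: "(\<lambda>n. vn ip (?Z n)) \<longlonglongrightarrow> 0" by (rule vn_lim_zero[OF Z])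
  have "(\<lambda>n. vn ip (?Z n) * vn ip (Y n)) \<longlonglongrightarrow> 0 * sqrt (Re (lip Y Y))"
    by (rule tendsto_mult[OF z0 vn_lim[OF Y]])
  then have "(\<lambda>n. vn ip (?Z n) * vn ip (Y n)) \<longlonglongrightarrow> 0" by simp
  then have "(\<lambda>n. ip (?Z n) (Y n)) \<longlonglongrightarrow> 0"
    by (rule tendsto_0_le[where K=1])
      (use Cauchy_Schwarz[OF cau_closed[OF Z] cau_closed[OF Y]] X Y in \<open>auto simp: abs_of_nonneg\<close>)
  then have "lip ?Z Y = 0" by (rule lip_eqI)
  moreover have "lip ?Z Y = lip X Y - lip X' Y" using X Y by (simp add: lip_add cau_sml lip_sml)
  ultimately show ?thesis by simp
qed

definition rp :: "('x \<Rightarrow> complex) \<Rightarrow> nat \<Rightarrow> 'v" where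
  "rp g = (SOME X. cau X \<and> cls X = g)"

lemma rp: assumes "cau X" shows "cau (rp (cls X))" "cls (rp (cls X)) = cls X"
  using someI[of "\<lambda>Y. cau Y \<and> cls Y = cls X" X] assms by (simp_all add: rp_def)

section \<open>The completion as a Hilbert space\<close>

definition hs :: "('x \<Rightarrow> complex) hspace" where
  "hs = \<lparr>hcarr = {cls X |X. cau X}, hadd = (\<lambda>g h p. g p + h p), hsml = (\<lambda>c g p. c * g p),
         hzero = (\<lambda>_. 0), hinner = (\<lambda>g h. lip (rp g) (rp h))\<rparr>"

lemma hs_simps [simp]:
  "hcarr hs = {cls X |X. cau X}" "hadd hs g h = (\<lambda>p. g p + h p)" "hsml hs c g = (\<lambda>p. c * g p)"
  "hzero hs = (\<lambda>_. 0)"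
  by (simp_all add: hs_def)

lemma hinner_cls: assumes "cau X" "cau Y" shows "hinner hs (cls X) (cls Y) = lip X Y"
proof -
  have "lip (rp (cls X)) (rp (cls Y)) = lip X (rp (cls Y))"
    using assms rp by (intro lip_cong) auto
  also have "\<dots> = cnj (lip (rp (cls Y)) X)" using assms rp by (intro lip_sym) auto
  also have "lip (rp (cls Y)) X = lip Y X" using assms rp by (intro lip_cong) auto
  also have "cnj (lip Y X) = lip X Y" using assms by (metis lip_sym)
  finally show ?thesis by (simp add: hs_def)
qed

lemma zero_cls: "(\<lambda>_. 0) = cls (\<lambda>_. vz)"
proof (rule ext)
  fix p
  have "lip (\<lambda>_. vz) (\<lambda>_. \<tau> p) = 0" if "p \<in> P" by (rule lip_eqI) (use that in simp)
  then show "0 = cls (\<lambda>_. vz) p" by (simp add: cls_def)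
qed

lemma hnorm_cls: "cau X \<Longrightarrow> (\<lambda>n. vn ip (X n)) \<longlonglongrightarrow> hnorm hs (cls X)"
  unfolding hnorm_def by (simp add: hinner_cls vn_lim)

lemma hsub_cls: "cau X \<Longrightarrow> cau Y \<Longrightarrow> hsub hs (cls X) (cls Y) = cls (\<lambda>n. vsub (X n) (Y n))"
  by (simp add: hsub_def cls_add cls_sml cau_sml)

lemma hnorm_sub_le:
  assumes "cau X" "cau Y" "\<And>n. n \<ge> N \<Longrightarrow> vn ip (vsub (X n) (Y n)) \<le> b"
  shows "hnorm hs (hsub hs (cls X) (cls Y)) \<le> b"
proof -
  have "(\<lambda>n. vn ip (vsub (X n) (Y n))) \<longlonglongrightarrow> hnorm hs (hsub hs (cls X) (cls Y))"
    unfolding hsub_cls[OF assms(1,2)] using assms by (intro hnorm_cls cau_add cau_sml)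
  then show ?thesis by (rule LIMSEQ_le_const2) (use assms(3) in blast)
qed

lemma hnorm_sub_triangle:
  assumes "cau X" "cau Y" "cau Z"
  shows "hnorm hs (hsub hs (cls X) (cls Z)) \<le> hnorm hs (hsub hs (cls X) (cls Y)) + hnorm hs (hsub hs (cls Y) (cls Z))"
proof -
  have l: "(\<lambda>n. vn ip (vsub (X n) (Y n))) \<longlonglongrightarrow> hnorm hs (hsub hs (cls X) (cls Y))"
    if "cau X" "cau Y" for X Y
    unfolding hsub_cls[OF that] using that by (intro hnorm_cls cau_add cau_sml)
  show ?thesis
    by (rule LIMSEQ_le[OF l[OF assms(1,3)] tendsto_add[OF l[OF assms(1,2)] l[OF assms(2,3)]]])
      (use assms in \<open>auto intro!: vn_vsub_triangle\<close>)
qed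

text \<open>Approximate the \<open>k\<close>-th class within \<open>1/(k+1)\<close> by a constant
  sequence with value \<open>v k\<close>. The sequence \<open>v\<close> is then itself Cauchy, and
  its class is the limit.\<close>

lemma hilbert_complete:
  assumes G: "\<And>k. G k \<in> hcarr hs"
    and Cau: "\<And>e. e > 0 \<Longrightarrow> \<exists>N. \<forall>m\<ge>N. \<forall>n\<ge>N. hnorm hs (hsub hs (G m) (G n)) < e"
  shows "\<exists>L\<in>hcarr hs. (\<lambda>n. hnorm hs (hsub hs (G n) L)) \<longlonglongrightarrow> 0"
proof -
  have "\<exists>X. cau X \<and> G k = cls X" for k using G[of k] by auto
  then obtain X where X: "\<And>k. cau (X k)" "\<And>k. G k = cls (X k)" by metis
  have inv0: "(\<lambda>k. 1 / real (Suc k)) \<longlonglongrightarrow> 0"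
    using LIMSEQ_inverse_real_of_nat by (simp add: inverse_eq_divide)
  have "\<exists>v\<in>V. hnorm hs (hsub hs (G k) (cls (\<lambda>_. v))) \<le> 1 / real (Suc k)" for k
  proof -
    have "1 / real (Suc k) > 0" by simp
    then obtain N where N: "\<And>m n. m \<ge> N \<Longrightarrow> n \<ge> N \<Longrightarrow> vn ip (vsub (X k m) (X k n)) < 1 / real (Suc k)"
      using cauD[OF X(1)] by meson
    have "hnorm hs (hsub hs (cls (X k)) (cls (\<lambda>_. X k N))) \<le> 1 / real (Suc k)"
      using X(1) by (intro hnorm_sub_le[where N=N] cau_const less_imp_le[OF N]) simp_all
    then show ?thesis using X by (auto intro!: bexI[of _ "X k N"])
  qed
  then obtain v where v: "\<And>k. v k \<in> V" "\<And>k. hnorm hs (hsub hs (G k) (cls (\<lambda>_. v k))) \<le> 1 / real (Suc k)"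
    by metis
  have sym: "hnorm hs (hsub hs (cls Y) (cls Z)) = hnorm hs (hsub hs (cls Z) (cls Y))"
    if "cau Y" "cau Z" for Y Z
  proof (rule LIMSEQ_unique)
    show "(\<lambda>n. vn ip (vsub (Y n) (Z n))) \<longlonglongrightarrow> hnorm hs (hsub hs (cls Y) (cls Z))"
      unfolding hsub_cls[OF that] using that by (intro hnorm_cls cau_add cau_sml)
    have "(\<lambda>n. vn ip (vsub (Z n) (Y n))) \<longlonglongrightarrow> hnorm hs (hsub hs (cls Z) (cls Y))"
      unfolding hsub_cls[OF that(2,1)] using that by (intro hnorm_cls cau_add cau_sml)
    then show "(\<lambda>n. vn ip (vsub (Y n) (Z n))) \<longlonglongrightarrow> hnorm hs (hsub hs (cls Z) (cls Y))"
      using that by (simp add: vn_vsub_comm)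
  qed
  have vv: "vn ip (vsub (v m) (v n)) \<le> 1 / real (Suc m) + hnorm hs (hsub hs (G m) (G n)) + 1 / real (Suc n)" for m n
  proof -
    let ?c = "\<lambda>k. cls (\<lambda>_. v k)"
    have cv: "cau (\<lambda>_. v k)" for k using v cau_const by blast
    have "(\<lambda>_. vn ip (vsub (v m) (v n))) \<longlonglongrightarrow> hnorm hs (hsub hs (?c m) (?c n))"
      unfolding hsub_cls[OF cv cv] using hnorm_cls[of "\<lambda>_. vsub (v m) (v n)"] v by (simp add: cau_const)
    then have "vn ip (vsub (v m) (v n)) = hnorm hs (hsub hs (?c m) (?c n))"
      using LIMSEQ_unique tendsto_const by blast
    also have "\<dots> \<le> hnorm hs (hsub hs (?c m) (G m)) + hnorm hs (hsub hs (G m) (?c n))"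
      unfolding X(2) by (rule hnorm_sub_triangle[OF cv X(1) cv])
    also have "\<dots> \<le> hnorm hs (hsub hs (?c m) (G m)) + (hnorm hs (hsub hs (G m) (G n)) + hnorm hs (hsub hs (G n) (?c n)))"
      unfolding X(2) by (intro add_left_mono hnorm_sub_triangle[OF X(1) X(1) cv])
    finally show ?thesis using v(2)[of m] v(2)[of n] sym[OF cv X(1), of m m] by (simp add: X(2))
  qed
  have cv: "cau v"
    unfolding cau_def
  proof (intro conjI allI impI)
    fix e :: real assume e: "e > 0"
    obtain M where M: "\<And>k. k \<ge> M \<Longrightarrow> 1 / real (Suc k) < e / 3"
      using LIMSEQ_D[OF inv0, of "e/3"] e by auto
    obtain N where N: "\<And>m n. m \<ge> N \<Longrightarrow> n \<ge> N \<Longrightarrow> hnorm hs (hsub hs (G m) (G n)) < e / 3"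
      using Cau[of "e/3"] e by auto
    have "vn ip (vsub (v m) (v n)) < e" if "m \<ge> max M N" "n \<ge> max M N" for m n
      using vv[of m n] M[of m] M[of n] N[of m n] that by simp
    then show "\<exists>N. \<forall>m\<ge>N. \<forall>n\<ge>N. vn ip (vsub (v m) (v n)) < e" by blast
  qed (fact v)
  have nn: "0 \<le> hnorm hs (hsub hs (G k) (cls v))" for k
    using vn_nonneg cv X(1)[of k] unfolding X(2) hsub_cls[OF X(1) cv]
    by (intro LIMSEQ_le_const[OF hnorm_cls]) (auto intro!: cau_add cau_sml)
  have "(\<lambda>k. hnorm hs (hsub hs (G k) (cls v))) \<longlonglongrightarrow> 0"
  proof (rule LIMSEQ_I)
    fix e :: real assume e: "e > 0"
    obtain M where M: "\<And>k. k \<ge> M \<Longrightarrow> 1 / real (Suc k) < e / 2"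
      using LIMSEQ_D[OF inv0, of "e/2"] e by auto
    have "e/3 > 0" using e by simp
    then obtain N where N: "\<And>m n. m \<ge> N \<Longrightarrow> n \<ge> N \<Longrightarrow> vn ip (vsub (v m) (v n)) < e / 3"
      using cauD[OF cv] by meson
    have "hnorm hs (hsub hs (G k) (cls v)) < e" if k: "k \<ge> max M N" for k
    proof -
      have "hnorm hs (hsub hs (G k) (cls v)) \<le> hnorm hs (hsub hs (G k) (cls (\<lambda>_. v k))) + hnorm hs (hsub hs (cls (\<lambda>_. v k)) (cls v))"
        unfolding X(2) by (intro hnorm_sub_triangle X(1) cv cau_const v)
      moreover have "hnorm hs (hsub hs (cls (\<lambda>_. v k)) (cls v)) \<le> e / 3"
        using k by (intro hnorm_sub_le[where N=N] cau_const v cv less_imp_le[OF N]) simp_all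
      ultimately show ?thesis using v(2)[of k] M[of k] k e by linarith
    qed
    then show "\<exists>N. \<forall>k\<ge>N. norm (hnorm hs (hsub hs (G k) (cls v)) - 0) < e"
      using nn by (intro exI[of _ "max M N"]) simp
  qed
  then show ?thesis using cv by auto
qed

lemma hilbert_hs: "hilbert_space hs"
  unfolding hilbert_space_def
proof (intro conjI ballI allI impI)
  show "hzero hs \<in> hcarr hs" using zero_cls cau_const[OF vz_closed] by auto
next
  fix x y assume "x \<in> hcarr hs" "y \<in> hcarr hs"
  then obtain X Y where X: "cau X" "x = cls X" and Y: "cau Y" "y = cls Y" by auto
  show "hadd hs x y \<in> hcarr hs"
    using X Y cls_add[OF X(1) Y(1)] cau_add[OF X(1) Y(1)]
    by (auto intro!: exI[of _ "\<lambda>n. vadd (X n) (Y n)"])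
  show "hadd hs x y = hadd hs y x" by (simp add: add.commute)
  show "hinner hs x y = cnj (hinner hs y x)" using X Y lip_sym[OF X(1) Y(1)] by (simp add: hinner_cls)
  show "hinner hs (hsml hs c x) y = c * hinner hs x y" for c
    using X Y hinner_cls[OF cau_sml[OF X(1)] Y(1), of c] by (simp add: hinner_cls cls_sml lip_sml)
  show "hsml hs c (hadd hs x y) = hadd hs (hsml hs c x) (hsml hs c y)" for c
    by (simp add: algebra_simps)
  fix z assume "z \<in> hcarr hs"
  then obtain Z where Z: "cau Z" "z = cls Z" by auto
  show "hadd hs (hadd hs x y) z = hadd hs x (hadd hs y z)" by (simp add: add.assoc)
  show "hinner hs (hadd hs x y) z = hinner hs x z + hinner hs y z"
    using X Y Z hinner_cls[OF cau_add[OF X(1) Y(1)] Z(1)] by (simp add: hinner_cls cls_add lip_add)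
next
  fix x assume "x \<in> hcarr hs"
  then obtain X where X: "cau X" "x = cls X" by auto
  show sc: "hsml hs c x \<in> hcarr hs" for c
    using X cls_sml[OF X(1)] cau_sml[OF X(1)] by (auto intro!: exI[of _ "\<lambda>n. vsml c (X n)"])
  show "hadd hs (hzero hs) x = x" by simp
  show "\<exists>y\<in>hcarr hs. hadd hs x y = hzero hs"
    by (rule bexI[OF _ sc[of "-1"]]) simp
  show "hsml hs (c + d) x = hadd hs (hsml hs c x) (hsml hs d x)" for c d by (simp add: algebra_simps)
  show "hsml hs (c * d) x = hsml hs c (hsml hs d x)" for c d by (simp add: mult.assoc)
  show "hsml hs 1 x = x" by simp
  have re: "(\<lambda>n. Re (ip (X n) (X n))) \<longlonglongrightarrow> Re (hinner hs x x)"
    unfolding X(2) hinner_cls[OF X(1) X(1)] by (intro tendsto_intros lip_lim X(1))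
  show "0 \<le> Re (hinner hs x x)"
    by (rule LIMSEQ_le_const[OF re]) (use X(1) ip_nonneg in auto)
  show "x = hzero hs" if "hinner hs x x = 0"
  proof -
    have v0: "(\<lambda>n. vn ip (X n)) \<longlonglongrightarrow> 0" using hnorm_cls[OF X(1)] that X(2) by (simp add: hnorm_def)
    \<comment> \<open>Norms tending to zero force all pairings with tests to tend to zero, and these
      limits are the values of the class.\<close>
    have "lip X (\<lambda>_. \<tau> p) = 0" if p: "p \<in> P" for p
    proof (rule lip_eqI, rule tendsto_0_le[OF v0])
      show "\<forall>\<^sub>F n in sequentially. norm (ip (X n) (\<tau> p)) \<le> norm (vn ip (X n)) * vn ip (\<tau> p)"
        using X(1) p by (auto simp: Cauchy_Schwarz)
    qed
    then show ?thesis using X(2) by (auto simp: cls_def)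
  qed
next
  fix X :: "nat \<Rightarrow> 'x \<Rightarrow> complex"
  assume "\<forall>n. X n \<in> hcarr hs" "\<forall>e>0. \<exists>N. \<forall>m\<ge>N. \<forall>n\<ge>N. hnorm hs (hsub hs (X m) (X n)) < e"
  then show "\<exists>L\<in>hcarr hs. (\<lambda>n. hnorm hs (hsub hs (X n) L)) \<longlonglongrightarrow> 0" using hilbert_complete by blast
qed

end

section \<open>The completed representation\<close>

locale tested_isometric_rep = isometric_sip_rep A V vadd vsml vz ip act
  for A :: "('a, 's, 'z) alg_scheme" and V vadd vsml vz ip and act :: "'a \<Rightarrow> 'v \<Rightarrow> 'v" +
  fixes P :: "'s \<Rightarrow> 'x set" and \<tau> :: "'s \<Rightarrow> 'x \<Rightarrow> 'v"
  assumes tested: "\<And>s. s \<in> Obj A \<Longrightarrow> tested_sip (V s) vadd vsml (vz s) ip (P s) (\<tau> s)"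
begin

abbreviation "Cau s \<equiv> tested_sip.cau (V s) vadd vsml ip"
abbreviation "Cls s \<equiv> tested_sip.cls ip (P s) (\<tau> s)"
definition H :: "'s \<Rightarrow> ('x \<Rightarrow> complex) hspace" where
  "H s = tested_sip.hs (V s) vadd vsml ip (P s) (\<tau> s)"
definition \<Phi> :: "'a \<Rightarrow> ('x \<Rightarrow> complex) \<Rightarrow> 'x \<Rightarrow> complex" where
  "\<Phi> a g = Cls (cd A a) (\<lambda>n. act a (tested_sip.rp (V (dm A a)) vadd vsml ip (P (dm A a)) (\<tau> (dm A a)) g n))"

context
  fixes a s t assumes a: "a \<in> fibre A s t"
begin

interpretation S: tested_sip "V s" vadd vsml "vz s" ip "P s" "\<tau> s" using tested fibre_obj[OF a] by blast
interpretation T: tested_sip "V t" vadd vsml "vz t" ip "P t" "\<tau> t" using tested fibre_obj[OF a] by blast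

lemma act_cau: assumes X: "Cau s X" shows "Cau t (\<lambda>n. act a (X n))"
  unfolding T.cau_def
proof (intro conjI allI impI)
  have XV: "X k \<in> V s" for k using X by simp
  show "act a (X k) \<in> V t" for k by (rule act_closed[OF a XV])
  have "vn ip (T.vsub (act a (X m)) (act a (X n))) = vn ip (act a (S.vsub (X m) (X n)))" for m n
    using XV by (intro T.vn_cong) (simp_all add: act_closed[OF a] T.ip_vsub act_vadd[OF a] act_vsml[OF a])
  then have le: "vn ip (T.vsub (act a (X m)) (act a (X n))) \<le> opn a * vn ip (S.vsub (X m) (X n))" for m n
    using opn_bound[OF a] XV by simp
  fix e :: real assume e: "e > 0"
  show "\<exists>N. \<forall>m\<ge>N. \<forall>n\<ge>N. vn ip (T.vsub (act a (X m)) (act a (X n))) < e"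
    by (rule Cauchy_contraction[OF S.cauD[OF X] _ opn_nonneg[OF a] le e]) (use XV in auto)
qed

lemma lip_act: assumes X: "Cau s X" and Y: "Cau t Y"
  shows "T.lip (\<lambda>n. act a (X n)) Y = S.lip X (\<lambda>n. act (inv A a) (Y n))"
  using act_adj[OF a] X Y by (simp add: T.lip_def S.lip_def)

end

lemma act_inv_cau: "a \<in> fibre A s t \<Longrightarrow> Cau t Y \<Longrightarrow> Cau s (\<lambda>n. act (inv A a) (Y n))"
  using act_cau[OF inv_fibre] .

text \<open>By taking adjoints, the limits defining the right-hand side only depend on \<open>Cls s X\<close>.\<close>
lemma \<Phi>_cls:
  assumes a: "a \<in> fibre A s t" and X: "Cau s X"
  shows "\<Phi> a (Cls s X) = Cls t (\<lambda>n. act a (X n))"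
proof -
  interpret S: tested_sip "V s" vadd vsml "vz s" ip "P s" "\<tau> s" using tested fibre_obj[OF a] by blast
  interpret T: tested_sip "V t" vadd vsml "vz t" ip "P t" "\<tau> t" using tested fibre_obj[OF a] by blast
  have ends: "dm A a = s" "cd A a = t" using a by (auto simp: fibre_def)
  have "T.lip (\<lambda>n. act a (S.rp (S.cls X) n)) (\<lambda>_. \<tau> t p) = T.lip (\<lambda>n. act a (X n)) (\<lambda>_. \<tau> t p)" if p: "p \<in> P t" for p
  proof -
    note \<tau> = T.cau_\<tau>[OF p]
    have "T.lip (\<lambda>n. act a (S.rp (S.cls X) n)) (\<lambda>_. \<tau> t p) = S.lip (S.rp (S.cls X)) (\<lambda>_. act (inv A a) (\<tau> t p))"
      using lip_act[OF a S.rp(1)[OF X] \<tau>] .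
    also have "\<dots> = S.lip X (\<lambda>_. act (inv A a) (\<tau> t p))"
      using act_inv_cau[OF a \<tau>] S.rp[OF X] X by (intro S.lip_cong) auto
    also have "\<dots> = T.lip (\<lambda>n. act a (X n)) (\<lambda>_. \<tau> t p)"
      using lip_act[OF a X \<tau>] by simp
    finally show ?thesis .
  qed
  then show ?thesis by (auto simp: \<Phi>_def ends T.cls_def fun_eq_iff)
qed

lemma hilbert_H: "s \<in> Obj A \<Longrightarrow> hilbert_space (H s)"
  unfolding H_def by (rule tested_sip.hilbert_hs[OF tested])

lemma H_simps:
  assumes "s \<in> Obj A"
  shows "hcarr (H s) = {Cls s X |X. Cau s X}" "hadd (H s) g h = (\<lambda>p. g p + h p)"
    "hsml (H s) c g = (\<lambda>p. c * g p)"
  unfolding H_def by (simp_all add: tested_sip.hs_simps[OF tested[OF assms]])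

text \<open>The action obeys its laws only up to null vectors. The pairings still agree term by
  term, and a class sees nothing else.\<close>

lemma Cls_eqI:
  assumes "s \<in> Obj A" "\<And>n p. p \<in> P s \<Longrightarrow> ip (X n) (\<tau> s p) = ip (Y n) (\<tau> s p)"
  shows "Cls s X = Cls s Y"
  using assms by (auto simp: tested_sip.cls_def[OF tested] tested_sip.lip_def[OF tested] fun_eq_iff)

lemma inj_star_rep_completion: "inj_star_rep A H \<Phi>"
  unfolding inj_star_rep_def
proof (intro conjI ballI allI impI)
  fix s assume "s \<in> Obj A" then show "hilbert_space (H s)" by (rule hilbert_H)
next
  fix a assume "a \<in> Carr A"
  then obtain s t where a: "a \<in> fibre A s t" and ends: "dm A a = s" "cd A a = t" using carr_fibre by blast
  have s: "s \<in> Obj A" and t: "t \<in> Obj A" using fibre_obj[OF a] by auto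
  interpret S: tested_sip "V s" vadd vsml "vz s" ip "P s" "\<tau> s" by (rule tested[OF s])
  interpret T: tested_sip "V t" vadd vsml "vz t" ip "P t" "\<tau> t" by (rule tested[OF t])
  show "bounded_op (H (dm A a)) (H (cd A a)) (\<Phi> a)"
    unfolding bounded_op_def ends
  proof (intro conjI ballI allI)
    fix x assume "x \<in> hcarr (H s)"
    then obtain X where X: "Cau s X" "x = Cls s X" by (auto simp: H_simps[OF s])
    show "\<Phi> a x \<in> hcarr (H t)" using \<Phi>_cls[OF a X(1)] act_cau[OF a X(1)] X(2) by (auto simp: H_simps[OF t])
    show "\<Phi> a (hsml (H s) c x) = hsml (H t) c (\<Phi> a x)" for c
    proof -
      have "\<Phi> a (hsml (H s) c x) = \<Phi> a (Cls s (\<lambda>n. vsml c (X n)))"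
        using X by (simp add: H_simps[OF s] S.cls_sml)
      also have "\<dots> = Cls t (\<lambda>n. act a (vsml c (X n)))" by (rule \<Phi>_cls[OF a S.cau_sml[OF X(1)]])
      also have "\<dots> = Cls t (\<lambda>n. vsml c (act a (X n)))"
        using X(1) act_cau[OF a X(1)] by (intro Cls_eqI[OF t]) (simp add: act_vsml[OF a] T.ip_sml act_closed[OF a])
      also have "\<dots> = hsml (H t) c (\<Phi> a x)"
        using X act_cau[OF a X(1)] by (simp add: H_simps[OF t] \<Phi>_cls[OF a] T.cls_sml)
      finally show ?thesis .
    qed
    fix y assume "y \<in> hcarr (H s)"
    then obtain Y where Y: "Cau s Y" "y = Cls s Y" by (auto simp: H_simps[OF s])
    have "\<Phi> a (hadd (H s) x y) = \<Phi> a (Cls s (\<lambda>n. vadd (X n) (Y n)))"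
      using X Y by (simp add: H_simps[OF s] S.cls_add)
    also have "\<dots> = Cls t (\<lambda>n. act a (vadd (X n) (Y n)))" by (rule \<Phi>_cls[OF a S.cau_add[OF X(1) Y(1)]])
    also have "\<dots> = Cls t (\<lambda>n. vadd (act a (X n)) (act a (Y n)))"
      using X(1) Y(1) by (intro Cls_eqI[OF t]) (simp add: act_vadd[OF a] T.ip_add act_closed[OF a])
    also have "\<dots> = hadd (H t) (\<Phi> a x) (\<Phi> a y)"
      using X Y act_cau[OF a X(1)] act_cau[OF a Y(1)] by (simp add: H_simps[OF t] \<Phi>_cls[OF a] T.cls_add)
    finally show "\<Phi> a (hadd (H s) x y) = hadd (H t) (\<Phi> a x) (\<Phi> a y)" .
  next
    have "hnorm (H t) (\<Phi> a x) \<le> opn a * hnorm (H s) x" if x: "x \<in> hcarr (H s)" for x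
    proof -
      obtain X where X: "Cau s X" "x = Cls s X" using x by (auto simp: H_simps[OF s])
      have l: "(\<lambda>n. vn ip (act a (X n))) \<longlonglongrightarrow> hnorm (H t) (\<Phi> a x)"
        using T.hnorm_cls[OF act_cau[OF a X(1)]] by (simp add: X(2) \<Phi>_cls[OF a X(1)] H_def)
      have r: "(\<lambda>n. opn a * vn ip (X n)) \<longlonglongrightarrow> opn a * hnorm (H s) x"
        using S.hnorm_cls[OF X(1)] by (intro tendsto_intros) (simp add: X(2) H_def)
      show ?thesis
        by (rule LIMSEQ_le[OF l r]) (use opn_bound[OF a] X(1) in auto)
    qed
    then show "\<exists>C. \<forall>x\<in>hcarr (H s). hnorm (H t) (\<Phi> a x) \<le> C * hnorm (H s) x" by blast
  qed
  fix x y assume "x \<in> hcarr (H (cd A a))" "y \<in> hcarr (H (dm A a))"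
  then obtain X Y where X: "Cau t X" "x = Cls t X" and Y: "Cau s Y" "y = Cls s Y"
    unfolding ends by (auto simp: H_simps[OF s] H_simps[OF t])
  have "hinner (H s) (\<Phi> (inv A a) x) y = S.lip (\<lambda>n. act (inv A a) (X n)) Y"
    using S.hinner_cls[OF act_inv_cau[OF a X(1)] Y(1)] by (simp add: X(2) Y(2) \<Phi>_cls[OF inv_fibre[OF a] X(1)] H_def)
  also have "\<dots> = T.lip X (\<lambda>n. act a (Y n))"
    using lip_act[OF inv_fibre[OF a] X(1) Y(1)] inv_inv[OF a] by simp
  also have "\<dots> = hinner (H t) x (\<Phi> a y)"
    using T.hinner_cls[OF X(1) act_cau[OF a Y(1)]] by (simp add: X(2) Y(2) \<Phi>_cls[OF a Y(1)] H_def)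
  finally show "hinner (H (dm A a)) (\<Phi> (inv A a) x) y = hinner (H (cd A a)) x (\<Phi> a y)" unfolding ends .
next
  fix s t a b c x assume s: "s \<in> Obj A" and t: "t \<in> Obj A" and a: "a \<in> fibre A s t" and b: "b \<in> fibre A s t"
    and "x \<in> hcarr (H s)"
  then obtain X where X: "Cau s X" "x = Cls s X" by (auto simp: H_simps[OF s])
  interpret S: tested_sip "V s" vadd vsml "vz s" ip "P s" "\<tau> s" by (rule tested[OF s])
  interpret T: tested_sip "V t" vadd vsml "vz t" ip "P t" "\<tau> t" by (rule tested[OF t])
  have "\<Phi> (add A a b) x = Cls t (\<lambda>n. act (add A a b) (X n))" unfolding X(2) by (rule \<Phi>_cls[OF add_fibre[OF a b] X(1)])
  also have "\<dots> = Cls t (\<lambda>n. vadd (act a (X n)) (act b (X n)))"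
    using X(1) by (intro Cls_eqI[OF t]) (simp add: act_add[OF a b] T.ip_add act_closed[OF a] act_closed[OF b])
  also have "\<dots> = hadd (H t) (\<Phi> a x) (\<Phi> b x)"
    using X act_cau[OF a X(1)] act_cau[OF b X(1)] by (simp add: H_simps[OF t] \<Phi>_cls[OF a] \<Phi>_cls[OF b] T.cls_add)
  finally show "\<Phi> (add A a b) x = hadd (H t) (\<Phi> a x) (\<Phi> b x)" .
  have "\<Phi> (sml A c a) x = Cls t (\<lambda>n. act (sml A c a) (X n))" unfolding X(2) by (rule \<Phi>_cls[OF sml_fibre[OF a] X(1)])
  also have "\<dots> = Cls t (\<lambda>n. vsml c (act a (X n)))"
    using X(1) by (intro Cls_eqI[OF t]) (simp add: act_sml[OF a] T.ip_sml act_closed[OF a])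
  also have "\<dots> = hsml (H t) c (\<Phi> a x)"
    using X act_cau[OF a X(1)] by (simp add: H_simps[OF t] \<Phi>_cls[OF a] T.cls_sml)
  finally show "\<Phi> (sml A c a) x = hsml (H t) c (\<Phi> a x)" .
next
  fix a b x assume ab: "a \<in> Carr A" "b \<in> Carr A" "dm A a = cd A b" and x: "x \<in> hcarr (H (dm A b))"
  obtain s u t where a: "a \<in> fibre A u t" and b: "b \<in> fibre A s u" and ends: "dm A b = s"
    using ab carr_fibre by metis
  have s: "s \<in> Obj A" and u: "u \<in> Obj A" and t: "t \<in> Obj A" using fibre_obj[OF a] fibre_obj[OF b] by auto
  obtain X where X: "Cau s X" "x = Cls s X" using x unfolding ends by (auto simp: H_simps[OF s])
  interpret S: tested_sip "V s" vadd vsml "vz s" ip "P s" "\<tau> s" by (rule tested[OF s])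
  interpret T: tested_sip "V t" vadd vsml "vz t" ip "P t" "\<tau> t" by (rule tested[OF t])
  have "\<Phi> (mul A a b) x = Cls t (\<lambda>n. act (mul A a b) (X n))" unfolding X(2) by (rule \<Phi>_cls[OF mul_fibre[OF a b] X(1)])
  also have "\<dots> = Cls t (\<lambda>n. act a (act b (X n)))"
    using X(1) by (intro Cls_eqI[OF t]) (simp add: act_mul[OF a b])
  also have "\<dots> = \<Phi> a (\<Phi> b x)"
    unfolding X(2) \<Phi>_cls[OF b X(1)] by (rule \<Phi>_cls[OF a act_cau[OF b X(1)], symmetric])
  finally show "\<Phi> (mul A a b) x = \<Phi> a (\<Phi> b x)" .
next
  fix a b assume ab: "a \<in> Carr A" "b \<in> Carr A" "dm A a = dm A b" "cd A a = cd A b"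
    and eq: "\<forall>x\<in>hcarr (H (dm A a)). \<Phi> a x = \<Phi> b x"
  obtain s t where a: "a \<in> fibre A s t" and b: "b \<in> fibre A s t" and ends: "dm A a = s"
    using ab carr_fibre by metis
  have s: "s \<in> Obj A" and t: "t \<in> Obj A" using fibre_obj[OF a] by auto
  interpret S: tested_sip "V s" vadd vsml "vz s" ip "P s" "\<tau> s" by (rule tested[OF s])
  interpret T: tested_sip "V t" vadd vsml "vz t" ip "P t" "\<tau> t" by (rule tested[OF t])
  interpret F: cvs "fibre A s t" "add A" "sml A" "zer A s t" by (rule cvs_fibre[OF s t])
  \<comment> \<open>For \<open>c = a - b\<close>, evaluating both operators on constant sequences
    gives \<open><a v, c v> = <b v, c v>\<close>, hence \<open>||c v|| = 0\<close>. So
    \<open>opn c = 0\<close>, and isometry makes \<open>c\<close> zero.\<close>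
  let ?c = "add A a (sml A (-1) b)"
  have c: "?c \<in> fibre A s t" using a b by simp
  have "opn ?c \<le> 0"
  proof (rule opn_le[OF c])
    fix v assume v: "v \<in> V s"
    note av = act_closed[OF a v] and bv = act_closed[OF b v] and cv = act_closed[OF c v]
    have C: "Cau s (\<lambda>_. v)" "Cau t (\<lambda>_. act a v)" "Cau t (\<lambda>_. act b v)" "Cau t (\<lambda>_. act ?c v)"
      using S.cau_const[OF v] T.cau_const av bv cv by auto
    have "Cls t (\<lambda>_. act a v) = Cls t (\<lambda>_. act b v)"
      using eq C(1) \<Phi>_cls[OF a C(1)] \<Phi>_cls[OF b C(1)] unfolding ends by (auto simp: H_simps[OF s])
    then have "T.lip (\<lambda>_. act a v) (\<lambda>_. act ?c v) = T.lip (\<lambda>_. act b v) (\<lambda>_. act ?c v)"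
      by (intro T.lip_cong C)
    then have "ip (act a v) (act ?c v) = ip (act b v) (act ?c v)" by (simp add: T.lip_def)
    then have "ip (act ?c v) (act ?c v) = 0"
      using act_add[OF a sml_fibre[OF b] v cv] act_sml[OF b v cv] by simp
    then show "vn ip (act ?c v) \<le> 0 * vn ip v" by (simp add: vn_def)
  qed simp
  then have "?c = zer A s t" using isometric[OF c] nrm_eq_0[OF c] nrm_nonneg[OF c] by simp
  then have "add A ?c b = b" using b by simp
  then show "a = b" using a b by (simp add: F.ad_assoc)
qed

end

text \<open>A pair \<open>(a, b)\<close> of elements is coded as the function \<open>\<delta>\<^sub>a + 2 \<delta>\<^sub>b\<close>, so that the completions become spaces of
  functions on \<open>'a \<Rightarrow> complex\<close>.\<close>
definition pair_code :: "'a \<Rightarrow> 'a \<Rightarrow> 'a \<Rightarrow> complex" where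
  "pair_code a b = (\<lambda>x. (if x = a then 1 else 0) + (if x = b then 2 else 0))"

lemma pair_code_inject: "pair_code a b = pair_code a' b' \<Longrightarrow> a = a' \<and> b = b'"
proof -
  assume eq: "pair_code a b = pair_code a' b'"
  have 1: "pair_code a b x \<in> {1, 3} \<longleftrightarrow> x = a" for a b x :: 'a by (auto simp: pair_code_def)
  have 2: "pair_code a b x \<in> {2, 3} \<longleftrightarrow> x = b" for a b x :: 'a by (auto simp: pair_code_def)
  show ?thesis using 1[of a b] 1[of a' b'] 2[of a b] 2[of a' b'] eq by metis
qed

context section_rep
begin

definition codes :: "'s \<Rightarrow> ('a \<Rightarrow> complex) set" where
  "codes s = {pair_code a b |a b. a \<in> Carr A \<and> b \<in> fibre A (dm A a) s}"

definition decode :: "'s \<Rightarrow> ('a \<Rightarrow> complex) \<Rightarrow> 'a \<Rightarrow> 'a" where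
  "decode s p = (THE v. \<exists>a b. p = pair_code a b \<and> v = delta s a b)"

lemma decode_code: "decode s (pair_code a b) = delta s a b"
  unfolding decode_def by (rule the_equality) (auto dest: pair_code_inject)

text \<open>A section is the finite sum of its \<open>delta\<close> components, at least under
  \<open>ips\<close>; pairing with it is therefore a finite sum of pairings with coded tests.
  Distinct base points have distinct codes, so the sum can be reindexed by codes.\<close>

lemma tested_sections: assumes s: "s \<in> Obj A"
  shows "tested_sip (Sec s) sadd ssml (sz s) ips (codes s) (decode s)"
proof (intro tested_sip.intro tested_sip_axioms.intro)
  show "sip (Sec s) sadd ssml (sz s) ips" by (rule sip_sections[OF s])
  show "decode s p \<in> Sec s" if "p \<in> codes s" for p
    using that by (auto simp: codes_def decode_code intro: delta_closed)
  fix w assume w: "w \<in> Sec s"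
  let ?c = "\<lambda>a. pair_code a (w a)"
  have inj: "inj_on ?c (supp s w)" by (rule inj_onI) (auto dest: pair_code_inject)
  have "ips v w = (\<Sum>p\<in>?c ` supp s w. ips v (decode s p))" if "v \<in> Sec s" for v
    unfolding sum.reindex[OF inj] by (simp add: decode_code sip_decompose[OF that w])
  moreover have "?c ` supp s w \<subseteq> codes s"
    using Sec_fibre[OF w] by (auto simp: codes_def supp_def)
  ultimately show "\<exists>F. finite F \<and> F \<subseteq> codes s \<and> (\<forall>v\<in>Sec s. ips v w = (\<Sum>p\<in>F. ips v (decode s p)))"
    using Sec_finite[OF w] by (intro exI[of _ "?c ` supp s w"]) auto
qed

sublocale tested_isometric_rep A Sec sadd ssml sz ips sact codes decode
  by (intro tested_isometric_rep.intro tested_isometric_rep_axioms.intro isometric_sip_rep_axioms tested_sections)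

lemma inj_star_rep_exists: "\<exists>H \<Phi>. inj_star_rep A (H :: 's \<Rightarrow> (('a \<Rightarrow> complex) \<Rightarrow> complex) hspace) \<Phi>"
  using inj_star_rep_completion by blast

end

theorem mainTheorem11:
  fixes A :: "('a, 's) alg"
  assumes "cstar_algebroid A" and "unital A"
  shows "((\<forall>s\<in>Obj A. \<forall>t\<in>Obj A. \<forall>x\<in>fibre A s t. \<exists>a\<in>fibre A s s.
              mul A (inv A x) x = mul A (inv A a) a)
          \<longleftrightarrow> (\<exists>H \<Phi>. inj_star_rep A (H :: 's \<Rightarrow> (('a \<Rightarrow> complex) \<Rightarrow> complex) hspace) \<Phi>))
       \<and> ((\<exists>H \<Phi>. inj_star_rep A (H :: 's \<Rightarrow> 'h hspace) \<Phi>) \<longrightarrow>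
          (\<forall>s\<in>Obj A. \<forall>t\<in>Obj A. \<forall>x\<in>fibre A s t. \<exists>a\<in>fibre A s s.
              mul A (inv A x) x = mul A (inv A a) a))
       \<and> ((\<forall>s\<in>Obj A. \<forall>t\<in>Obj A. \<forall>x\<in>fibre A s t. \<exists>a\<in>fibre A s s.
              mul A (inv A x) x = mul A (inv A a) a)
          \<longleftrightarrow> (\<forall>n::nat. n \<ge> 1 \<longrightarrow>
                 (\<exists>N. extends_norms n A N \<and> cstar_algebroid (amp n A N))))
       \<and> ((\<forall>s\<in>Obj A. \<forall>t\<in>Obj A. \<forall>x\<in>fibre A s t. \<exists>a\<in>fibre A s s.
              mul A (inv A x) x = mul A (inv A a) a)
          \<longleftrightarrow> (\<exists>N. extends_norms 2 A N \<and> cstar_algebroid (amp 2 A N)))"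
proof -
  interpret cstaralg A by unfold_locales (fact assms(1))
  let ?P = "star_positive A"
  note iff = star_positive_iff[OF assms(2)]
  have 2: "\<exists>H \<Phi>. inj_star_rep A (H :: 's \<Rightarrow> (('a \<Rightarrow> complex) \<Rightarrow> complex) hspace) \<Phi>" if ?P
    using section_rep_exists[OF assms(2) that] section_rep.inj_star_rep_exists by blast
  have 3: "\<exists>N. extends_norms n A N \<and> cstar_algebroid (amp n A N)" if ?P "n \<ge> 1" for n
  proof -
    from section_rep_exists[OF assms(2) that(1)] obtain \<epsilon> f where "section_rep A \<epsilon> f" by blast
    then interpret section_rep A \<epsilon> f .
    show ?thesis using amp_norm_exists[of n] that(2) by simp
  qed
  have 4: ?P if "\<exists>N. extends_norms 2 A N \<and> cstar_algebroid (amp 2 A N)"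
    using that star_positive_if_amp2[OF assms(2)] by blast
  show ?thesis
    unfolding iff
  proof (intro conjI iffI impI allI)
    \<comment> \<open>Condition (3) contains (3') as the case \<open>n = 2\<close>, and (3') already
      gives positivity.\<close>
    show ?P if "\<forall>n\<ge>1. \<exists>N. extends_norms n A N \<and> cstar_algebroid (amp n A N)"
      using that 4 by (metis one_le_numeral)
  \<comment> \<open>\<open>star_positive_if_rep\<close> is polymorphic in the type of vectors, so it
    serves the fixed type of the equivalence as well as the arbitrary \<open>'h\<close>.\<close>
  qed (use 2 3 4 star_positive_if_rep[OF assms(2)] in auto)
qed

end
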